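(* The following unlabelled versions hold, where for $\mathbf{X}\subseteq\mathbf{S}$ we write $[\mathbf{X}]$ for the set of isomorphism classes of members of $\mathbf{X}$. (a) For any two finite groups $G$ and $H$, each of the limits \[ \lim_{n\to\infty} \frac{| [\{\mathcal{M} \in \mathbf{S}_n : H \leq \mathrm{Aut}(\mathcal{M})\}] |}{| [\{\mathcal{M} \in \mathbf{S}_n : G \leq \mathrm{Aut}(\mathcal{M})\}] |}, \ \lim_{n\to\infty} \frac{| [\{\mathcal{M} \in \mathbf{S}_n : H \cong \mathrm{Aut}(\mathcal{M})\}] |}{| [\{\mathcal{M} \in \mathbf{S}_n : G \cong \mathrm{Aut}(\mathcal{M})\}] |}, \ \lim_{n\to\infty} \frac{| [\{\mathcal{M} \in \mathbf{S}_n : G \cong \mathrm{Aut}(\mathcal{M})\}] |}{| [\{\mathcal{M} \in \mathbf{S}_n : G \leq \mathrm{Aut}(\mathcal{M})\}] |} \] exists in $\mathbb{Q}\cup\{\infty\}$. (b) Let $\mathbf{S}'$ be any one of the classes $\{\mathcal{M} \in \mathbf{S} : G \cong \mathrm{Aut}(\mathcal{M})\}$, $\{\mathcal{M} \in \mathbf{S} : G \leq \mathrm{Aut}(\mathcal{M})\}$ (for a finite group $G$), or $\mathbf{S}(\mathrm{spt}^* = m)$, $\mathbf{S}(\mathrm{spt} \geq m)$, $\mathbf{S}(\mathrm{spt}^* \geq m)$ (for an integer $m\ge 2$), and $\mathbf{S}'_n=\mathbf{S}'\cap\mathbf{S}_n$. Then for every first-order sentence $\varphi$, the ratio $|[\{\mathcal{M}\in\mathbf{S}'_n:\mathcal{M}\models\varphi\}]|/|[\mathbf{S}'_n]|$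 converges as $n\to\infty$; moreover there is a finite set $A\subseteq\mathbb{Q}$ such that for every $\varphi$ this limit belongs to $A$.
   Context: Fix a finite relational vocabulary $\{R_1,\dots,R_\rho\}$, $R_i$ of arity $r_i$, with maximal arity $r\ge 2$. $\mathbf{S}_n$ is the set of all structures with universe $[n]=\{1,\dots,n\}$, $\mathbf{S}=\bigcup_{n\ge1}\mathbf{S}_n$. For $\mathcal{M}\in\mathbf{S}$, $[\mathcal{M}]=\{\mathcal{N}\in\mathbf{S}:\mathcal{N}\cong\mathcal{M}\}$ and for $\mathbf{X}\subseteq\mathbf{S}$, $[\mathbf{X}]=\{[\mathcal{M}]:\mathcal{M}\in\mathbf{X}\}$. For permutations $f_1,\dots,f_k$ of a set, $\mathrm{spt}(f_1,\dots,f_k)$ is the number of elements moved by some element of $\langle f_1,\dots,f_k\rangle$. $\mathrm{spt}(\mathcal{M})=\max\{\mathrm{spt}(f):f\in\mathrm{Aut}(\mathcal{M})\}$; $\mathrm{spt}^*(\mathcal{M})$ is the number of elements of $M$ moved by some automorphism of $\mathcal{M}$. $\mathbf{S}(\mathrm{spt}^*=m)=\{\mathcal{M}\in\mathbf{S}:\mathrm{spt}^*(\mathcal{M})=m\}$ and similarly for the other conditions. $G\le H$ means $G$ is isomorphic to a subgroup of $H$. *)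

theory Defs
  imports Complex_Main "HOL-Combinatorics.Permutations" "HOL-Algebra.Generated_Groups"
begin

text \<open>
  A finite relational vocabulary is given by an arity function \<open>ar\<close> on a finite type \<open>'i\<close> of
  relation symbols.  A relation of arity \<open>k\<close> on a set is a set of lists of length \<open>k\<close>.
\<close>

record ('i, 'a) rel_structure =
  univ :: "'a set"
  rel :: "'i \<Rightarrow> 'a list set"

definition Structs_n :: "('i \<Rightarrow> nat) \<Rightarrow> nat \<Rightarrow> ('i, nat) rel_structure set" where
  "Structs_n ar n = {M. univ M = {1..n} \<and>
     (\<forall>i. rel M i \<subseteq> {xs. length xs = ar i \<and> set xs \<subseteq> univ M})}"

definition Structs :: "('i \<Rightarrow> nat) \<Rightarrow> ('i, nat) rel_structure set" where
  "Structs ar = (\<Union>n\<in>{1..}. Structs_n ar n)"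

text \<open>
  Tuples of the wrong length need not be excluded here: in the structures considered they belong
  to no relation.
\<close>

definition isomorphism :: "('a \<Rightarrow> 'b) \<Rightarrow> ('i, 'a) rel_structure \<Rightarrow> ('i, 'b) rel_structure \<Rightarrow> bool" where
  "isomorphism f M N \<longleftrightarrow> bij_betw f (univ M) (univ N) \<and>
     (\<forall>i. \<forall>xs \<in> lists (univ M). xs \<in> rel M i \<longleftrightarrow> map f xs \<in> rel N i)"

definition isomorphic :: "('i, 'a) rel_structure \<Rightarrow> ('i, 'b) rel_structure \<Rightarrow> bool" where
  "isomorphic M N \<longleftrightarrow> (\<exists>f. isomorphism f M N)"

definition iso_class :: "('i \<Rightarrow> nat) \<Rightarrow> ('i, nat) rel_structure \<Rightarrow> ('i, nat) rel_structure set" where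
  "iso_class ar M = {N \<in> Structs ar. isomorphic N M}"

definition iso_classes ::
    "('i \<Rightarrow> nat) \<Rightarrow> ('i, nat) rel_structure set \<Rightarrow> ('i, nat) rel_structure set set" where
  "iso_classes ar X = iso_class ar ` X"

definition Sym :: "'a set \<Rightarrow> ('a \<Rightarrow> 'a) monoid" where
  "Sym \<Omega> = \<lparr>carrier = {f. f permutes \<Omega>}, mult = (\<circ>), one = id\<rparr>"

definition Aut :: "('i, 'a) rel_structure \<Rightarrow> ('a \<Rightarrow> 'a) monoid" where
  "Aut M = Sym (univ M) \<lparr>carrier := {f. f permutes univ M \<and> isomorphism f M M}\<rparr>"

definition embeds_in :: "('a, 'x) monoid_scheme \<Rightarrow> ('b, 'y) monoid_scheme \<Rightarrow> bool" where
  "embeds_in G H \<longleftrightarrow> (\<exists>K. subgroup K H \<and> G \<cong> H\<lparr>carrier := K\<rparr>)"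

definition spt_perms :: "'a set \<Rightarrow> ('a \<Rightarrow> 'a) set \<Rightarrow> nat" where
  "spt_perms \<Omega> F = card {a \<in> \<Omega>. \<exists>g \<in> generate (Sym \<Omega>) F. g a \<noteq> a}"

definition spt :: "('i, 'a) rel_structure \<Rightarrow> nat" where
  "spt M = Max {spt_perms (univ M) {f} | f. f \<in> carrier (Aut M)}"

definition spt_star :: "('i, 'a) rel_structure \<Rightarrow> nat" where
  "spt_star M = card {a \<in> univ M. \<exists>f \<in> carrier (Aut M). f a \<noteq> a}"

text \<open>
  First-order logic with equality; the remaining connectives and quantifiers are definable.
  Variables are natural numbers.
\<close>

datatype 'i form =
    Rel 'i "nat list"
  | Eq nat nat
  | Neg "'i form"
  | Conj "'i form" "'i form"
  | Forall nat "'i form"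

primrec wf_form :: "('i \<Rightarrow> nat) \<Rightarrow> 'i form \<Rightarrow> bool" where
  "wf_form ar (Rel i xs) \<longleftrightarrow> length xs = ar i"
| "wf_form ar (Eq x y) \<longleftrightarrow> True"
| "wf_form ar (Neg p) \<longleftrightarrow> wf_form ar p"
| "wf_form ar (Conj p q) \<longleftrightarrow> wf_form ar p \<and> wf_form ar q"
| "wf_form ar (Forall x p) \<longleftrightarrow> wf_form ar p"

primrec free_vars :: "'i form \<Rightarrow> nat set" where
  "free_vars (Rel i xs) = set xs"
| "free_vars (Eq x y) = {x, y}"
| "free_vars (Neg p) = free_vars p"
| "free_vars (Conj p q) = free_vars p \<union> free_vars q"
| "free_vars (Forall x p) = free_vars p - {x}"

definition is_sentence :: "('i \<Rightarrow> nat) \<Rightarrow> 'i form \<Rightarrow> bool" where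
  "is_sentence ar p \<longleftrightarrow> wf_form ar p \<and> free_vars p = {}"

primrec sat :: "('i, 'a) rel_structure \<Rightarrow> (nat \<Rightarrow> 'a) \<Rightarrow> 'i form \<Rightarrow> bool" where
  "sat M e (Rel i xs) \<longleftrightarrow> map e xs \<in> rel M i"
| "sat M e (Eq x y) \<longleftrightarrow> e x = e y"
| "sat M e (Neg p) \<longleftrightarrow> \<not> sat M e p"
| "sat M e (Conj p q) \<longleftrightarrow> sat M e p \<and> sat M e q"
| "sat M e (Forall x p) \<longleftrightarrow> (\<forall>a \<in> univ M. sat M (e(x := a)) p)"

definition models :: "('i, 'a) rel_structure \<Rightarrow> 'i form \<Rightarrow> bool" where
  "models M p \<longleftrightarrow> (\<forall>e. range e \<subseteq> univ M \<longrightarrow> sat M e p)"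

definition class_ratio ::
    "('i \<Rightarrow> nat) \<Rightarrow> ('i, nat) rel_structure set \<Rightarrow> ('i, nat) rel_structure set \<Rightarrow> real" where
  "class_ratio ar X Y = real (card (iso_classes ar X)) / real (card (iso_classes ar Y))"

text \<open>
  The sequences in question are nonnegative, so that \<open>\<infinity>\<close> means divergence to \<open>+\<infinity>\<close>.
\<close>

definition has_limit_in_Rats_or_infinity :: "(nat \<Rightarrow> real) \<Rightarrow> bool" where
  "has_limit_in_Rats_or_infinity X \<longleftrightarrow>
     (\<exists>q \<in> \<rat>. X \<longlonglongrightarrow> q) \<or> filterlim X at_top sequentially"

end

theory Submission
  imports Defs "HOL-Computational_Algebra.Polynomial" "HOL-Real_Asymp.Real_Asymp"
begin

text \<open>
  A structure on \<open>{1..n}\<close> is a set \<open>A\<close> of labelled tuples, and by Burnside's lemma the number of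
  isomorphism classes in a class is \<open>\<Sum>A. |Aut A| / n!\<close>.  Sorting by the support of the automorphism
  group, a permutation group \<open>P\<close> without fixed points on \<open>{1..t}\<close> contributes
  \<open>|P| / (t! (n - t)!)\<close> times the number of \<open>A\<close> with automorphism group exactly \<open>P\<close>.

  A \<open>P\<close>-invariant structure consists of a structure on \<open>{1..t}\<close> and an invariant set of tuples that
  leave \<open>{1..t}\<close>.  The latter almost surely has no symmetries beyond those forced by its \<open>P\<close>-orbits,
  and given the former it satisfies all extension axioms over \<open>{1..t}\<close> almost surely, which gives a
  zero-one law.  So the number of structures with group \<open>P\<close> satisfying a sentence is asymptotically
  an integer multiple of \<open>2\<close> to the number of orbits on tuples leaving \<open>{1..t}\<close>, which by
  Burnside's lemma is a polynomial in \<open>n\<close>; hence any two such contributions have a ratio with limit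
  in \<open>\<rat> \<union> {\<infinity>}\<close>.  A group with support \<open>t\<close> has an element moving at least \<open>t/2\<close> points, which costs
  a factor exponential in \<open>t n\<^sup>r\<^sup>-\<^sup>1\<close>; so all but finitely many groups are negligible in each class.
\<close>

text \<open>A tuple that leaves \<open>{1..t}\<close> contains at most \<open>rmax - 1\<close>
  points of \<open>{1..t}\<close>, so invariance of the outer part may admit more permutations than
  \<open>P\<close>: for maximal arity 2, all those that preserve every \<open>P\<close>-orbit on
  points. This enlarged group is \<open>hat t P\<close>, and automorphism group \<open>P\<close> is
  possible only if the structure on \<open>{1..t}\<close> cuts it down to \<open>P\<close>; such
  structures form the finite set \<open>base t P\<close>. A sentence enters the asymptotics only
  through its limit, 0 or 1, over each member of \<open>base t P\<close>. As finitely many pairs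
  \<open>(t, P)\<close> matter, the possible limits can be listed before the sentence is known. When
  groups are compared, the scale n^(rmax-1) is decisive: invariance under a fixed group loses at
  most K n^(rmax-1) in the exponent of 2, while support \<open>t\<close> loses at least (t/6)
  n^(rmax-1). Hence supports beyond a multiple of \<open>K\<close> lose against any group that
  occurs. Rationality comes from integrality: exponents with a constant difference differ by an
  integer, and for a nonconstant difference the quotient tends to 0 or infinity.\<close>

section \<open>Finite permutation groups\<close>

text \<open>The group theory library takes over the notation of the inverse function.\<close>
abbreviation invf :: "('a \<Rightarrow> 'b) \<Rightarrow> 'b \<Rightarrow> 'a" where
  "invf \<equiv> inv_into UNIV"

text \<open>A bare set of functions rather than a group record: a function that permutes
  \<open>{1..t}\<close> is the identity elsewhere, so the same set \<open>P\<close> is a group on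
  \<open>{1..t}\<close> and on every larger \<open>{1..n}\<close>.\<close>

definition pgroup :: "'a set \<Rightarrow> ('a \<Rightarrow> 'a) set \<Rightarrow> bool" where
  "pgroup S P \<longleftrightarrow> id \<in> P \<and> (\<forall>p\<in>P. p permutes S) \<and> (\<forall>p\<in>P. \<forall>q\<in>P. p \<circ> q \<in> P) \<and>
     (\<forall>p\<in>P. invf p \<in> P)"

text \<open>The laws are required on \<open>X\<close> only. The locale is instantiated with points,
  with labelled tuples and with whole sets of tuples.\<close>

locale finite_action =
  fixes S :: "'a set" and P :: "('a \<Rightarrow> 'a) set" and act :: "('a \<Rightarrow> 'a) \<Rightarrow> 'x \<Rightarrow> 'x" and X :: "'x set"
  assumes pgroup: "pgroup S P" and finite_P: "finite P" and finite_X: "finite X"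
    and act_id: "x \<in> X \<Longrightarrow> act id x = x"
    and act_comp: "p \<in> P \<Longrightarrow> q \<in> P \<Longrightarrow> x \<in> X \<Longrightarrow> act (p \<circ> q) x = act p (act q x)"
    and act_closed: "p \<in> P \<Longrightarrow> x \<in> X \<Longrightarrow> act p x \<in> X"
begin

definition orb :: "'x \<Rightarrow> 'x set" where
  "orb x = (\<lambda>p. act p x) ` P"

lemma P_id: "id \<in> P" and P_comp: "p \<in> P \<Longrightarrow> q \<in> P \<Longrightarrow> p \<circ> q \<in> P"
  and P_inv: "p \<in> P \<Longrightarrow> invf p \<in> P" and P_perm: "p \<in> P \<Longrightarrow> p permutes S"
  using pgroup by (auto simp: pgroup_def)

lemma inv_comp: "p \<in> P \<Longrightarrow> invf p \<circ> p = id" "p \<in> P \<Longrightarrow> p \<circ> invf p = id"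
  using P_perm permutes_inv_o by blast+

lemma act_inv: "p \<in> P \<Longrightarrow> x \<in> X \<Longrightarrow> act (invf p) (act p x) = x"
  "p \<in> P \<Longrightarrow> x \<in> X \<Longrightarrow> act p (act (invf p) x) = x"
  by (metis act_comp act_id inv_comp P_inv)+

lemma finite_orb: "finite (orb x)"
  by (simp add: orb_def finite_P)

lemma orb_self: "x \<in> X \<Longrightarrow> x \<in> orb x"
  unfolding orb_def using P_id act_id by force

lemma orb_sub: "x \<in> X \<Longrightarrow> orb x \<subseteq> X"
  using act_closed by (auto simp: orb_def)

lemma orb_act: 
  assumes "p \<in> P" "x \<in> X" shows "orb (act p x) = orb x"
proof
  show "orb (act p x) \<subseteq> orb x"
    using assms by (auto simp: orb_def P_comp simp flip: act_comp)
  show "orb x \<subseteq> orb (act p x)"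
  proof
    fix y assume "y \<in> orb x"
    then obtain q where q: "q \<in> P" "y = act q x" by (auto simp: orb_def)
    have "y = act (q \<circ> invf p) (act p x)"
      using q assms by (simp add: act_comp P_inv act_closed act_inv)
    thus "y \<in> orb (act p x)" using P_comp P_inv assms q by (auto simp: orb_def)
  qed
qed

lemma orb_eq:
  assumes "x \<in> X" "y \<in> orb x" shows "orb y = orb x"
proof -
  obtain p where "p \<in> P" "y = act p x" using assms(2) by (auto simp: orb_def)
  thus ?thesis using orb_act assms(1) by simp
qed

lemma orb_disj: "x \<in> X \<Longrightarrow> y \<in> X \<Longrightarrow> orb x \<inter> orb y \<noteq> {} \<Longrightarrow> orb x = orb y"
  using orb_eq by blast

lemma card_transporter:
  assumes "x \<in> X" "y \<in> orb x"
  shows "card {p \<in> P. act p x = y} = card {p \<in> P. act p x = x}"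
proof -
  obtain q where q: "q \<in> P" "y = act q x" using assms by (auto simp: orb_def)
  have "bij_betw (\<lambda>p. q \<circ> p) {p \<in> P. act p x = x} {p \<in> P. act p x = y}"
  proof (rule bij_betw_byWitness[where f' = "\<lambda>p. invf q \<circ> p"])
    show "\<forall>a\<in>{p \<in> P. act p x = x}. invf q \<circ> (q \<circ> a) = a"
      using inv_comp q by (simp add: o_assoc)
    show "\<forall>a\<in>{p \<in> P. act p x = y}. q \<circ> (invf q \<circ> a) = a"
      using inv_comp q by (simp add: o_assoc)
    show "(\<lambda>p. q \<circ> p) ` {p \<in> P. act p x = x} \<subseteq> {p \<in> P. act p x = y}"
      using q assms by (auto simp: P_comp act_comp)
    show "(\<lambda>p. invf q \<circ> p) ` {p \<in> P. act p x = y} \<subseteq> {p \<in> P. act p x = x}"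
      using q assms by (auto simp: P_comp act_comp P_inv act_inv)
  qed
  thus ?thesis using bij_betw_same_card by fastforce
qed

lemma orbit_stabilizer:
  assumes "x \<in> X"
  shows "card (orb x) * card {p \<in> P. act p x = x} = card P"
proof -
  have "card P = (\<Sum>y\<in>orb x. card {p \<in> P. act p x = y})"
  proof -
    have "card P = (\<Sum>p\<in>P. card {y\<in>orb x. act p x = y})"
    proof -
      have "{y\<in>orb x. act p x = y} = {act p x}" if "p \<in> P" for p
        using that by (auto simp: orb_def)
      thus ?thesis by simp
    qed
    also have "\<dots> = (\<Sum>y\<in>orb x. card {p \<in> P. act p x = y})"
      using sum_multicount_gen[of P "orb x" "\<lambda>p y. act p x = y" "\<lambda>y. card {p \<in> P. act p x = y}"]
      by (simp add: finite_P finite_orb)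
    finally show ?thesis .
  qed
  also have "\<dots> = card (orb x) * card {p \<in> P. act p x = x}"
    using card_transporter assms by simp
  finally show ?thesis by simp
qed

lemma stab_orb:
  assumes "x \<in> X" "y \<in> orb x"
  shows "card {p \<in> P. act p y = y} = card {p \<in> P. act p x = x}"
proof -
  have "y \<in> X" using orb_sub assms by blast
  hence "card (orb x) * card {p \<in> P. act p y = y} = card (orb x) * card {p \<in> P. act p x = x}"
    using orbit_stabilizer[OF assms(1)] orbit_stabilizer[of y] orb_eq[OF assms] by simp
  moreover have "card (orb x) > 0" using assms finite_orb card_gt_0_iff by blast
  ultimately show ?thesis by simp
qed

lemma Union_orbits: "\<Union> (orb ` X) = X"
  using orb_self orb_sub by blast

lemma disjoint_orbits: "\<forall>U\<in>orb ` X. \<forall>V\<in>orb ` X. U \<noteq> V \<longrightarrow> U \<inter> V = {}"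
  using orb_disj by blast

text \<open>By the orbit-stabilizer theorem each orbit contributes \<open>card P\<close> to the sum.
  This form counts isomorphism classes, since the stabilizer of a structure is its automorphism
  group; \<open>burnside_fix\<close> counts orbits of tuples.\<close>

lemma burnside_stab:
  "card (orb ` X) * card P = (\<Sum>x\<in>X. card {p \<in> P. act p x = x})"
proof -
  have "(\<Sum>x\<in>X. card {p \<in> P. act p x = x}) = (\<Sum>x\<in>\<Union> (orb ` X). card {p \<in> P. act p x = x})"
    by (simp add: Union_orbits)
  also have "\<dots> = (\<Sum>U\<in>orb ` X. \<Sum>x\<in>U. card {p \<in> P. act p x = x})"
    using disjoint_orbits by (subst sum.Union_disjoint) (auto simp: finite_orb)
  also have "\<dots> = (\<Sum>U\<in>orb ` X. card P)"
  proof (rule sum.cong[OF refl])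
    fix U assume "U \<in> orb ` X"
    then obtain x where x: "x \<in> X" "U = orb x" by auto
    have "(\<Sum>y\<in>U. card {p \<in> P. act p y = y}) = (\<Sum>y\<in>U. card {p \<in> P. act p x = x})"
      using x stab_orb by simp
    thus "(\<Sum>x\<in>U. card {p \<in> P. act p x = x}) = card P"
      using orbit_stabilizer x by simp
  qed
  finally show ?thesis by simp
qed

lemma burnside_fix:
  "card (orb ` X) * card P = (\<Sum>p\<in>P. card {x \<in> X. act p x = x})"
  unfolding burnside_stab
  using sum_multicount_gen[of X P "\<lambda>x p. act p x = x" "\<lambda>p. card {x \<in> X. act p x = x}"]
  by (simp add: finite_P finite_X)

text \<open>Invariant sets are exactly the unions of orbits. This turns counts of structures into
  powers of 2 whose exponent is a number of orbits.\<close>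

lemma card_invariant_subsets:
  "card {A. A \<subseteq> X \<and> (\<forall>p\<in>P. act p ` A = A)} = 2 ^ card (orb ` X)"
proof -
  have "bij_betw Union (Pow (orb ` X)) {A. A \<subseteq> X \<and> (\<forall>p\<in>P. act p ` A = A)}"
  proof (rule bij_betwI[where g = "\<lambda>A. orb ` A"])
    show "Union \<in> Pow (orb ` X) \<rightarrow> {A. A \<subseteq> X \<and> (\<forall>p\<in>P. act p ` A = A)}"
    proof (rule Pi_I)
      fix F assume F: "F \<in> Pow (orb ` X)"
      then have Fs: "F \<subseteq> orb ` X" by auto
      { fix y U assume "y \<in> U" "U \<in> F" hence "y \<in> X" using Fs orb_sub by blast } note sub = this
      { fix p y U assume "p \<in> P" "y \<in> U" "U \<in> F"
        then obtain z where z: "z \<in> X" "U = orb z" using Fs by blast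
        have "act p y \<in> U" using \<open>y \<in> U\<close> z \<open>p \<in> P\<close> orb_eq act_closed orb_sub orb_self orb_act
          by (metis subsetD)
        hence "act p y \<in> \<Union> F" using \<open>U \<in> F\<close> by blast } note cl = this
      { fix p y U assume "p \<in> P" "y \<in> U" "U \<in> F"
        hence "act (invf p) y \<in> \<Union> F" using cl P_inv by blast
        moreover have "y = act p (act (invf p) y)"
          using act_inv \<open>p \<in> P\<close> sub[OF \<open>y \<in> U\<close> \<open>U \<in> F\<close>] by simp
        ultimately have "y \<in> act p ` \<Union> F" by blast } note cl' = this
      have "\<Union> F \<subseteq> X" using sub by blast
      moreover have "act p ` \<Union> F = \<Union> F" if "p \<in> P" for p
        using cl[OF that] cl'[OF that] by blast
      ultimately show "\<Union> F \<in> {A. A \<subseteq> X \<and> (\<forall>p\<in>P. act p ` A = A)}" by blast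
    qed
    show "(\<lambda>A. orb ` A) \<in> {A. A \<subseteq> X \<and> (\<forall>p\<in>P. act p ` A = A)} \<rightarrow> Pow (orb ` X)" by auto
    show "orb ` \<Union> F = F" if "F \<in> Pow (orb ` X)" for F
    proof
      have Fs: "F \<subseteq> orb ` X" using that by auto
      show "orb ` \<Union> F \<subseteq> F"
      proof safe
        fix y U assume "y \<in> U" "U \<in> F"
        then obtain z where "z \<in> X" "U = orb z" using Fs by blast
        thus "orb y \<in> F" using orb_eq \<open>y \<in> U\<close> \<open>U \<in> F\<close> by metis
      qed
      show "F \<subseteq> orb ` \<Union> F"
      proof
        fix U assume "U \<in> F"
        then obtain z where z: "z \<in> X" "U = orb z" using Fs by blast
        thus "U \<in> orb ` \<Union> F" using orb_self \<open>U \<in> F\<close> by blast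
      qed
    qed
    show "\<Union> (orb ` A) = A" if "A \<in> {A. A \<subseteq> X \<and> (\<forall>p\<in>P. act p ` A = A)}" for A
    proof
      show "\<Union> (orb ` A) \<subseteq> A" using that by (auto simp: orb_def)
      show "A \<subseteq> \<Union> (orb ` A)" using that orb_self by blast
    qed
  qed
  hence "card {A. A \<subseteq> X \<and> (\<forall>p\<in>P. act p ` A = A)} = card (Pow (orb ` X))"
    by (simp add: bij_betw_same_card)
  thus ?thesis by (simp add: card_Pow finite_X)
qed

end

lemma pgroup_permutes: "pgroup S P \<Longrightarrow> p \<in> P \<Longrightarrow> p permutes S"
  and pgroup_id: "pgroup S P \<Longrightarrow> id \<in> P"
  and pgroup_comp: "pgroup S P \<Longrightarrow> p \<in> P \<Longrightarrow> q \<in> P \<Longrightarrow> p \<circ> q \<in> P"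
  and pgroup_inv: "pgroup S P \<Longrightarrow> p \<in> P \<Longrightarrow> invf p \<in> P"
  by (auto simp: pgroup_def)

lemma pgroup_finite: "pgroup S P \<Longrightarrow> finite S \<Longrightarrow> finite P"
  using finite_subset[of P "{p. p permutes S}"] finite_permutations by (auto simp: pgroup_def)

lemma pgroup_sym: "pgroup S {p. p permutes S}"
  by (auto simp: pgroup_def permutes_inv permutes_compose)

lemma pgroup_triv: "pgroup S {id}"
  by (auto simp: pgroup_def permutes_inv permutes_compose)

lemma card_split:
  assumes "finite A"
  shows "card A = card {x \<in> A. Q x} + card {x \<in> A. \<not> Q x}"
proof -
  have "A = {x \<in> A. Q x} \<union> {x \<in> A. \<not> Q x}" by blast
  thus ?thesis using assms card_Un_disjoint[of "{x \<in> A. Q x}" "{x \<in> A. \<not> Q x}"] by auto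
qed

definition supp :: "('a \<Rightarrow> 'a) set \<Rightarrow> 'a set" where
  "supp P = {a. \<exists>p\<in>P. p a \<noteq> a}"

text \<open>A group without global fixed points has at most half as many orbits as points, so by
  Burnside's lemma some element fixes at most half of the points.\<close>
lemma exists_large_support:
  assumes "pgroup S P" "finite S" "supp P = S"
  shows "\<exists>p\<in>P. card S \<le> 2 * card {a \<in> S. p a \<noteq> a}"
proof (rule ccontr)
  assume contra: "\<not> ?thesis"
  interpret finite_action S P "\<lambda>p a. p a" S
    by unfold_locales
       (use assms pgroup_finite in \<open>auto simp: permutes_in_image dest: pgroup_permutes\<close>)
  have two: "card (orb a) \<ge> 2" if "a \<in> S" for a
  proof -
    have "a \<in> supp P" using that assms(3) by simp
    then obtain p where "p \<in> P" "p a \<noteq> a" unfolding supp_def by blast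
    hence "{a, p a} \<subseteq> orb a" using orb_self that by (auto simp: orb_def)
    thus ?thesis using card_mono[OF finite_orb, of "{a, p a}" a] \<open>p a \<noteq> a\<close> by auto
  qed
  have "card S = card (\<Union> (orb ` S))" by (simp add: Union_orbits)
  also have "\<dots> = (\<Sum>U\<in>orb ` S. card U)"
    by (rule card_Union_disjoint)
       (use disjoint_orbits in \<open>auto simp: pairwise_def disjnt_def finite_orb\<close>)
  also have "\<dots> \<ge> (\<Sum>U\<in>orb ` S. 2)" by (rule sum_mono) (use two in auto)
  finally have orbs: "2 * card (orb ` S) \<le> card S" by simp
  have "2 * card {a \<in> S. p a = a} > card S" if "p \<in> P" for p
  proof -
    have "card S = card {a \<in> S. p a = a} + card {a \<in> S. p a \<noteq> a}"
      by (rule card_split[OF assms(2)])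
    thus ?thesis using contra that by fastforce
  qed
  hence "(\<Sum>p\<in>P. 2 * card {a \<in> S. p a = a}) > (\<Sum>p\<in>P. card S)"
    using P_id finite_P by (intro sum_strict_mono) auto
  also have "(\<Sum>p\<in>P. 2 * card {a \<in> S. p a = a}) = 2 * card (orb ` S) * card P"
    by (simp flip: sum_distrib_left burnside_fix)
  finally have "card S * card P < 2 * card (orb ` S) * card P" by (simp add: mult.commute)
  thus False using orbs by simp
qed

section \<open>Counting families of sets\<close>

text \<open>Toggling \<open>U z\<close> breaks the agreement of \<open>e z\<close> with
  \<open>f z\<close> and keeps all the others, so \<open>G\<close> and its toggled copy are disjoint
  and their union still satisfies the agreements at the remaining points. In the applications
  \<open>F\<close> consists of the \<open>P\<close>-invariant sets, \<open>G\<close> of those that a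
  further permutation preserves, and \<open>f x\<close> is the image of \<open>e x\<close> under
  it.\<close>

lemma halving:
  fixes F G :: "'x set set"
  assumes "finite F" "finite X" "G \<subseteq> F"
    and closed: "\<And>R x. R \<in> F \<Longrightarrow> x \<in> X \<Longrightarrow> (R - U x) \<union> (U x - R) \<in> F"
    and agree: "\<And>R x. R \<in> G \<Longrightarrow> x \<in> X \<Longrightarrow> e x \<in> R \<longleftrightarrow> f x \<in> R"
    and e: "\<And>x y. x \<in> X \<Longrightarrow> y \<in> X \<Longrightarrow> e x \<in> U y \<longleftrightarrow> x = y"
    and f: "\<And>x y. x \<in> X \<Longrightarrow> y \<in> X \<Longrightarrow> f x \<notin> U y"
  shows "card G * 2 ^ card X \<le> card F"
  using assms(2-)
proof (induction X arbitrary: G rule: finite_induct)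
  case empty
  thus ?case using \<open>finite F\<close> by (simp add: card_mono)
next
  case (insert z X)
  let ?h = "\<lambda>R. (R - U z) \<union> (U z - R)"
  have ez: "e z \<in> U z" and fz: "f z \<notin> U z" using insert.prems by auto
  have inj: "inj_on ?h G"
  proof (rule inj_on_inverseI)
    show "?h (?h R) = R" for R by auto
  qed
  have disj: "G \<inter> ?h ` G = {}"
  proof -
    have "?h R \<notin> G" if "R \<in> G" for R
      using insert.prems(3)[of R z] insert.prems(3)[of "?h R" z] that ez fz by auto
    thus ?thesis by blast
  qed
  let ?G = "G \<union> ?h ` G"
  have finG: "finite G" using \<open>finite F\<close> insert.prems(1) finite_subset by blast
  have "card ?G * 2 ^ card X \<le> card F"
  proof (rule insert.IH)
    show "?G \<subseteq> F" using insert.prems(1,2) by blast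
    show "\<And>R x. R \<in> F \<Longrightarrow> x \<in> X \<Longrightarrow> (R - U x) \<union> (U x - R) \<in> F"
      using insert.prems(2) by blast
    show "e x \<in> R \<longleftrightarrow> f x \<in> R" if "R \<in> ?G" "x \<in> X" for R x
    proof -
      have "e x \<notin> U z" "f x \<notin> U z" using insert.prems(4,5)[of x z] that insert.hyps by auto
      thus ?thesis using that insert.prems(3) by auto
    qed
    show "\<And>x y. x \<in> X \<Longrightarrow> y \<in> X \<Longrightarrow> e x \<in> U y \<longleftrightarrow> x = y"
      "\<And>x y. x \<in> X \<Longrightarrow> y \<in> X \<Longrightarrow> f x \<notin> U y" using insert.prems(4,5) by auto
  qed
  moreover have "card ?G = 2 * card G"
    using card_Un_disjoint[OF finG _ disj] finG card_image[OF inj] by simp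
  ultimately show ?case using insert.hyps by simp
qed

text \<open>Prescribing the trace of a random member of \<open>F\<close> on the disjoint sets \<open>W z\<close>: at each \<open>z\<close> the
  prescription is met with conditional probability at least \<open>1/C\<close>.\<close>
lemma avoid_patterns:
  fixes F :: "'x set set"
  assumes "finite F" "finite Z" "C > 0"
    and closed: "\<And>R z. R \<in> F \<Longrightarrow> z \<in> Z \<Longrightarrow> (R - W z) \<union> D z \<in> F"
    and D: "\<And>z. z \<in> Z \<Longrightarrow> D z \<subseteq> W z"
    and disj: "\<And>y z. y \<in> Z \<Longrightarrow> z \<in> Z \<Longrightarrow> y \<noteq> z \<Longrightarrow> W y \<inter> W z = {}"
    and fin: "\<And>z. z \<in> Z \<Longrightarrow> finite (W z) \<and> 2 ^ card (W z) \<le> C"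
  shows "real (card {R \<in> F. \<forall>z\<in>Z. R \<inter> W z \<noteq> D z}) \<le> (1 - 1 / real C) ^ card Z * real (card F)"
  using assms(2,4-)
proof (induction Z rule: finite_induct)
  case empty
  thus ?case by simp
next
  case (insert z Z)
  let ?B = "{R \<in> F. \<forall>y\<in>Z. R \<inter> W y \<noteq> D y}"
  let ?Bin = "{R \<in> ?B. R \<inter> W z = D z}"
  let ?Bout = "{R \<in> ?B. R \<inter> W z \<noteq> D z}"
  let ?h = "\<lambda>R. (R - W z) \<union> D z"
  have finB: "finite ?B" using \<open>finite F\<close> by simp
  have finW: "finite (W z)" and WC: "2 ^ card (W z) \<le> C" using insert.prems(4) by blast+
  have h: "?h R \<in> ?Bin" if "R \<in> ?B" for R
  proof -
    have "?h R \<inter> W y = R \<inter> W y" if "y \<in> Z" for y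
      using insert.prems(3)[of y z] insert.prems(2)[of z] that insert.hyps by blast
    moreover have "?h R \<inter> W z = D z" using insert.prems(2)[of z] by blast
    moreover have "?h R \<in> F" using insert.prems(1) that by blast
    ultimately show ?thesis using that by auto
  qed
  \<comment> \<open>\<open>R\<close> can be recovered from its rewritten form and its old trace on
    \<open>W z\<close>. So rewriting is at most \<open>2 ^ card (W z)\<close> to one, and at least a
    fraction \<open>1/C\<close> of the sets meets the prescription at \<open>z\<close>.\<close>
  have inj: "inj_on (\<lambda>R. (?h R, R \<inter> W z)) ?B"
  proof (rule inj_onI)
    fix R R' assume *: "(?h R, R \<inter> W z) = (?h R', R' \<inter> W z)"
    have "R = (?h R - W z) \<union> (R \<inter> W z)" "R' = (?h R' - W z) \<union> (R' \<inter> W z)"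
      using insert.prems(2)[of z] by blast+
    thus "R = R'" using * by auto
  qed
  have "card ?B = card ((\<lambda>R. (?h R, R \<inter> W z)) ` ?B)" using card_image[OF inj] by simp
  also have "\<dots> \<le> card (?Bin \<times> Pow (W z))"
  proof (rule card_mono)
    have "finite ?Bin" by (rule finite_subset[of _ F]) (auto simp: \<open>finite F\<close>)
    thus "finite (?Bin \<times> Pow (W z))" using finW by (intro finite_cartesian_product) simp_all
    show "(\<lambda>R. (?h R, R \<inter> W z)) ` ?B \<subseteq> ?Bin \<times> Pow (W z)" using h by blast
  qed
  also have "\<dots> = card ?Bin * 2 ^ card (W z)" using finW by (simp add: card_Pow card_cartesian_product)
  also have "\<dots> \<le> card ?Bin * C" using WC by (rule mult_left_mono) simp
  finally have 1: "real (card ?B) \<le> real (card ?Bin) * real C"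
    unfolding of_nat_mult[symmetric] of_nat_le_iff .
  have 2: "card ?B = card ?Bin + card ?Bout" by (rule card_split[OF finB])
  have "real (card ?B) / real C \<le> real (card ?Bin)" using 1 assms(3) by (simp add: field_simps)
  hence "real (card ?Bout) \<le> (1 - 1 / real C) * real (card ?B)" using 2
    by (simp only: of_nat_add) (simp add: algebra_simps add_divide_distrib)
  also have "\<dots> \<le> (1 - 1 / real C) * ((1 - 1 / real C) ^ card Z * real (card F))"
    by (intro mult_left_mono insert.IH) (use insert.prems assms(3) in auto)
  finally have "real (card ?Bout) \<le> (1 - 1 / real C) ^ card (insert z Z) * real (card F)"
    using insert.hyps by (simp add: mult.assoc)
  moreover have "{R \<in> F. \<forall>y\<in>insert z Z. R \<inter> W y \<noteq> D y} = ?Bout" by auto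
  ultimately show ?case by (simp only:)
qed

text \<open>A maximal \<open>B\<close> disjoint from its image satisfies \<open>S \<subseteq> B \<union> g B \<union> g\<^sup>-\<^sup>1 B\<close>.\<close>
lemma exists_displaced_subset:
  assumes "finite S" "inj g" "\<And>a. a \<in> S \<Longrightarrow> g a \<noteq> a"
  shows "\<exists>B\<subseteq>S. B \<inter> g ` B = {} \<and> card S \<le> 3 * card B"
proof -
  let ?Q = "\<lambda>B. B \<subseteq> S \<and> B \<inter> g ` B = {}"
  obtain B where B: "?Q B" and max: "\<And>B'. ?Q B' \<Longrightarrow> B \<subseteq> B' \<Longrightarrow> B' = B"
  proof -
    have "finite {B. ?Q B}" "{B. ?Q B} \<noteq> {}" using \<open>finite S\<close> by auto
    from finite_has_maximal[OF this] obtain m where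
      "m \<in> {B. ?Q B}" and m: "\<forall>b\<in>{B. ?Q B}. m \<subseteq> b \<longrightarrow> m = b" by blast
    with that[of m] show ?thesis by blast
  qed
  have finB: "finite B" using B \<open>finite S\<close> finite_subset by blast
  have "S \<subseteq> B \<union> g ` B \<union> (g -` B)"
  proof
    fix s assume s: "s \<in> S"
    show "s \<in> B \<union> g ` B \<union> (g -` B)"
    proof (rule ccontr)
      assume "s \<notin> B \<union> g ` B \<union> (g -` B)"
      hence n: "s \<notin> B" "s \<notin> g ` B" "g s \<notin> B" by auto
      hence "?Q (insert s B)" using B s assms(3)[OF s] by auto
      thus False using max[of "insert s B"] n by blast
    qed
  qed
  moreover have "finite (g -` B)" using finB assms(2) finite_vimageI by blast
  ultimately have "card S \<le> card (B \<union> g ` B \<union> (g -` B))"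
    using finB by (intro card_mono) auto
  also have "\<dots> \<le> card B + card (g ` B) + card (g -` B)"
    using card_Un_le[of "B \<union> g ` B" "g -` B"] card_Un_le[of B "g ` B"] by linarith
  also have "\<dots> \<le> 3 * card B" 
    using card_image_le[OF finB, of g] card_vimage_inj_on_le[of g UNIV B] finB assms(2) by simp
  finally show ?thesis using B by blast
qed

section \<open>Structures as sets of labelled tuples\<close>

definition lact :: "('a \<Rightarrow> 'b) \<Rightarrow> 'i \<times> 'a list \<Rightarrow> 'i \<times> 'b list" where
  "lact p = (\<lambda>(i, xs). (i, map p xs))"

lemma lact_simp [simp]: "lact p (i, xs) = (i, map p xs)"
  by (simp add: lact_def)

lemma lact_id [simp]: "lact id = id" "lact id x = x"
  by (auto simp: lact_def fun_eq_iff)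

lemma lact_comp: "lact (p \<circ> q) x = lact p (lact q x)"
  by (cases x) (simp add: lact_def)

lemma lact_comp_image: "lact (p \<circ> q) ` A = lact p ` lact q ` A"
  by (simp add: image_image lact_comp)

lemma lact_inj: "inj p \<Longrightarrow> inj (lact p)"
  by (auto simp: inj_def lact_def)

lemma lact_permutes_inv: "p permutes S \<Longrightarrow> lact (invf p) (lact p x) = x"
  "p permutes S \<Longrightarrow> lact p (lact (invf p) x) = x"
  by (metis lact_comp lact_id(2) permutes_inv_o)+

lemma lact_image_inv:
  assumes "p permutes S" shows "lact p ` A = B \<longleftrightarrow> lact (invf p) ` B = A"
proof
  assume "lact p ` A = B"
  hence "lact (invf p) ` B = (\<lambda>x. lact (invf p) (lact p x)) ` A" by (simp add: image_image flip: \<open>_ = B\<close>)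
  thus "lact (invf p) ` B = A" by (simp add: lact_permutes_inv[OF assms])
next
  assume "lact (invf p) ` B = A"
  hence "lact p ` A = (\<lambda>x. lact p (lact (invf p) x)) ` B" by (simp add: image_image flip: \<open>_ = A\<close>)
  thus "lact p ` A = B" by (simp add: lact_permutes_inv[OF assms])
qed

lemma lact_image_cancel:
  assumes "p permutes S"
  shows "lact (invf p) ` lact p ` A = A" "lact p ` lact (invf p) ` A = A"
  by (simp_all add: image_image lact_permutes_inv[OF assms])

lemma lact_in_iff:
  assumes "inj p" "lact p ` A = A" shows "lact p x \<in> A \<longleftrightarrow> x \<in> A"
  using inj_image_mem_iff[OF lact_inj[OF assms(1)], of x A] assms(2) by simp

section \<open>Automorphism groups of structures on \<open>{1..n}\<close> and their behaviour under
  relabelling\<close>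

definition mk_struct :: "nat \<Rightarrow> ('i \<times> nat list) set \<Rightarrow> ('i, nat) rel_structure" where
  "mk_struct n A = \<lparr>univ = {1..n}, rel = (\<lambda>i. {xs. (i, xs) \<in> A})\<rparr>"

lemma mk_struct_simps [simp]: "univ (mk_struct n A) = {1..n}" "xs \<in> rel (mk_struct n A) i \<longleftrightarrow> (i, xs) \<in> A"
  by (auto simp: mk_struct_def)

lemma inj_mk_struct: "inj (mk_struct n)"
proof (rule injI)
  fix A B assume "mk_struct n A = mk_struct n B"
  hence "(i, xs) \<in> A \<longleftrightarrow> (i, xs) \<in> B" for i xs
    by (metis mk_struct_simps(2))
  thus "A = B" by auto
qed

definition autg :: "nat \<Rightarrow> ('i \<times> nat list) set \<Rightarrow> (nat \<Rightarrow> nat) set" where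
  "autg n A = {p. p permutes {1..n} \<and> lact p ` A = A}"

lemma autgD: "p \<in> autg n A \<Longrightarrow> p permutes {1..n}" "p \<in> autg n A \<Longrightarrow> lact p ` A = A"
  by (auto simp: autg_def)

lemma pgroup_autg: "pgroup {1..n} (autg n A)"
proof -
  have "invf p \<in> autg n A" if "p \<in> autg n A" for p
    using lact_image_inv[OF autgD(1)[OF that], of A A] autgD(2)[OF that]
      permutes_inv[OF autgD(1)[OF that]] by (simp add: autg_def)
  moreover have "p \<circ> q \<in> autg n A" if "p \<in> autg n A" "q \<in> autg n A" for p q
    using autgD[OF that(1)] autgD[OF that(2)]
    by (simp add: autg_def lact_comp_image permutes_compose)
  moreover have "id \<in> autg n A" by (simp add: autg_def)
  ultimately show ?thesis using autgD(1) unfolding pgroup_def by blast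
qed

definition full_groups :: "nat \<Rightarrow> (nat \<Rightarrow> nat) set set" where
  "full_groups t = {P. pgroup {1..t} P \<and> supp P = {1..t}}"

lemma finite_full_groups: "finite (full_groups t)"
  by (rule finite_subset[of _ "Pow {p. p permutes {1..t}}"])
     (auto simp: full_groups_def finite_permutations dest: pgroup_permutes)

text \<open>The possible groups for a given support form a finite set that does not depend on
  \<open>n\<close>; this makes structures of different sizes comparable.\<close>

lemma autg_full_group:
  assumes "supp (autg n A) = {1..t}" shows "autg n A \<in> full_groups t"
proof -
  have "p permutes {1..t}" if "p \<in> autg n A" for p
  proof (rule permutes_superset[of p "{1..n}"])
    show "p permutes {1..n}" using that by (simp add: autg_def)
    show "p x = x" if "x \<in> {1..n} - {1..t}" for x
      using assms that \<open>p \<in> autg n A\<close> unfolding supp_def by blast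
  qed
  thus ?thesis using pgroup_autg[of n A] assms by (auto simp: full_groups_def pgroup_def)
qed

lemma supp_autg: "supp (autg n A) \<subseteq> {1..n}"
  unfolding supp_def autg_def using permutes_not_in by fastforce

lemma autg_conj:
  assumes f: "f permutes {1..n}"
  shows "autg n (lact f ` A) = (\<lambda>p. f \<circ> p \<circ> invf f) ` autg n A"
proof -
  have 1: "(\<lambda>p. g \<circ> p \<circ> invf g) ` autg n B \<subseteq> autg n (lact g ` B)" if g: "g permutes {1..n}" for g B
  proof safe
    fix p assume "p \<in> autg n B"
    hence p: "p permutes {1..n}" "lact p ` B = B" by (auto simp: autg_def)
    have "lact (invf g) ` lact g ` B = B" by (rule lact_image_cancel[OF g])
    hence "lact (g \<circ> p \<circ> invf g) ` lact g ` B = lact g ` B"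
      using p by (simp add: lact_comp_image)
    moreover have "g \<circ> p \<circ> invf g permutes {1..n}"
      using g p by (intro permutes_compose permutes_inv)
    ultimately show "g \<circ> p \<circ> invf g \<in> autg n (lact g ` B)" by (simp add: autg_def)
  qed
  have "q \<in> (\<lambda>p. f \<circ> p \<circ> invf f) ` autg n A" if q: "q \<in> autg n (lact f ` A)" for q
  proof -
    have "lact (invf f) ` lact f ` A = A" by (rule lact_image_cancel[OF f])
    hence "invf f \<circ> q \<circ> f \<in> autg n A"
      using 1[OF permutes_inv[OF f], of "lact f ` A"] q permutes_inv_inv[OF f] by auto
    moreover have "q = f \<circ> (invf f \<circ> q \<circ> f) \<circ> invf f"
      using permutes_inv_o[OF f] by (metis comp_assoc comp_id id_comp)
    ultimately show ?thesis by blast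
  qed
  thus ?thesis using 1[OF f] by blast
qed

lemma supp_conj:
  assumes f: "f permutes S"
  shows "supp ((\<lambda>p. f \<circ> p \<circ> invf f) ` P) = f ` supp P"
proof -
  have *: "a \<in> supp ((\<lambda>p. f \<circ> p \<circ> invf f) ` P) \<longleftrightarrow> invf f a \<in> supp P" for a
  proof -
    have "f (p (invf f a)) \<noteq> a \<longleftrightarrow> p (invf f a) \<noteq> invf f a" for p
      using permutes_inv_eq[OF f, of a "p (invf f a)"] by auto
    thus ?thesis by (simp add: supp_def)
  qed
  show ?thesis
  proof
    show "supp ((\<lambda>p. f \<circ> p \<circ> invf f) ` P) \<subseteq> f ` supp P"
    proof
      fix a assume "a \<in> supp ((\<lambda>p. f \<circ> p \<circ> invf f) ` P)"
      hence "invf f a \<in> supp P" using * by blast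
      moreover have "a = f (invf f a)" using permutes_inverses(1)[OF f] by simp
      ultimately show "a \<in> f ` supp P" by blast
    qed
    show "f ` supp P \<subseteq> supp ((\<lambda>p. f \<circ> p \<circ> invf f) ` P)"
      using * permutes_inverses(2)[OF f] by auto
  qed
qed

lemma card_conj:
  assumes f: "f permutes S"
  shows "card ((\<lambda>p. f \<circ> p \<circ> invf f) ` P) = card P"
proof (rule card_image, rule inj_on_inverseI)
  fix p show "invf f \<circ> (f \<circ> p \<circ> invf f) \<circ> f = p"
    using permutes_inv_o[OF f] by (metis comp_assoc comp_id id_comp)
qed

lemma exists_permutation_onto:
  fixes n :: nat
  assumes "S \<subseteq> {1..n}" "card S = t"
  shows "\<exists>f. f permutes {1..n} \<and> f ` {1..t} = S"
proof -
  have fin: "finite S" using assms(1) finite_subset by blast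
  have tn: "t \<le> n" using card_mono[OF _ assms(1)] assms(2) by simp
  obtain g where g: "bij_betw g {1..t} S"
    using finite_same_card_bij[of "{1..t}" S] fin assms by auto
  obtain h where h: "bij_betw h ({1..n} - {1..t}) ({1..n} - S)"
  proof -
    have "card ({1..n} - {1..t}) = card ({1..n} - S)"
      using assms tn fin by (simp add: card_Diff_subset)
    thus ?thesis using finite_same_card_bij[of "{1..n} - {1..t}" "{1..n} - S"] that by auto
  qed
  define f where "f = (\<lambda>x. if x \<in> {1..t} then g x else if x \<in> {1..n} then h x else x)"
  have "bij_betw f {1..t} S" using g by (rule bij_betw_cong[THEN iffD1, rotated]) (auto simp: f_def)
  moreover have "bij_betw f ({1..n} - {1..t}) ({1..n} - S)"
    using h by (rule bij_betw_cong[THEN iffD1, rotated]) (auto simp: f_def)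
  ultimately have "bij_betw f ({1..t} \<union> ({1..n} - {1..t})) (S \<union> ({1..n} - S))"
    by (rule bij_betw_combine) auto
  moreover have "{1..t} \<union> ({1..n} - {1..t}) = {1..n}" "S \<union> ({1..n} - S) = {1..n}"
    using tn assms by auto
  ultimately have "bij_betw f {1..n} {1..n}" by simp
  hence "f permutes {1..n}" by (rule bij_imp_permutes) (use tn in \<open>auto simp: f_def\<close>)
  thus ?thesis using \<open>bij_betw f {1..t} S\<close> bij_betw_imp_surj_on by blast
qed

section \<open>Isomorphism classes as orbits of the symmetric group\<close>

definition tuples :: "('i \<Rightarrow> nat) \<Rightarrow> nat \<Rightarrow> ('i \<times> nat list) set" where
  "tuples ar n = {(i, xs). length xs = ar i \<and> set xs \<subseteq> {1..n}}"

locale vocabulary =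
  fixes ar :: "'i::finite \<Rightarrow> nat"
  assumes max_arity: "Max (range ar) \<ge> 2"
begin

abbreviation "tup \<equiv> tuples ar"

lemma tup_iff: "(i, xs) \<in> tup n \<longleftrightarrow> length xs = ar i \<and> set xs \<subseteq> {1..n}"
  by (simp add: tuples_def)

lemma tup_eq: "tup n = (SIGMA i:UNIV. {xs. set xs \<subseteq> {1..n} \<and> length xs = ar i})"
  by (auto simp: tuples_def)

lemma finite_tup: "finite (tup n)"
  unfolding tup_eq by (intro finite_SigmaI finite_lists_length_eq) auto

lemma card_tup: "card (tup n) = (\<Sum>i\<in>UNIV. n ^ ar i)"
  unfolding tup_eq by (simp add: card_SigmaI card_lists_length_eq finite_lists_length_eq)

lemma tup_mono: "m \<le> n \<Longrightarrow> tup m \<subseteq> tup n"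
  by (auto simp: tuples_def)

lemma lact_tup_iff: "p permutes {1..n} \<Longrightarrow> lact p x \<in> tup n \<longleftrightarrow> x \<in> tup n"
  using permutes_in_image[of p "{1..n}"] by (cases x) (auto simp: tup_iff image_subset_iff subset_iff)

lemma lact_tup:
  assumes "p permutes {1..n}" shows "lact p ` tup n = tup n"
proof -
  have "lact p ` tup n \<subseteq> tup n" "lact (invf p) ` tup n \<subseteq> tup n"
    using assms lact_tup_iff permutes_inv by blast+
  thus ?thesis using lact_permutes_inv(2)[OF assms] by (metis image_eqI subsetI subset_antisym
      image_subset_iff)
qed

lemma Structs_n_eq: "Structs_n ar n = mk_struct n ` Pow (tup n)"
proof
  show "mk_struct n ` Pow (tup n) \<subseteq> Structs_n ar n"
    by (fastforce simp: Structs_n_def tuples_def mk_struct_def)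
  show "Structs_n ar n \<subseteq> mk_struct n ` Pow (tup n)"
  proof
    fix M :: "('i, nat) rel_structure" assume M: "M \<in> Structs_n ar n"
    have "M = mk_struct n {(i, xs). xs \<in> rel M i}"
      using M by (auto simp: mk_struct_def Structs_n_def)
    moreover have "{(i, xs). xs \<in> rel M i} \<subseteq> tup n"
      using M by (force simp: Structs_n_def tuples_def)
    ultimately show "M \<in> mk_struct n ` Pow (tup n)" by blast
  qed
qed

lemma isomorphism_iff:
  assumes "A \<subseteq> tup n" "B \<subseteq> tup n" "f permutes {1..n}"
  shows "isomorphism f (mk_struct n A) (mk_struct n B) \<longleftrightarrow> lact f ` A = B"
proof
  assume *: "isomorphism f (mk_struct n A) (mk_struct n B)"
  have **: "x \<in> A \<longleftrightarrow> lact f x \<in> B" if "x \<in> tup n" for x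
    using * that by (cases x) (auto simp: isomorphism_def tup_iff lists_eq_set)
  show "lact f ` A = B"
  proof
    show "lact f ` A \<subseteq> B" using ** assms(1) by blast
    show "B \<subseteq> lact f ` A"
    proof
      fix y assume "y \<in> B"
      hence "y \<in> lact f ` tup n" using assms(2) lact_tup[OF assms(3)] by (metis subsetD)
      then obtain x where "x \<in> tup n" "y = lact f x" by (rule imageE)
      thus "y \<in> lact f ` A" using **[of x] \<open>y \<in> B\<close> by simp
    qed
  qed
next
  assume *: "lact f ` A = B"
  have "(i, xs) \<in> A \<longleftrightarrow> lact f (i, xs) \<in> B" for i xs
    using inj_image_mem_iff[OF lact_inj[OF permutes_inj[OF assms(3)]]] * by metis
  thus "isomorphism f (mk_struct n A) (mk_struct n B)"
    using assms(3) by (auto simp: isomorphism_def permutes_imp_bij)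
qed

lemma carrier_Aut: "A \<subseteq> tup n \<Longrightarrow> carrier (Aut (mk_struct n A)) = autg n A"
  by (simp add: Aut_def autg_def isomorphism_iff cong: conj_cong)

lemma Aut_eq: "A \<subseteq> tup n \<Longrightarrow> Aut (mk_struct n A) = \<lparr>carrier = autg n A, mult = (\<circ>), one = id\<rparr>"
  using carrier_Aut by (auto simp: Aut_def Sym_def)

lemma isomorphic_iff:
  assumes "A \<subseteq> tup n" "B \<subseteq> tup n"
  shows "isomorphic (mk_struct n B) (mk_struct n A) \<longleftrightarrow> (\<exists>f. f permutes {1..n} \<and> lact f ` A = B)"
proof
  assume "isomorphic (mk_struct n B) (mk_struct n A)"
  then obtain f where f: "isomorphism f (mk_struct n B) (mk_struct n A)" by (auto simp: isomorphic_def)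
  \<comment> \<open>\<open>isomorphism\<close> leaves \<open>f\<close> arbitrary outside
    \<open>{1..n}\<close>, whereas \<open>permutes\<close> demands the identity there.\<close>
  define g where "g = (\<lambda>x. if x \<in> {1..n} then f x else x)"
  have "bij_betw g {1..n} {1..n}"
    using f bij_betw_cong[of "{1..n}" g f "{1..n}"] by (simp add: isomorphism_def g_def)
  hence g: "g permutes {1..n}" by (rule bij_imp_permutes) (auto simp: g_def)
  have mapeq: "map g xs = map f xs" if "xs \<in> lists {1..n}" for xs
    using that by (auto simp: g_def)
  have "isomorphism g (mk_struct n B) (mk_struct n A)"
    using f \<open>bij_betw g {1..n} {1..n}\<close> by (simp add: isomorphism_def mapeq)
  hence "lact g ` B = A" using isomorphism_iff[OF assms(2,1) g] by simp
  hence "lact (invf g) ` A = B" by (simp only: lact_image_inv[OF g])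
  thus "\<exists>f. f permutes {1..n} \<and> lact f ` A = B" using permutes_inv[OF g] by blast
next
  assume "\<exists>f. f permutes {1..n} \<and> lact f ` A = B"
  then obtain f where f: "f permutes {1..n}" "lact f ` A = B" by auto
  hence "lact (invf f) ` B = A" by (simp only: lact_image_inv[OF f(1)])
  hence "isomorphism (invf f) (mk_struct n B) (mk_struct n A)"
    using isomorphism_iff[OF assms(2,1) permutes_inv[OF f(1)]] by simp
  thus "isomorphic (mk_struct n B) (mk_struct n A)" by (auto simp: isomorphic_def)
qed

text \<open>Isomorphic structures have equal size, so the class taken among all sizes is a single
  orbit of the symmetric group. \<open>Structs\<close> contains no empty structure, hence
  \<open>n \<ge> 1\<close>.\<close>

lemma iso_class_eq:
  assumes "A \<subseteq> tup n" "n \<ge> 1"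
  shows "iso_class ar (mk_struct n A) = mk_struct n ` (\<lambda>f. lact f ` A) ` {f. f permutes {1..n}}"
proof -
  have img: "lact f ` A \<subseteq> tup n" if "f permutes {1..n}" for f
    using assms(1) lact_tup[OF that] by blast
  show ?thesis
  proof
    show "mk_struct n ` (\<lambda>f. lact f ` A) ` {f. f permutes {1..n}} \<subseteq> iso_class ar (mk_struct n A)"
    proof safe
      fix f :: "nat \<Rightarrow> nat" assume f: "f permutes {1..n}"
      have "mk_struct n (lact f ` A) \<in> Structs ar"
        using img[OF f] assms(2) by (auto simp: Structs_def Structs_n_eq)
      thus "mk_struct n (lact f ` A) \<in> iso_class ar (mk_struct n A)"
        using isomorphic_iff[OF assms(1) img[OF f]] f by (auto simp: iso_class_def)
    qed
    show "iso_class ar (mk_struct n A) \<subseteq> mk_struct n ` (\<lambda>f. lact f ` A) ` {f. f permutes {1..n}}"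
    proof
      fix N assume N: "N \<in> iso_class ar (mk_struct n A)"
      then obtain m B where B: "N = mk_struct m B" "B \<subseteq> tup m"
        by (auto simp: iso_class_def Structs_def Structs_n_eq)
      have iso: "isomorphic (mk_struct m B) (mk_struct n A)" using N B by (simp add: iso_class_def)
      then obtain f where "bij_betw f {1..m} {1..n}" by (auto simp: isomorphic_def isomorphism_def)
      hence "card {1..m} = card {1..n}" by (rule bij_betw_same_card)
      hence mn: "m = n" by simp
      obtain f where "f permutes {1..n}" "lact f ` A = B"
        using iso isomorphic_iff[OF assms(1)] B unfolding mn by blast
      thus "N \<in> mk_struct n ` (\<lambda>f. lact f ` A) ` {f. f permutes {1..n}}"
        using B(1) mn by auto
    qed
  qed
qed

lemma card_iso_classes:
  assumes X: "X \<subseteq> Pow (tup n)" and n: "n \<ge> 1"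
    and closed: "\<And>f A. f permutes {1..n} \<Longrightarrow> A \<in> X \<Longrightarrow> lact f ` A \<in> X"
  shows "card (iso_classes ar (mk_struct n ` X)) * fact n = (\<Sum>A\<in>X. card (autg n A))"
proof -
  interpret finite_action "{1..n}" "{f. f permutes {1..n}}" "\<lambda>f A. lact f ` A" X
    by unfold_locales
       (use closed in \<open>auto simp: pgroup_sym finite_permutations lact_comp_image
          intro: finite_subset[OF X] finite_tup\<close>)
  have "iso_classes ar (mk_struct n ` X) = (\<lambda>U. mk_struct n ` U) ` orb ` X"
    unfolding iso_classes_def image_image 
  proof (rule image_cong[OF refl])
    fix A assume "A \<in> X"
    hence "A \<subseteq> tup n" using X by blast
    from iso_class_eq[OF this n] show "iso_class ar (mk_struct n A) = mk_struct n ` orb A"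
      by (simp only: orb_def)
  qed
  hence "card (iso_classes ar (mk_struct n ` X)) = card (orb ` X)"
    by (simp add: card_image inj_on_image inj_on_def inj_image_eq_iff[OF inj_mk_struct])
  thus ?thesis using burnside_stab by (simp add: card_permutations autg_def)
qed

text \<open>As \<open>X\<close> is closed under relabelling, all \<open>n choose t\<close> supports
  of size \<open>t\<close> contribute the same amount as \<open>{1..t}\<close>, and
  \<open>n choose t\<close> divided by n! is 1 / (t! (n - t)!).\<close>

lemma class_count:
  assumes X: "X \<subseteq> Pow (tup n)" and n: "n \<ge> 1"
    and closed: "\<And>f A. f permutes {1..n} \<Longrightarrow> A \<in> X \<Longrightarrow> lact f ` A \<in> X"
  shows "real (card (iso_classes ar (mk_struct n ` X))) =
    (\<Sum>t\<le>n. (\<Sum>P\<in>full_groups t. real (card P) * real (card {A\<in>X. autg n A = P})) /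
       (fact t * fact (n - t)))"
proof -
  have finX: "finite X" using X finite_subset finite_tup by blast
  define a where "a = (\<lambda>S. \<Sum>A | A \<in> X \<and> supp (autg n A) = S. card (autg n A))"
  have a_eq: "a S = a {1..card S}" if S: "S \<subseteq> {1..n}" for S
  proof -
    obtain f where f: "f permutes {1..n}" "f ` {1..card S} = S"
      using exists_permutation_onto[OF S] by blast
    have inj: "inj f" using f permutes_inj by blast
    have sup: "supp (autg n (lact f ` A)) = f ` supp (autg n A)" for A :: "('i \<times> nat list) set"
      by (simp only: autg_conj[OF f(1)] supp_conj[OF f(1)])
    show ?thesis unfolding a_def
    proof (rule sum.reindex_bij_witness[where j = "\<lambda>A. lact (invf f) ` A" and i = "\<lambda>A. lact f ` A"])
      fix A assume A: "A \<in> {A. A \<in> X \<and> supp (autg n A) = S}"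
      show *: "lact f ` lact (invf f) ` A = A" by (rule lact_image_cancel[OF f(1)])
      have "f ` supp (autg n (lact (invf f) ` A)) = f ` {1..card S}"
        using sup[of "lact (invf f) ` A"] A f(2) unfolding * by simp
      hence "supp (autg n (lact (invf f) ` A)) = {1..card S}"
        by (simp only: inj_image_eq_iff[OF inj])
      thus "lact (invf f) ` A \<in> {A. A \<in> X \<and> supp (autg n A) = {1..card S}}"
        using A closed f permutes_inv by blast
      show "card (autg n (lact (invf f) ` A)) = card (autg n A)"
        by (simp only: autg_conj[OF permutes_inv[OF f(1)]] card_conj[OF permutes_inv[OF f(1)]])
    next
      fix A assume A: "A \<in> {A. A \<in> X \<and> supp (autg n A) = {1..card S}}"
      show "lact (invf f) ` lact f ` A = A" by (rule lact_image_cancel[OF f(1)])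
      show "lact f ` A \<in> {A. A \<in> X \<and> supp (autg n A) = S}"
        using A closed f sup by auto
    qed
  qed
  have "(\<Sum>A\<in>X. card (autg n A)) = (\<Sum>S\<in>Pow {1..n}. a S)"
    unfolding a_def
    by (rule sum.group[symmetric, OF finX]) (use supp_autg in auto)
  also have "\<dots> = (\<Sum>S\<in>Pow {1..n}. a {1..card S})" using a_eq by (intro sum.cong) auto
  also have "\<dots> = (\<Sum>t\<le>n. \<Sum>S | S \<in> Pow {1..n} \<and> card S = t. a {1..card S})"
  proof (rule sum.group[symmetric])
    show "card ` Pow {1..n} \<subseteq> {..n}" using card_mono[of "{1..n}"] by fastforce
  qed auto
  also have "\<dots> = (\<Sum>t\<le>n. (n choose t) * a {1..t})"
    by (intro sum.cong refl) (simp add: n_subsets[of "{1..n}", simplified])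
  finally have eq: "card (iso_classes ar (mk_struct n ` X)) * fact n = (\<Sum>t\<le>n. (n choose t) * a {1..t})"
    using card_iso_classes[OF assms] by simp
  have a_groups: "a {1..t} = (\<Sum>P\<in>full_groups t. card P * card {A\<in>X. autg n A = P})" for t
  proof -
    have "a {1..t} = (\<Sum>P\<in>full_groups t. \<Sum>A | A \<in> {A \<in> X. supp (autg n A) = {1..t}} \<and> autg n A = P.
        card (autg n A))"
      unfolding a_def
      by (rule sum.group[symmetric]) (use finX autg_full_group finite_full_groups in auto)
    also have "\<dots> = (\<Sum>P\<in>full_groups t. \<Sum>A | A \<in> X \<and> autg n A = P. card P)"
      by (intro sum.cong refl) (auto simp: full_groups_def)
    finally show ?thesis by (simp add: mult.commute)
  qed
  have "real (card (iso_classes ar (mk_struct n ` X))) = real (\<Sum>t\<le>n. (n choose t) * a {1..t}) / fact n"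
    using eq by (metis (no_types) nonzero_mult_div_cancel_right of_nat_fact of_nat_mult fact_nonzero)
  also have "\<dots> = (\<Sum>t\<le>n. real (n choose t) / fact n * real (a {1..t}))"
    by (simp add: sum_divide_distrib)
  also have "\<dots> = (\<Sum>t\<le>n. real (a {1..t}) / (fact t * fact (n - t)))"
    by (intro sum.cong refl) (simp add: binomial_fact)
  finally show ?thesis unfolding a_groups by simp
qed

end

section \<open>Sets of tuples invariant under a permutation group\<close>

definition invs :: "('a \<Rightarrow> 'a) set \<Rightarrow> ('i \<times> 'a list) set \<Rightarrow> ('i \<times> 'a list) set set" where
  "invs P X = {A. A \<subseteq> X \<and> (\<forall>p\<in>P. lact p ` A = A)}"

lemma invsD: "A \<in> invs P X \<Longrightarrow> A \<subseteq> X" "A \<in> invs P X \<Longrightarrow> p \<in> P \<Longrightarrow> lact p ` A = A"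
  by (auto simp: invs_def)

lemma invsI: "A \<subseteq> X \<Longrightarrow> (\<And>p. p \<in> P \<Longrightarrow> lact p ` A = A) \<Longrightarrow> A \<in> invs P X"
  by (auto simp: invs_def)

lemma finite_invs: "finite X \<Longrightarrow> finite (invs P X)"
  by (rule finite_subset[of _ "Pow X"]) (auto simp: invs_def)

lemma invs_Un:
  assumes "A \<in> invs P X" "B \<in> invs P X" shows "A \<union> B \<in> invs P X"
  using invsD[OF assms(1)] invsD[OF assms(2)] by (intro invsI) (auto simp: image_Un)

lemma invs_Diff:
  assumes "\<And>p. p \<in> P \<Longrightarrow> inj p" "A \<in> invs P X" "B \<in> invs P Y" shows "A - B \<in> invs P X"
proof (rule invsI)
  show "A - B \<subseteq> X" using invsD(1)[OF assms(2)] by blast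
  show "lact p ` (A - B) = A - B" if "p \<in> P" for p
    using image_set_diff[OF lact_inj[OF assms(1)[OF that]], of A B] invsD(2) assms(2,3) that by metis
qed

lemma invs_mono: "X \<subseteq> Y \<Longrightarrow> invs P X \<subseteq> invs P Y"
  by (auto simp: invs_def)

lemma invs_singleton:
  assumes "(i, xs) \<in> X" "\<And>p a. p \<in> P \<Longrightarrow> a \<in> set xs \<Longrightarrow> p a = a"
  shows "{(i, xs)} \<in> invs P X"
proof (rule invsI)
  show "{(i, xs)} \<subseteq> X" using assms by simp
  show "lact p ` {(i, xs)} = {(i, xs)}" if "p \<in> P" for p
    using assms(2)[OF that] by (simp add: map_idI)
qed

lemma invs_orbit:
  assumes "pgroup S P" "finite S" "x \<in> X" "finite X" "\<And>p y. p \<in> P \<Longrightarrow> y \<in> X \<Longrightarrow> lact p y \<in> X"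
  shows "(\<lambda>p. lact p x) ` P \<in> invs P X"
proof -
  interpret finite_action S P lact X
    by unfold_locales (use assms pgroup_finite in \<open>auto simp: lact_comp\<close>)
  show ?thesis
  proof (rule invsI)
    show "(\<lambda>p. lact p x) ` P \<subseteq> X" using assms by blast
    fix p assume p: "p \<in> P"
    have "lact p ` (\<lambda>q. lact q x) ` P = (\<lambda>q. lact q x) ` (\<lambda>q. p \<circ> q) ` P"
      by (simp add: image_image lact_comp)
    also have "(\<lambda>q. p \<circ> q) ` P = P"
    proof
      show "(\<lambda>q. p \<circ> q) ` P \<subseteq> P" using P_comp p by blast
      show "P \<subseteq> (\<lambda>q. p \<circ> q) ` P"
      proof
        fix q assume "q \<in> P"
        hence "q = p \<circ> (invf p \<circ> q)" "invf p \<circ> q \<in> P"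
          using inv_comp[OF p] P_comp P_inv p by (simp_all add: o_assoc)
        thus "q \<in> (\<lambda>q. p \<circ> q) ` P" by blast
      qed
    qed
    finally show "lact p ` (\<lambda>p. lact p x) ` P = (\<lambda>p. lact p x) ` P" .
  qed
qed

section \<open>Elementary estimates\<close>

lemma power_le_power_diff:
  fixes n t k :: nat
  assumes "t \<le> n"
  shows "n ^ k \<le> (n - t) ^ k + k * t * n ^ (k - 1)"
proof (induction k)
  case (Suc k)
  have "n ^ Suc k = n * n ^ k" by simp
  also have "\<dots> = (n - t) * n ^ k + t * n ^ k"
    using assms by (simp flip: add_mult_distrib)
  also have "(n - t) * n ^ k \<le> (n - t) * ((n - t) ^ k + k * t * n ^ (k - 1))"
    by (rule mult_left_mono[OF Suc]) simp
  also have "\<dots> \<le> (n - t) ^ Suc k + k * t * n ^ k"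
  proof -
    have "(n - t) * (k * t * n ^ (k - 1)) \<le> k * t * n ^ k"
    proof (cases k)
      case (Suc j)
      have "(n - t) * (k * t * n ^ (k - 1)) \<le> n * (k * t * n ^ (k - 1))"
        by (rule mult_right_mono) auto
      thus ?thesis using Suc by (simp add: algebra_simps)
    qed auto
    thus ?thesis by (simp add: algebra_simps)
  qed
  finally show ?case by (simp add: algebra_simps)
qed simp

lemma fact_le_power_ge: 
  assumes "k \<le> n" shows "fact k \<le> (n ^ k :: nat)"
proof -
  have "fact k \<le> k ^ k" using Factorial.fact_le_power[of k, where 'a = nat] by (simp only: of_nat_id)
  also have "\<dots> \<le> n ^ k" using assms by (rule power_mono) simp
  finally show ?thesis .
qed

lemma power_times_geometric:
  fixes c :: real
  assumes "0 < c" "c < 1"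
  shows "(\<lambda>n. real n ^ a * c ^ (n - b)) \<longlonglongrightarrow> 0"
proof -
  have "(\<lambda>n. real n ^ a * c ^ n / c ^ b) \<longlonglongrightarrow> 0"
    using assms by real_asymp
  moreover have "eventually (\<lambda>n. real n ^ a * c ^ n / c ^ b = real n ^ a * c ^ (n - b)) sequentially"
    using eventually_ge_at_top[of b]
    by eventually_elim (use assms in \<open>simp add: power_diff\<close>)
  ultimately show ?thesis by (rule Lim_transform_eventually)
qed

text \<open>The crude factor \<open>n\<close> is harmless: \<open>q\<close> will be exponentially
  small in \<open>n\<close>.\<close>

lemma geometric_tail_le:
  fixes q :: real
  assumes "0 \<le> q" "q \<le> 1" "1 \<le> m"
  shows "(\<Sum>s=m..n. q ^ s) \<le> real n * q"
proof -
  have "(\<Sum>s=m..n. q ^ s) \<le> (\<Sum>s=m..n. q ^ 1)"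
    by (rule sum_mono, rule power_decreasing) (use assms in auto)
  also have "\<dots> \<le> real n * q" using assms by (auto intro!: mult_right_mono)
  finally show ?thesis .
qed

abbreviation moved_above :: "nat \<Rightarrow> nat \<Rightarrow> (nat \<Rightarrow> nat) \<Rightarrow> nat set" where
  "moved_above t n g \<equiv> {a\<in>{t+1..n}. g a \<noteq> a}"

text \<open>There are at most n^s choices for the moved points above \<open>t\<close>, and the
  permutation then lives on these points and \<open>{1..t}\<close>, which leaves (t + s)! \<le>
  n^(t+s) possibilities.\<close>

lemma card_moving_outside:
  assumes "t \<le> n"
  shows "card {g. g permutes {1..n} \<and> card (moved_above t n g) = s} \<le> n ^ (2 * s + t)"
proof (cases "t + s \<le> n")
  case True
  let ?I = "{S. S \<subseteq> {t+1..n} \<and> card S = s}"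
  have fin: "finite ?I" by simp
  have "{g. g permutes {1..n} \<and> card (moved_above t n g) = s}
     \<subseteq> (\<Union>S\<in>?I. {g. g permutes {1..t} \<union> S})"
  proof
    fix g assume "g \<in> {g. g permutes {1..n} \<and> card (moved_above t n g) = s}"
    hence g: "g permutes {1..n}" and c: "card (moved_above t n g) = s" by auto
    define S where "S = moved_above t n g"
    have "g permutes {1..t} \<union> S"
      by (rule permutes_superset[OF g]) (auto simp: S_def)
    hence 1: "g \<in> {g. g permutes {1..t} \<union> S}" by simp
    have "S \<subseteq> {t+1..n}" unfolding S_def by (rule Collect_restrict)
    hence "S \<in> ?I" using c unfolding S_def by (intro CollectI conjI)
    thus "g \<in> (\<Union>S\<in>?I. {g. g permutes {1..t} \<union> S})" using 1 by (rule UN_I)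
  qed
  note sub = this
  have finS: "finite S" if "S \<in> ?I" for S
    by (rule finite_subset[of S "{t+1..n}"]) (use that in simp_all)
  have finU: "finite (\<Union>S\<in>?I. {g. g permutes {1..t} \<union> S})"
  proof (rule finite_UN_I[OF fin])
    fix S assume "S \<in> ?I"
    from finS[OF this] show "finite {g. g permutes {1..t} \<union> S}" by (intro finite_permutations) simp
  qed
  have "card {g. g permutes {1..n} \<and> card (moved_above t n g) = s}
     \<le> card (\<Union>S\<in>?I. {g. g permutes {1..t} \<union> S})"
    by (rule card_mono[OF finU sub])
  also have "\<dots> \<le> (\<Sum>S\<in>?I. card {g. g permutes {1..t} \<union> S})" by (rule card_UN_le[OF fin])
  also have "\<dots> \<le> (\<Sum>S\<in>?I. n ^ (t + s))"
  proof (rule sum_mono)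
    fix S assume S: "S \<in> ?I"
    have "card ({1..t} \<union> S) = t + s"
      using S finS[OF S] by (subst card_Un_disjoint) auto
    hence "card {g. g permutes {1..t} \<union> S} = fact (t + s)"
      using finS[OF S] card_permutations by blast
    thus "card {g. g permutes {1..t} \<union> S} \<le> n ^ (t + s)" using fact_le_power_ge[OF True] by simp
  qed
  also have "\<dots> = ((n - t) choose s) * n ^ (t + s)"
    using n_subsets[of "{t+1..n}" s] by simp
  also have "\<dots> \<le> n ^ s * n ^ (t + s)"
  proof (rule mult_right_mono)
    have "(n - t) choose s \<le> (n - t) ^ s" by (rule binomial_le_pow) (use True in linarith)
    also have "\<dots> \<le> n ^ s" by (rule power_mono) auto
    finally show "(n - t) choose s \<le> n ^ s" .
  qed simp
  also have "\<dots> = n ^ (2 * s + t)" by (simp flip: power_add) (simp add: mult_2 add_ac)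
  finally show ?thesis .
next
  case False
  have "card (moved_above t n g) \<noteq> s" for g :: "nat \<Rightarrow> nat"
  proof -
    have "card (moved_above t n g) \<le> card {t+1..n}" by (rule card_mono) auto
    thus ?thesis using False assms by simp
  qed
  thus ?thesis by simp
qed

section \<open>Splitting an invariant set into its parts inside and outside
  \<open>tup t\<close>\<close>

context vocabulary
begin

text \<open>The empty tuple of a symbol of arity 0 lies in every \<open>tup t\<close> and never in
  \<open>mix t n\<close>. So even for \<open>t = 0\<close> the inner part may be nontrivial: it
  records the truth values of the nullary relations.\<close>

definition mix :: "nat \<Rightarrow> nat \<Rightarrow> ('i \<times> nat list) set" where
  "mix t n = tup n - tup t"

definition mixcount :: "nat \<Rightarrow> (nat \<Rightarrow> nat) set \<Rightarrow> nat \<Rightarrow> nat" where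
  "mixcount t P n = card (invs P (mix t n))"

lemma finite_mix: "finite (mix t n)"
  by (simp add: mix_def finite_tup)

lemma mixcount_pos: "mixcount t P n > 0"
proof -
  have "{} \<in> invs P (mix t n)" by (auto simp: invs_def)
  thus ?thesis using finite_invs[OF finite_mix] card_gt_0_iff unfolding mixcount_def by blast
qed

lemma lact_mix:
  assumes "p permutes {1..t}" "t \<le> n" shows "lact p x \<in> mix t n \<longleftrightarrow> x \<in> mix t n"
proof -
  have "p permutes {1..n}" by (rule permutes_subset[OF assms(1)]) (use assms(2) in auto)
  thus ?thesis using lact_tup_iff assms(1) by (simp add: mix_def)
qed

lemma invs_split:
  assumes P: "\<And>p. p \<in> P \<Longrightarrow> p permutes {1..t}" and n: "t \<le> n" and A: "A \<in> invs P (tup n)"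
  shows "A \<inter> tup t \<in> invs P (tup t)" "A - tup t \<in> invs P (mix t n)"
proof -
  have tt: "tup t \<in> invs P (tup t)" by (rule invsI) (use lact_tup[OF P] in simp_all)
  have inj: "inj p" if "p \<in> P" for p using P[OF that] permutes_inj by blast
  have d: "A - tup t \<in> invs P (tup n)" by (rule invs_Diff[OF inj A tt])
  have "A - (A - tup t) \<in> invs P (tup n)" by (rule invs_Diff[OF inj A d])
  moreover have "A - (A - tup t) = A \<inter> tup t" by blast
  ultimately show "A \<inter> tup t \<in> invs P (tup t)" by (auto simp: invs_def)
  show "A - tup t \<in> invs P (mix t n)" using d invsD(1)[OF A] by (auto simp: invs_def mix_def)
qed

lemma invs_join:
  assumes "t \<le> n" "A0 \<in> invs P (tup t)" "R \<in> invs P (mix t n)"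
  shows "A0 \<union> R \<in> invs P (tup n)"
  using invs_Un invs_mono[OF tup_mono[OF assms(1)]] invs_mono[of "mix t n" "tup n"] assms(2,3)
  by (metis Diff_subset mix_def subsetD)

lemma join_split:
  assumes "A0 \<subseteq> tup t" "R \<subseteq> mix t n"
  shows "(A0 \<union> R) \<inter> tup t = A0" "(A0 \<union> R) - tup t = R"
  using assms by (auto simp: mix_def)

text \<open>A group on \<open>{1..t}\<close> preserves \<open>tup t\<close>, so the two parts can be
  chosen independently. The first factor is constant in \<open>n\<close>.\<close>

lemma card_invs_tup:
  assumes P: "\<And>p. p \<in> P \<Longrightarrow> p permutes {1..t}" and n: "t \<le> n"
  shows "card (invs P (tup n)) = card (invs P (tup t)) * mixcount t P n"
proof -
  have "bij_betw (\<lambda>(A, R). A \<union> R) (invs P (tup t) \<times> invs P (mix t n)) (invs P (tup n))"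
  proof (rule bij_betwI[where g = "\<lambda>A. (A \<inter> tup t, A - tup t)"])
    show "(\<lambda>(A, R). A \<union> R) \<in> invs P (tup t) \<times> invs P (mix t n) \<rightarrow> invs P (tup n)"
      using invs_join[OF n] by auto
    show "(\<lambda>A. (A \<inter> tup t, A - tup t)) \<in> invs P (tup n) \<rightarrow> invs P (tup t) \<times> invs P (mix t n)"
      using invs_split[OF P n] by auto
    show "((case x of (A, R) \<Rightarrow> A \<union> R) \<inter> tup t, (case x of (A, R) \<Rightarrow> A \<union> R) - tup t) = x"
      if "x \<in> invs P (tup t) \<times> invs P (mix t n)" for x
    proof -
      obtain A R where x: "x = (A, R)" by (cases x)
      have "A \<subseteq> tup t" "R \<subseteq> mix t n" using that x invsD(1) by auto
      thus ?thesis using join_split[of A t R n] x by simp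
    qed
  qed auto
  thus ?thesis by (simp add: mixcount_def card_cartesian_product flip: bij_betw_same_card)
qed

section \<open>The cost of an additional automorphism\<close>

definition rmax :: nat where "rmax = Max (range ar)"

lemma rmax_ge_2: "rmax \<ge> 2" using max_arity by (simp add: rmax_def)

lemma ar_le_rmax: "ar i \<le> rmax" by (simp add: rmax_def)

lemma obtain_rmax: obtains i where "ar i = rmax"
proof -
  have "rmax \<in> range ar" unfolding rmax_def by (rule Max_in) auto
  thus ?thesis using that by auto
qed

text \<open>The tuples \<open>(a, ys)\<close> with \<open>a\<close> in a set \<open>B\<close> displaced by \<open>g\<close> and \<open>ys\<close> outside \<open>{1..t}\<close>
  are fixed by \<open>P\<close>, but their membership in a \<open>g\<close>-invariant set is tied to that of other tuples.\<close>
lemma moving_bound: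
  assumes P: "pgroup {1..t} P" and n: "t \<le> n" and g: "g permutes {1..n}"
  shows "\<exists>m. card (moved_above t n g) \<le> 3 * m \<and>
    card {A \<in> invs P (tup n). lact g ` A = A} * 2 ^ (m * (n - t) ^ (rmax - 1)) \<le> card (invs P (tup n))"
proof -
  obtain i where i: "ar i = rmax" by (rule obtain_rmax)
  have inj: "inj g" using g permutes_inj by blast
  obtain B where B: "B \<subseteq> moved_above t n g" "B \<inter> g ` B = {}"
    "card (moved_above t n g) \<le> 3 * card B"
  proof -
    have "\<exists>B\<subseteq>(moved_above t n g). B \<inter> g ` B = {} \<and> card (moved_above t n g) \<le> 3 * card B"
      by (rule exists_displaced_subset) (use inj in simp_all)
    thus ?thesis using that by (elim exE conjE)
  qed
  \<comment> \<open>The entries after the first are free in \<open>{t+1..n}\<close>; they supply the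
    factor \<open>(n - t) ^ (rmax - 1)\<close> in the exponent.\<close>
  define Ys where "Ys = {ys. set ys \<subseteq> {t+1..n} \<and> length ys = rmax - 1}"
  define e where "e = (\<lambda>(a :: nat, ys). (i, a # ys))"
  have finB: "finite B" using B(1) finite_subset by fastforce
  have finY: "finite Ys" unfolding Ys_def by (rule finite_lists_length_eq) simp
  have etup: "e x \<in> tup n" if "x \<in> B \<times> Ys" for x
    using that B(1) i rmax_ge_2 by (fastforce simp: e_def Ys_def tup_iff)
  have fixes_out: "p a = a" if "p \<in> P" "a \<in> {t+1..n}" for p a
    using pgroup_permutes[OF P that(1)] permutes_not_in that(2) by fastforce
  have e_inv: "{e x} \<in> invs P (tup n)" if "x \<in> B \<times> Ys" for x
  proof -
    obtain a ys where x: "x = (a, ys)" by (cases x)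
    have "b \<in> {t+1..n}" if "b \<in> set (a # ys)" for b
      using that \<open>x \<in> B \<times> Ys\<close> x B(1) by (auto simp: Ys_def)
    moreover have "e x = (i, a # ys)" by (simp add: x e_def)
    ultimately show ?thesis
      using etup[OF that] invs_singleton[of i "a # ys" "tup n" P] fixes_out by metis
  qed
  have "card {A \<in> invs P (tup n). lact g ` A = A} * 2 ^ card (B \<times> Ys) \<le> card (invs P (tup n))"
  proof (rule halving[where e = e and f = "\<lambda>x. lact g (e x)" and U = "\<lambda>x. {e x}"])
    show "finite (invs P (tup n))" by (simp add: finite_invs finite_tup)
    show "finite (B \<times> Ys)" using finB finY by simp
    show "{A \<in> invs P (tup n). lact g ` A = A} \<subseteq> invs P (tup n)" by blast
    have injP: "inj p" if "p \<in> P" for p using pgroup_permutes[OF P that] permutes_inj by blast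
    show "R - {e x} \<union> ({e x} - R) \<in> invs P (tup n)" if "R \<in> invs P (tup n)" "x \<in> B \<times> Ys" for R x
      using invs_Un invs_Diff[OF injP] e_inv that by metis
    show "e x \<in> R \<longleftrightarrow> lact g (e x) \<in> R" if "R \<in> {A \<in> invs P (tup n). lact g ` A = A}" for R x
      using lact_in_iff[OF inj, of R "e x"] that by simp
    show "e x \<in> {e y} \<longleftrightarrow> x = y" for x y by (auto simp: e_def split: prod.splits)
    \<comment> \<open>The first entry of the image lies in the image of \<open>B\<close> under
      \<open>g\<close>, which misses \<open>B\<close>.\<close>
    show "lact g (e x) \<notin> {e y}" if "x \<in> B \<times> Ys" "y \<in> B \<times> Ys" for x y
    proof
      assume eq: "lact g (e x) \<in> {e y}"
      obtain a ys b zs where xy: "x = (a, ys)" "y = (b, zs)" by (cases x, cases y)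
      have "g a = b" using eq xy by (simp add: e_def)
      hence "b \<in> B \<inter> g ` B" using that xy by auto
      thus False using B(2) by blast
    qed
  qed
  moreover have "card (B \<times> Ys) = card B * (n - t) ^ (rmax - 1)"
    unfolding Ys_def using card_lists_length_eq[of "{t+1..n}" "rmax - 1"] by (simp add:
        card_cartesian_product)
  ultimately show ?thesis using B(3) by (intro exI[of _ "card B"]) simp
qed

text \<open>The largest group of permutations of \<open>{1..t}\<close> with the same orbits as \<open>P\<close> on the tuples
  that leave \<open>{1..t}\<close>.\<close>
definition hat :: "nat \<Rightarrow> (nat \<Rightarrow> nat) set \<Rightarrow> (nat \<Rightarrow> nat) set" where
  "hat t P = {f. f permutes {1..t} \<and>
     (\<forall>i xs. length xs = ar i \<and> \<not> set xs \<subseteq> {1..t} \<longrightarrow> (\<exists>p\<in>P. map f xs = map p xs))}"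

text \<open>In a tuple witnessing that \<open>f\<close> is not in \<open>hat t P\<close>, all
  entries outside \<open>{1..t}\<close> can be merged into one point \<open>x\<close>: they are
  fixed by \<open>f\<close> and by \<open>P\<close>, so \<open>f\<close> still takes the tuple out
  of its \<open>P\<close>-orbit. The \<open>n - t\<close> choices of \<open>x\<close> give as many
  ties between distinct orbits for \<open>halving\<close>.\<close>

lemma hat_bound:
  assumes P: "pgroup {1..t} P" and n: "t \<le> n" and f: "f permutes {1..t}" "f \<notin> hat t P"
  shows "card {A \<in> invs P (tup n). lact f ` A = A} * 2 ^ (n - t) \<le> card (invs P (tup n))"
proof -
  obtain i xs where xs: "length xs = ar i" "\<not> set xs \<subseteq> {1..t}"
    "\<And>p. p \<in> P \<Longrightarrow> map f xs \<noteq> map p xs"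
    using f by (auto simp: hat_def)
  \<comment> \<open>\<open>hat\<close> does not mention \<open>n\<close>, so the outer entries of
    the witness may be 0 or exceed \<open>n\<close>; the merging also brings them into
    \<open>{t+1..n}\<close>.\<close>
  define h where "h = (\<lambda>x a. if a \<in> {1..t} then a else x :: nat)"
  define e where "e = (\<lambda>x. (i, map (h x) xs))"
  define U where "U = (\<lambda>x. (\<lambda>p. lact p (e x)) ` P)"
  have out: "p a = a" if "p permutes {1..t}" "a \<notin> {1..t}" for p a
    using permutes_not_in that by metis
  have perm_n: "p permutes {1..n}" if "p permutes {1..t}" for p
    by (rule permutes_subset[OF that]) (use n in auto)
  \<comment> \<open>An outer entry gives \<open>x = y\<close>; the inner entries, untouched by
    \<open>h\<close>, give the agreement of \<open>q\<close> and \<open>p\<close> on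
    \<open>xs\<close>.\<close>
  have key: "x = y \<and> map q xs = map p xs"
    if "p permutes {1..t}" "q permutes {1..t}" "x \<in> {t+1..n}" "y \<in> {t+1..n}" "lact q (e x) = lact
        p (e y)"
    for p q x y
  proof -
    have eq: "q (h x a) = p (h y a)" if "a \<in> set xs" for a
      using \<open>lact q (e x) = lact p (e y)\<close> that by (auto simp: e_def)
    obtain a where a: "a \<in> set xs" "a \<notin> {1..t}" using xs(2) by blast
    have "x = y" using eq[OF a(1)] a(2) out[OF that(1)] out[OF that(2)] that(3,4) by (auto simp: h_def)
    moreover have "q a = p a" if "a \<in> set xs" for a
    proof (cases "a \<in> {1..t}")
      case True
      thus ?thesis using eq[OF that] unfolding h_def by (simp only: if_True)
    next
      case False
      thus ?thesis using out[of q a] out[of p a] \<open>p permutes {1..t}\<close> \<open>q permutes {1..t}\<close> by simp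
    qed
    ultimately show ?thesis by simp
  qed
  have "card {A \<in> invs P (tup n). lact f ` A = A} * 2 ^ card {t+1..n} \<le> card (invs P (tup n))"
  proof (rule halving[where e = e and f = "\<lambda>x. lact f (e x)" and U = U])
    show "finite (invs P (tup n))" by (simp add: finite_invs finite_tup)
    show "{A \<in> invs P (tup n). lact f ` A = A} \<subseteq> invs P (tup n)" by blast
    have injP: "inj p" if "p \<in> P" for p using pgroup_permutes[OF P that] permutes_inj by blast
    have U_inv: "U x \<in> invs P (tup n)" if x: "x \<in> {t+1..n}" for x
      unfolding U_def
    proof (rule invs_orbit[OF P])
      show "e x \<in> tup n" using x xs(1) n by (auto simp: e_def tup_iff h_def)
      show "lact p y \<in> tup n" if "p \<in> P" "y \<in> tup n" for p y
        using lact_tup_iff[OF perm_n[OF pgroup_permutes[OF P that(1)]]] that(2) by blast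
    qed (auto simp: finite_tup)
    show "R - U x \<union> (U x - R) \<in> invs P (tup n)" if "R \<in> invs P (tup n)" "x \<in> {t+1..n}" for R x
      using invs_Un invs_Diff[OF injP] U_inv that by metis
    show "e x \<in> R \<longleftrightarrow> lact f (e x) \<in> R" if "R \<in> {A \<in> invs P (tup n). lact f ` A = A}" for R x
      using lact_in_iff[of f R "e x"] permutes_inj[OF f(1)] that by simp
    show "e x \<in> U y \<longleftrightarrow> x = y" if "x \<in> {t+1..n}" "y \<in> {t+1..n}" for x y
    proof
      assume "e x \<in> U y"
      then obtain p where "p \<in> P" "lact id (e x) = lact p (e y)" by (auto simp: U_def)
      thus "x = y" using key[of p id x y] that pgroup_permutes[OF P] permutes_id by blast
    next
      assume "x = y"
      thus "e x \<in> U y" using pgroup_id[OF P] lact_id(2) unfolding U_def by force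
    qed
    show "lact f (e x) \<notin> U y" if "x \<in> {t+1..n}" "y \<in> {t+1..n}" for x y
    proof
      assume "lact f (e x) \<in> U y"
      then obtain p where "p \<in> P" "lact f (e x) = lact p (e y)" by (auto simp: U_def)
      thus False using key[of p f x y] that pgroup_permutes[OF P] f(1) xs(3) by blast
    qed
  qed auto
  thus ?thesis by simp
qed

text \<open>The part outside \<open>tup t\<close> cannot separate \<open>P\<close> from
  \<open>hat t P\<close>, so the part inside must. Membership of the inner part is necessary for
  automorphism group \<open>P\<close> (\<open>autg_base\<close>) and almost surely sufficient
  (\<open>bad_ratio\<close>). The set may be empty, and then \<open>P\<close> does not
  occur.\<close>

definition base :: "nat \<Rightarrow> (nat \<Rightarrow> nat) set \<Rightarrow> ('i \<times> nat list) set set" where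
  "base t P = {A \<in> invs P (tup t). {f \<in> hat t P. lact f ` A = A} = P}"

lemma finite_base: "finite (base t P)"
  by (simp add: base_def finite_invs finite_tup)

text \<open>On each single tuple of \<open>R\<close> the permutation \<open>f\<close> acts like some
  member of \<open>P\<close>, so it maps \<open>R\<close> into itself; equality follows by
  finiteness.\<close>

lemma hat_invs:
  assumes P: "pgroup {1..t} P" and f: "f \<in> hat t P" and R: "R \<in> invs P (mix t n)"
  shows "lact f ` R = R"
proof -
  have perm: "f permutes {1..t}" using f by (simp add: hat_def)
  have *: "\<exists>p\<in>P. lact f x = lact p x" if xR: "x \<in> R" for x
  proof -
    obtain i xs where x: "x = (i, xs)" by (cases x)
    have "x \<in> mix t n" using invsD(1)[OF R] xR by blast
    hence "length xs = ar i \<and> \<not> set xs \<subseteq> {1..t}" using x by (auto simp: mix_def tup_iff)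
    thus ?thesis using f x by (auto simp: hat_def)
  qed
  have sub: "lact f ` R \<subseteq> R"
  proof
    fix y assume "y \<in> lact f ` R"
    then obtain x where x: "x \<in> R" "y = lact f x" by blast
    then obtain p where "p \<in> P" "y = lact p x" using *[OF x(1)] by auto
    thus "y \<in> R" using invsD(2)[OF R] x(1) by blast
  qed
  have "finite R" using invsD(1)[OF R] finite_mix finite_subset by blast
  thus ?thesis using sub card_image[of "lact f" R] lact_inj[OF permutes_inj[OF perm]]
    by (metis card_subset_eq inj_on_subset subset_UNIV)
qed

text \<open>By \<open>hat_invs\<close>, a member of \<open>hat t P\<close> that preserves the inner
  part of \<open>A\<close> preserves all of \<open>A\<close>, hence belongs to
  \<open>P\<close>.\<close>

lemma autg_base:
  assumes P: "pgroup {1..t} P" and n: "t \<le> n" and A: "A \<subseteq> tup n" "autg n A = P"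
  shows "A \<in> invs P (tup n)" "A \<inter> tup t \<in> base t P"
proof -
  show inv: "A \<in> invs P (tup n)" using A by (auto simp: invs_def autg_def)
  have perm: "p permutes {1..t}" if "p \<in> P" for p using pgroup_permutes[OF P that] .
  note split = invs_split[OF perm n inv]
  have "f \<in> P" if f: "f \<in> hat t P" "lact f ` (A \<inter> tup t) = A \<inter> tup t" for f
  proof -
    have "f permutes {1..n}"
      by (rule permutes_subset[of f "{1..t}"]) (use f n in \<open>auto simp: hat_def\<close>)
    moreover have "lact f ` (A - tup t) = A - tup t" by (rule hat_invs[OF P f(1) split(2)])
    hence "lact f ` (A \<inter> tup t \<union> (A - tup t)) = A \<inter> tup t \<union> (A - tup t)"
      using f(2) by (simp only: image_Un)
    hence "lact f ` A = A" by (simp add: Un_Diff_Int Int_commute Un_commute Int_Diff_Un)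
    ultimately show ?thesis using A(2) by (auto simp: autg_def)
  qed
  moreover have "f \<in> hat t P" if "f \<in> P" for f using perm[OF that] that by (auto simp: hat_def)
  moreover have "lact f ` (A \<inter> tup t) = A \<inter> tup t" if "f \<in> P" for f using invsD(2)[OF split(1) that] .
  ultimately have "{f \<in> hat t P. lact f ` (A \<inter> tup t) = A \<inter> tup t} = P" by blast
  thus "A \<inter> tup t \<in> base t P" using split(1) unfolding base_def by (intro CollectI conjI)
qed

lemma count_by_base:
  assumes P: "pgroup {1..t} P" and n: "t \<le> n"
  shows "card {A \<in> Pow (tup n). autg n A = P \<and> \<Phi> A} =
    (\<Sum>A0\<in>base t P. card {R \<in> invs P (mix t n). autg n (A0 \<union> R) = P \<and> \<Phi> (A0 \<union> R)})"
proof -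
  let ?S = "SIGMA A0:base t P. {R \<in> invs P (mix t n). autg n (A0 \<union> R) = P \<and> \<Phi> (A0 \<union> R)}"
  have perm: "p permutes {1..t}" if "p \<in> P" for p using pgroup_permutes[OF P that] .
  have "bij_betw (\<lambda>(A, R). A \<union> R) ?S {A \<in> Pow (tup n). autg n A = P \<and> \<Phi> A}"
  proof (rule bij_betwI[where g = "\<lambda>A. (A \<inter> tup t, A - tup t)"])
    show "(\<lambda>(A, R). A \<union> R) \<in> ?S \<rightarrow> {A \<in> Pow (tup n). autg n A = P \<and> \<Phi> A}"
    proof
      fix x assume x: "x \<in> ?S"
      then obtain A R where AR: "x = (A, R)" "A \<in> invs P (tup t)" "R \<in> invs P (mix t n)"
        "autg n (A \<union> R) = P" "\<Phi> (A \<union> R)" by (auto simp: base_def)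
      have "A \<union> R \<subseteq> tup n" by (rule invsD(1)[OF invs_join[OF n AR(2,3)]])
      thus "(case x of (A, R) \<Rightarrow> A \<union> R) \<in> {A \<in> Pow (tup n). autg n A = P \<and> \<Phi> A}"
        using AR by simp
    qed
    show "(\<lambda>A. (A \<inter> tup t, A - tup t)) \<in> {A \<in> Pow (tup n). autg n A = P \<and> \<Phi> A} \<rightarrow> ?S"
    proof
      fix A assume A: "A \<in> {A \<in> Pow (tup n). autg n A = P \<and> \<Phi> A}"
      hence "A \<in> invs P (tup n)" "A \<inter> tup t \<in> base t P" using autg_base[OF P n] by auto
      moreover have "A \<inter> tup t \<union> (A - tup t) = A" by blast
      ultimately show "(A \<inter> tup t, A - tup t) \<in> ?S" using invs_split(2)[OF perm n] A by auto
    qed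
    show "((case x of (A, R) \<Rightarrow> A \<union> R) \<inter> tup t, (case x of (A, R) \<Rightarrow> A \<union> R) - tup t) = x"
      if "x \<in> ?S" for x
    proof -
      obtain A R where x: "x = (A, R)" by (cases x)
      have "A \<subseteq> tup t" "R \<subseteq> mix t n" using that x invsD(1) by (auto simp: base_def)
      thus ?thesis using join_split[of A t R n] x by simp
    qed
  qed auto
  hence "card {A \<in> Pow (tup n). autg n A = P \<and> \<Phi> A} = card ?S"
    by (simp add: bij_betw_same_card)
  thus ?thesis by (simp add: card_SigmaI finite_base finite_invs finite_mix)
qed

end

section \<open>Almost sure absence of further automorphisms\<close>

lemma half_powr_less: "0 < a \<Longrightarrow> (1/2 :: real) powr a < 1"
  using powr_less_mono2[of a "1/2" 1] by simp

lemma fact_le_power_mult: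
  assumes "t \<le> n" shows "fact n \<le> (real n ^ t * fact (n - t) :: real)"
proof -
  have "fact n div fact (n - t) \<le> n ^ t" by (rule fact_div_fact_le_pow[OF assms])
  moreover have "fact (n - t) dvd (fact n :: nat)" by (rule fact_dvd) simp
  ultimately have "fact n \<le> n ^ t * fact (n - t)"
    by (metis dvd_div_mult_self mult_le_mono1)
  thus ?thesis
    unfolding of_nat_fact[symmetric, where 'a = real] of_nat_power[symmetric]
        of_nat_mult[symmetric] of_nat_le_iff .
qed

text \<open>\<open>moving_bound\<close> saves \<open>2 ^ (m * k)\<close> with \<open>m\<close> known
  only up to the factor \<open>d\<close>. This restates the saving per moved point, ready for
  summation over \<open>s\<close>.\<close>

lemma card_ratio_le:
  fixes d :: nat
  assumes "a * 2 ^ (m * k) \<le> b" "s \<le> d * m" "b > 0" "d > 0"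
  shows "real a \<le> real b * (((1/2) powr (1 / real d)) ^ k) ^ s"
proof -
  define c where "c = (1/2 :: real) powr (1 / real d)"
  have c: "0 < c" "c \<le> 1" unfolding c_def by (simp_all add: powr_le1)
  have cd: "c ^ d = 1 / 2" using assms(4) unfolding c_def by (simp add: powr_powr flip: powr_realpow)
  have "real a * 2 ^ (m * k) \<le> real b"
  proof -
    have "real (a * 2 ^ (m * k)) \<le> real b" using assms(1) by (simp only: of_nat_le_iff)
    thus ?thesis by simp
  qed
  hence "real a \<le> real b * (1/2) ^ (m * k)" by (simp add: field_simps power_one_over)
  also have "(1/2 :: real) ^ (m * k) = (c ^ k) ^ (d * m)"
    unfolding cd[symmetric] by (simp add: mult_ac flip: power_mult)
  also have "(c ^ k) ^ (d * m) \<le> (c ^ k) ^ s"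
    by (rule power_decreasing[OF assms(2)]) (use c in \<open>auto intro: power_le_one\<close>)
  finally show ?thesis unfolding c_def by (simp add: mult_left_mono)
qed

context vocabulary
begin

abbreviation extra_aut ::
  "nat \<Rightarrow> (nat \<Rightarrow> nat) set \<Rightarrow> ('i \<times> nat list) set \<Rightarrow> nat \<Rightarrow> ('i \<times> nat list) set set" where
  "extra_aut t P A0 n \<equiv> {R \<in> invs P (mix t n). autg n (A0 \<union> R) \<noteq> P}"

text \<open>Almost all \<open>P\<close>-invariant structures extending a member of \<open>base t P\<close> have no further
  automorphisms: one inside \<open>{1..t}\<close> would lie outside \<open>hat t P\<close>, and one moving \<open>s\<close> points
  outside \<open>{1..t}\<close> has probability exponentially small in \<open>s * n\<close>.\<close>
lemma bad_ratio:
  assumes P: "pgroup {1..t} P" and A0: "A0 \<in> base t P"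
  shows "(\<lambda>n. real (card (extra_aut t P A0 n)) / real (mixcount t P n)) \<longlonglongrightarrow> 0"
proof -
  \<comment> \<open>The exponent \<open>1/3\<close> is the proportion of moved points guaranteed by
    \<open>exists_displaced_subset\<close>.\<close>
  define c where "c = (1/2 :: real) powr (1/3)"
  define C where "C = real (card (invs P (tup t)))"
  \<comment> \<open>There are at most n^(2s+t) permutations moving \<open>s\<close> outer points,
    each with proportion at most \<open>c ^ ((n - t) * s)\<close>; the product is
    \<open>n ^ t * q n ^ s\<close>.\<close>
  define q where "q = (\<lambda>n. real n ^ 2 * c ^ (n - t))"
  define b where "b = (\<lambda>n. C * (fact t * (1/2) ^ (n - t) + real n ^ t * (real n * q n)))"
  have c: "0 < c" "c < 1" unfolding c_def using half_powr_less[of "1/3"] by simp_all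
  have q0: "q \<longlonglongrightarrow> 0" unfolding q_def by (rule power_times_geometric[OF c])
  have "(\<lambda>n. real n ^ (t + 3) * c ^ (n - t)) \<longlonglongrightarrow> 0" by (rule power_times_geometric[OF c])
  moreover have "real n ^ (t + 3) * c ^ (n - t) = real n ^ t * (real n * q n)" for n
    by (simp add: q_def power_add power2_eq_square power3_eq_cube)
  ultimately have "(\<lambda>n. real n ^ t * (real n * q n)) \<longlonglongrightarrow> 0" by simp
  moreover have "(\<lambda>n. fact t * (1/2 :: real) ^ (n - t)) \<longlonglongrightarrow> 0"
    using tendsto_mult_right_zero[OF power_times_geometric[of "1/2" 0 t], of "fact t"] by simp
  ultimately have "(\<lambda>n. fact t * (1/2) ^ (n - t) + real n ^ t * (real n * q n)) \<longlonglongrightarrow> 0"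
    using tendsto_add_zero by blast
  hence b0: "b \<longlonglongrightarrow> 0" unfolding b_def by (rule tendsto_mult_right_zero)
  have perm: "p permutes {1..t}" if "p \<in> P" for p using pgroup_permutes[OF P that] .
  have "eventually (\<lambda>n. real (card (extra_aut t P A0 n)) / real (mixcount t P n) \<le> b n) sequentially"
    using order_tendstoD(2)[OF q0, of 1, simplified] eventually_ge_at_top[of "Suc t"]
  proof eventually_elim
    case (elim n)
    hence tn: "t \<le> n" and q1: "q n \<le> 1" by auto
    define N where "N = card (invs P (tup n))"
    define bad where "bad = extra_aut t P A0 n"
    define fix_by where "fix_by = (\<lambda>g. {A \<in> invs P (tup n). lact g ` A = A})"
    define F where "F = {f. f permutes {1..t}} - hat t P"
    define G where "G = (\<lambda>s. {g. g permutes {1..n} \<and> card (moved_above t n g) = s})"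
    have finG: "finite (G s)" for s
      by (rule finite_subset[of _ "{g. g permutes {1..n}}"]) (auto simp: G_def finite_permutations)
    have finF: "finite F" by (simp add: F_def finite_permutations)
    have A0D: "A0 \<in> invs P (tup t)" "{f \<in> hat t P. lact f ` A0 = A0} = P" using A0 by (auto simp:
        base_def)
    \<comment> \<open>Replacing \<open>R\<close> by \<open>A0 \<union> R\<close> compares
      \<open>bad\<close> with all invariant sets on \<open>tup n\<close>, at the price of the
      constant factor \<open>C\<close>.\<close>
    have N: "real N = C * real (mixcount t P n)"
      unfolding N_def C_def using card_invs_tup[OF perm tn] by simp
    have Npos: "N > 0" unfolding N_def
      using card_invs_tup[OF perm tn] mixcount_pos A0D(1) finite_invs[OF finite_tup, of P t]
          card_gt_0_iff
      by (metis empty_iff nat_0_less_mult_iff)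
    have sub: "(\<lambda>R. A0 \<union> R) ` bad \<subseteq> (\<Union>f\<in>F. fix_by f) \<union> (\<Union>s\<in>{1..n}. \<Union>g\<in>G s. fix_by g)"
    proof
      fix A assume "A \<in> (\<lambda>R. A0 \<union> R) ` bad"
      then obtain R where R: "A = A0 \<union> R" "R \<in> invs P (mix t n)" "autg n A \<noteq> P" by (auto simp: bad_def)
      have A: "A \<in> invs P (tup n)" unfolding R(1) by (rule invs_join[OF tn A0D(1) R(2)])
      have "P \<subseteq> autg n A"
      proof
        fix p assume "p \<in> P"
        moreover have "p permutes {1..n}" by (rule permutes_subset[OF perm[OF \<open>p \<in> P\<close>]]) (use tn in auto)
        ultimately show "p \<in> autg n A" using invsD(2)[OF A] by (simp add: autg_def)
      qed
      then obtain g where g: "g \<in> autg n A" "g \<notin> P" using R(3) by blast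
      have gA: "A \<in> fix_by g" using A autgD(2)[OF g(1)] by (simp add: fix_by_def)
      define s where "s = card (moved_above t n g)"
      show "A \<in> (\<Union>f\<in>F. fix_by f) \<union> (\<Union>s\<in>{1..n}. \<Union>g\<in>G s. fix_by g)"
      proof (cases "s = 0")
        case True
        hence "(moved_above t n g) = {}" by (simp add: s_def)
        hence "g permutes {1..t}"
          by (intro permutes_superset[OF autgD(1)[OF g(1)]]) auto
        \<comment> \<open>A member of \<open>hat t P\<close> that preserves \<open>A\<close>
          preserves its inner part \<open>A0\<close>, and then the definition of \<open>base\<close>
          puts it in \<open>P\<close>.\<close>
        have "g \<notin> hat t P"
        proof
          assume "g \<in> hat t P"
          have sA: "A \<inter> tup t = A0" "A - tup t = R"
            using join_split[of A0 t R n] invsD(1)[OF A0D(1)] invsD(1)[OF R(2)] R(1) by auto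
          have "lact g ` (A \<inter> tup t) = lact g ` A \<inter> lact g ` tup t"
            by (rule image_Int) (rule lact_inj[OF permutes_inj[OF \<open>g permutes {1..t}\<close>]])
          hence "lact g ` A0 = A0"
            unfolding autgD(2)[OF g(1)] lact_tup[OF \<open>g permutes {1..t}\<close>] sA .
          thus False using A0D(2) \<open>g \<in> hat t P\<close> g(2) by blast
        qed
        hence "g \<in> F" using \<open>g permutes {1..t}\<close> by (simp add: F_def)
        thus ?thesis using gA by blast
      next
        case False
        have "s \<le> card {t+1..n}" unfolding s_def by (rule card_mono) auto
        hence "s \<in> {1..n}" using False by simp
        moreover have "g \<in> G s" using autgD(1)[OF g(1)] by (simp add: G_def s_def)
        ultimately show ?thesis using gA by blast
      qed
    qed
    have fin_fix: "finite (fix_by g)" for g by (simp add: fix_by_def finite_invs finite_tup)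
    have inj: "inj_on (\<lambda>R. A0 \<union> R) bad"
    proof (rule inj_onI)
      fix R R' assume "R \<in> bad" "R' \<in> bad" and eq: "A0 \<union> R = A0 \<union> R'"
      hence "R \<in> invs P (mix t n)" "R' \<in> invs P (mix t n)" by (simp_all add: bad_def)
      note * = join_split(2)[OF invsD(1)[OF A0D(1)] invsD(1)[OF this(1)]]
        join_split(2)[OF invsD(1)[OF A0D(1)] invsD(1)[OF this(2)]]
      from * show "R = R'" unfolding eq by (rule subst)
    qed
    have "card bad = card ((\<lambda>R. A0 \<union> R) ` bad)" by (simp add: card_image[OF inj])
    also have "\<dots> \<le> card ((\<Union>f\<in>F. fix_by f) \<union> (\<Union>s\<in>{1..n}. \<Union>g\<in>G s. fix_by g))"
      by (rule card_mono[OF _ sub]) (use finF finG fin_fix in auto)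
    also have "\<dots> \<le> card (\<Union>f\<in>F. fix_by f) + card (\<Union>s\<in>{1..n}. \<Union>g\<in>G s. fix_by g)"
      by (rule card_Un_le)
    also have "\<dots> \<le> (\<Sum>f\<in>F. card (fix_by f)) + (\<Sum>s\<in>{1..n}. \<Sum>g\<in>G s. card (fix_by g))"
    proof (rule add_mono)
      show "card (\<Union>f\<in>F. fix_by f) \<le> (\<Sum>f\<in>F. card (fix_by f))" by (rule card_UN_le[OF finF])
      have "card (\<Union>s\<in>{1..n}. \<Union>g\<in>G s. fix_by g) \<le> (\<Sum>s\<in>{1..n}. card (\<Union>g\<in>G s. fix_by g))"
        by (rule card_UN_le) simp
      also have "\<dots> \<le> (\<Sum>s\<in>{1..n}. \<Sum>g\<in>G s. card (fix_by g))"
        by (rule sum_mono, rule card_UN_le[OF finG])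
      finally show "card (\<Union>s\<in>{1..n}. \<Union>g\<in>G s. fix_by g) \<le> (\<Sum>s\<in>{1..n}. \<Sum>g\<in>G s. card (fix_by g))" .
    qed
    finally have "real (card bad) \<le> real ((\<Sum>f\<in>F. card (fix_by f)) + (\<Sum>s\<in>{1..n}. \<Sum>g\<in>G s. card
        (fix_by g)))"
      by (rule of_nat_mono)
    also have "\<dots> = (\<Sum>f\<in>F. real (card (fix_by f))) + (\<Sum>s\<in>{1..n}. \<Sum>g\<in>G s. real (card (fix_by g)))"
      by simp
    also have "\<dots> \<le> fact t * (real N * (1/2) ^ (n - t)) + (\<Sum>s\<in>{1..n}. real N * (real n ^ t * q n ^ s))"
    proof (rule add_mono)
      have "(\<Sum>f\<in>F. real (card (fix_by f))) \<le> (\<Sum>f\<in>F. real N * (1/2) ^ (n - t))"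
      proof (rule sum_mono)
        fix f assume "f \<in> F"
        hence "card (fix_by f) * 2 ^ (1 * (n - t)) \<le> N"
          using hat_bound[OF P tn] by (simp add: F_def fix_by_def N_def)
        from card_ratio_le[OF this, of 1 1] Npos
        show "real (card (fix_by f)) \<le> real N * (1/2) ^ (n - t)" by simp
      qed
      also have "\<dots> = real (card F) * (real N * (1/2) ^ (n - t))" by simp
      also have "\<dots> \<le> fact t * (real N * (1/2) ^ (n - t))"
      proof (rule mult_right_mono)
        have "card F \<le> card {f. f permutes {1..t}}"
          unfolding F_def by (rule card_mono) (auto simp: finite_permutations)
        also have "\<dots> = fact t" by (simp add: card_permutations)
        finally show "real (card F) \<le> fact t" unfolding of_nat_fact[symmetric, where 'a = real]
            of_nat_le_iff .
      qed simp
      finally show "(\<Sum>f\<in>F. real (card (fix_by f))) \<le> fact t * (real N * (1/2) ^ (n - t))" .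
      show "(\<Sum>s\<in>{1..n}. \<Sum>g\<in>G s. real (card (fix_by g))) \<le> (\<Sum>s\<in>{1..n}. real N * (real n ^ t * q n ^ s))"
      proof (rule sum_mono)
        fix s assume "s \<in> {1..n}"
        have "real (card (fix_by g)) \<le> real N * (c ^ (n - t)) ^ s" if "g \<in> G s" for g
        proof -
          have g: "g permutes {1..n}" "card (moved_above t n g) = s" using that by (auto simp: G_def)
          obtain m where m: "s \<le> 3 * m" "card (fix_by g) * 2 ^ (m * (n - t) ^ (rmax - 1)) \<le> N"
            using moving_bound[OF P tn g(1)] g(2) unfolding fix_by_def N_def by auto
          \<comment> \<open>One factor \<open>n - t\<close> of the exponent suffices here;
            \<open>rmax \<ge> 2\<close> provides it.\<close>
          have "(n - t) ^ 1 \<le> (n - t) ^ (rmax - 1)"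
            by (rule power_increasing) (use elim rmax_ge_2 in auto)
          hence "(2::nat) ^ (m * (n - t)) \<le> 2 ^ (m * (n - t) ^ (rmax - 1))"
            by (intro power_increasing mult_left_mono) auto
          hence "card (fix_by g) * 2 ^ (m * (n - t)) \<le> card (fix_by g) * 2 ^ (m * (n - t) ^ (rmax - 1))"
            by (rule mult_left_mono) simp
          hence "card (fix_by g) * 2 ^ (m * (n - t)) \<le> N" using m(2) by (rule order_trans)
          from card_ratio_le[OF this m(1) Npos] show ?thesis by (simp add: c_def)
        qed
        hence "(\<Sum>g\<in>G s. real (card (fix_by g))) \<le> (\<Sum>g\<in>G s. real N * (c ^ (n - t)) ^ s)"
          by (rule sum_mono)
        also have "\<dots> = real (card (G s)) * (real N * (c ^ (n - t)) ^ s)" by simp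
        also have "\<dots> \<le> real n ^ (2 * s + t) * (real N * (c ^ (n - t)) ^ s)"
        proof (rule mult_right_mono)
          have "card (G s) \<le> n ^ (2 * s + t)" unfolding G_def by (rule card_moving_outside[OF tn])
          thus "real (card (G s)) \<le> real n ^ (2 * s + t)" unfolding of_nat_power[symmetric]
              of_nat_le_iff .
        qed (use c in simp)
        also have "\<dots> = real N * (real n ^ t * q n ^ s)"
          by (simp add: q_def power_mult_distrib power_add power_mult)
        finally show "(\<Sum>g\<in>G s. real (card (fix_by g))) \<le> real N * (real n ^ t * q n ^ s)" .
      qed
    qed
    also have "(\<Sum>s\<in>{1..n}. real N * (real n ^ t * q n ^ s)) = real N * (real n ^ t * (\<Sum>s\<in>{1..n}. q
        n ^ s))"
      by (simp add: sum_distrib_left)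
    also have "\<dots> \<le> real N * (real n ^ t * (real n * q n))"
      by (intro mult_left_mono geometric_tail_le) (use q1 c in \<open>auto simp: q_def\<close>)
    finally have "real (card bad) \<le> real N * (fact t * (1/2) ^ (n - t) + real n ^ t * (real n * q n))"
      by (simp add: algebra_simps)
    also have "\<dots> = b n * real (mixcount t P n)" by (simp add: N b_def mult_ac)
    finally show "real (card (extra_aut t P A0 n)) / real (mixcount t P n) \<le> b n"
      unfolding bad_def using mixcount_pos[of t P n] by (simp add: field_simps)
  qed
  thus ?thesis
    by (rule tendsto_sandwich[OF _ _ tendsto_const b0, rotated]) simp
qed

section \<open>Groups of large support\<close>

abbreviation supp_class :: "nat \<Rightarrow> nat \<Rightarrow> ('i \<times> nat list) set set" where
  "supp_class n t \<equiv> {A \<in> Pow (tup n). supp (autg n A) = {1..t}}"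

text \<open>The exponent \<open>1/6\<close> is a half from \<open>exists_large_support\<close> times
  a third from \<open>exists_displaced_subset\<close>. The latter enters through
  \<open>moving_bound\<close> for the trivial group with no inner points; the sum over candidate
  automorphisms has at most t! \<le> n^t terms.\<close>

lemma full_group_bound:
  assumes "t \<le> n"
  shows "real (card (supp_class n t)) \<le>
     real n ^ t * 2 ^ card (tup n) * (((1/2) powr (1/6)) ^ (n ^ (rmax - 1))) ^ t"
proof -
  define w where "w = (((1/2 :: real) powr (1/6)) ^ (n ^ (rmax - 1))) ^ t"
  define F where "F = {g. g permutes {1..t} \<and> t \<le> 2 * card {a\<in>{1..t}. g a \<noteq> a}}"
  define fix_by where "fix_by = (\<lambda>g. {A \<in> Pow (tup n). lact g ` A = A})"
  have finF: "finite F"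
    by (rule finite_subset[of _ "{g. g permutes {1..t}}"]) (auto simp: F_def finite_permutations)
  have "(supp_class n t) \<subseteq> (\<Union>g\<in>F. fix_by g)"
  proof
    fix A assume A: "A \<in> supp_class n t"
    hence "autg n A \<in> full_groups t" using autg_full_group by blast
    hence G: "pgroup {1..t} (autg n A)" "supp (autg n A) = {1..t}" by (auto simp: full_groups_def)
    obtain g where g: "g \<in> autg n A" "t \<le> 2 * card {a\<in>{1..t}. g a \<noteq> a}"
      using exists_large_support[OF G(1) _ G(2)] by auto
    have "g \<in> F" using g pgroup_permutes[OF G(1)] by (simp add: F_def)
    moreover have "A \<in> fix_by g" using A autgD(2)[OF g(1)] by (simp add: fix_by_def)
    ultimately show "A \<in> (\<Union>g\<in>F. fix_by g)" by blast
  qed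
  hence "card (supp_class n t) \<le> card (\<Union>g\<in>F. fix_by g)"
    by (rule card_mono[rotated]) (use finF in \<open>simp add: fix_by_def finite_tup\<close>)
  also have "\<dots> \<le> (\<Sum>g\<in>F. card (fix_by g))" by (rule card_UN_le[OF finF])
  finally have "real (card (supp_class n t)) \<le> (\<Sum>g\<in>F. real (card (fix_by g)))"
    unfolding of_nat_sum[symmetric] of_nat_le_iff .
  also have "\<dots> \<le> (\<Sum>g\<in>F. 2 ^ card (tup n) * w)"
  proof (rule sum_mono)
    fix g assume "g \<in> F"
    hence g: "g permutes {1..t}" "t \<le> 2 * card {a\<in>{1..t}. g a \<noteq> a}" by (auto simp: F_def)
    have gn: "g permutes {1..n}" by (rule permutes_subset[OF g(1)]) (use assms in auto)
    have triv: "invs {id} (tup n) = Pow (tup n)" by (auto simp: invs_def)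
    obtain m where m: "card {a\<in>{0+1..n}. g a \<noteq> a} \<le> 3 * m"
      "card {A \<in> invs {id} (tup n). lact g ` A = A} * 2 ^ (m * (n - 0) ^ (rmax - 1)) \<le> card (invs
          {id} (tup n))"
      using moving_bound[OF pgroup_triv _ gn, of 0] by auto
    have "card {a\<in>{1..t}. g a \<noteq> a} \<le> card {a\<in>{0+1..n}. g a \<noteq> a}"
      by (rule card_mono) (use assms in auto)
    hence t6: "t \<le> 6 * m" using m(1) g(2) by linarith
    have "card (fix_by g) * 2 ^ (m * n ^ (rmax - 1)) \<le> 2 ^ card (tup n)"
      using m(2) unfolding triv by (simp add: fix_by_def card_Pow finite_tup)
    from card_ratio_le[OF this t6] show "real (card (fix_by g)) \<le> 2 ^ card (tup n) * w"
      by (simp add: w_def)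
  qed
  also have "\<dots> = real (card F) * (2 ^ card (tup n) * w)" by simp
  also have "\<dots> \<le> real n ^ t * (2 ^ card (tup n) * w)"
  proof (rule mult_right_mono)
    have "card F \<le> card {f. f permutes {1..t}}"
      unfolding F_def by (rule card_mono) (auto simp: finite_permutations)
    also have "\<dots> = fact t" by (simp add: card_permutations)
    also have "\<dots> \<le> n ^ t" by (rule fact_le_power_ge[OF assms])
    finally show "real (card F) \<le> real n ^ t" unfolding of_nat_power[symmetric] of_nat_le_iff .
  qed (simp add: w_def)
  finally show ?thesis by (simp add: w_def mult_ac)
qed

text \<open>Every set of nonempty tuples avoiding \<open>{1..t}\<close> is invariant, and only
  O(n^(rmax-1)) tuples remain. So invariance under \<open>P\<close> costs an exponent of the same
  scale that \<open>full_group_bound\<close> saves for each point of the support.\<close>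

lemma mixcount_lower:
  assumes P: "\<And>p. p \<in> P \<Longrightarrow> p permutes {1..t}"
  shows "\<exists>K. \<forall>n\<ge>max 1 t. 2 ^ card (tup n) \<le> mixcount t P n * 2 ^ (K * n ^ (rmax - 1))"
proof (intro exI allI impI)
  \<comment> \<open>For each symbol, \<open>rmax * t\<close> comes from
    \<open>power_le_power_diff\<close>, and the \<open>1\<close> covers the empty tuple of a nullary
    symbol.\<close>
  define K where "K = card (UNIV :: 'i set) * (rmax * t + 1)"
  fix n :: nat assume "n \<ge> max 1 t"
  hence n: "t \<le> n" "1 \<le> n" by auto
  \<comment> \<open>Arity 0 is left out because the empty tuple is not in
    \<open>mix t n\<close>.\<close>
  define Y where "Y = (SIGMA i:{i. ar i \<noteq> 0}. {xs. set xs \<subseteq> {t+1..n} \<and> length xs = ar i})"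
  have finY: "finite Y" unfolding Y_def by (intro finite_SigmaI finite_lists_length_eq) auto
  have "Pow Y \<subseteq> invs P (mix t n)"
  proof
    fix A assume "A \<in> Pow Y"
    hence AY: "A \<subseteq> Y" by simp
    have lact: "lact p x = x" if "p \<in> P" "x \<in> Y" for p x
    proof -
      obtain i xs where x: "x = (i, xs)" by (cases x)
      have "p a = a" if "a \<in> set xs" for a
        using permutes_not_in[OF P[OF \<open>p \<in> P\<close>]] that \<open>x \<in> Y\<close> x by (force simp: Y_def)
      thus ?thesis using x by (simp add: map_idI)
    qed
    show "A \<in> invs P (mix t n)"
    proof (rule invsI)
      show "A \<subseteq> mix t n"
      proof
        fix x assume "x \<in> A"
        then obtain i xs where x: "x = (i, xs)" "set xs \<subseteq> {t+1..n}" "length xs = ar i" "xs \<noteq> []"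
          using AY by (force simp: Y_def)
        have hd: "hd xs \<in> set xs" by (rule hd_in_set[OF x(4)])
        hence "hd xs \<in> {t+1..n}" using x(2) by blast
        hence "hd xs \<notin> {1..t}" by simp
        thus "x \<in> mix t n" using x hd by (force simp: mix_def tup_iff)
      qed
      show "lact p ` A = A" if "p \<in> P" for p
      proof -
        have "lact p ` A = id ` A" by (rule image_cong) (use lact[OF that] AY in auto)
        thus ?thesis by simp
      qed
    qed
  qed
  hence "card (Pow Y) \<le> mixcount t P n"
    unfolding mixcount_def by (rule card_mono[OF finite_invs[OF finite_mix]])
  hence 1: "2 ^ card Y \<le> mixcount t P n" by (simp add: card_Pow finY)
  have cY: "card Y = (\<Sum>i | ar i \<noteq> 0. (n - t) ^ ar i)"
    unfolding Y_def using card_lists_length_eq[of "{t+1..n}"] finite_lists_length_eq[of "{t+1..n}"]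
    by (subst card_SigmaI) auto
  have "card (tup n) = (\<Sum>i\<in>UNIV. n ^ ar i)" by (rule card_tup)
  also have "\<dots> \<le> (\<Sum>i\<in>UNIV. (if ar i \<noteq> 0 then (n - t) ^ ar i else 0) + (rmax * t + 1) * n ^ (rmax - 1))"
  proof (rule sum_mono)
    fix i
    show "n ^ ar i \<le> (if ar i \<noteq> 0 then (n - t) ^ ar i else 0) + (rmax * t + 1) * n ^ (rmax - 1)"
    proof (cases "ar i = 0")
      case True
      have "1 \<le> n ^ (rmax - 1)" using n(2) by simp
      thus ?thesis using True by simp
    next
      case False
      have "n ^ ar i \<le> (n - t) ^ ar i + ar i * t * n ^ (ar i - 1)" by (rule power_le_power_diff[OF n(1)])
      also have "ar i * t * n ^ (ar i - 1) \<le> (rmax * t) * n ^ (rmax - 1)"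
        by (intro mult_mono power_increasing diff_le_mono ar_le_rmax) (use n in auto)
      finally show ?thesis using False by simp
    qed
  qed
  also have "\<dots> = card Y + K * n ^ (rmax - 1)"
    by (simp add: sum.distrib cY K_def sum.If_cases Collect_neg_eq[symmetric] algebra_simps)
  finally have "2 ^ card (tup n) \<le> (2::nat) ^ (card Y + K * n ^ (rmax - 1))" by (rule
      power_increasing) simp
  also have "\<dots> \<le> mixcount t P n * 2 ^ (K * n ^ (rmax - 1))" using 1 by (simp add: power_add)
  finally show "2 ^ card (tup n) \<le> mixcount t P n * 2 ^ (K * n ^ (rmax - 1))" .
qed

text \<open>The order of magnitude of the number of isomorphism classes with automorphism group \<open>P\<close>.\<close>
definition growth :: "nat \<Rightarrow> (nat \<Rightarrow> nat) set \<Rightarrow> nat \<Rightarrow> real" where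
  "growth t P n = real (mixcount t P n) / fact (n - t)"

lemma growth_pos: "growth t P n > 0"
  using mixcount_pos[of t P n] by (simp add: growth_def)

text \<open>The saving in \<open>full_group_bound\<close> grows with \<open>t\<close> while the cost
  \<open>K\<close> in \<open>mixcount_lower\<close> is fixed by \<open>P\<close>. Beyond a multiple
  of \<open>K\<close> the saving pays for that cost and still leaves a geometric series in
  \<open>t\<close>.\<close>

lemma tail_negligible:
  assumes P: "\<And>p. p \<in> P \<Longrightarrow> p permutes {1..t0}"
  shows "\<exists>T>t0. (\<lambda>n. (\<Sum>t=T..n. real (card (supp_class n t)) / fact (n - t)) / growth t0 P n) \<longlonglongrightarrow> 0"
proof -
  obtain K where K: "\<And>n. n \<ge> max 1 t0 \<Longrightarrow> 2 ^ card (tup n) \<le> mixcount t0 P n * 2 ^ (K * n ^ (rmax - 1))"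
    using mixcount_lower[OF P] by blast
  define c where "c = (1/2 :: real) powr (1/6)"
  \<comment> \<open>The saving is split as \<open>c = d * d\<close>: one factor pays for
    \<open>K\<close>, the other beats the powers of \<open>n\<close>.\<close>
  define d where "d = (1/2 :: real) powr (1/12)"
  have d: "0 < d" "d < 1" unfolding d_def using half_powr_less[of "1/12"] by simp_all
  have cd: "c = d * d" unfolding c_def d_def by (simp flip: powr_add)
  have d12: "d ^ 12 = 1/2" unfolding d_def by (simp add: powr_powr flip: powr_realpow)
  \<comment> \<open>From \<open>d ^ 12 = 1/2\<close> and \<open>t \<ge> 12 * K\<close> one gets
    \<open>d ^ (t * m) \<le> (1/2) ^ (K * m)\<close>. The \<open>1\<close> lets the tail start at a
    positive exponent, and with \<open>t0\<close> it ensures \<open>T > t0\<close>.\<close>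
  define T where "T = 12 * K + 1 + t0"
  define q where "q = (\<lambda>n. real n ^ 2 * d ^ (n - 0))"
  have q0: "q \<longlonglongrightarrow> 0" unfolding q_def by (rule power_times_geometric[OF d])
  have nq0: "(\<lambda>n. real n * q n) \<longlonglongrightarrow> 0"
    using power_times_geometric[OF d, of 3 0] by (simp add: q_def power2_eq_square power3_eq_cube
        mult_ac)
  have "eventually (\<lambda>n. (\<Sum>t=T..n. real (card (supp_class n t)) / fact (n - t)) / growth t0 P n
      \<le> real n * q n) sequentially"
    using order_tendstoD(2)[OF q0, of 1, simplified] eventually_ge_at_top[of "max 1 t0"]
  proof eventually_elim
    case (elim n)
    hence n1: "1 \<le> n" "t0 \<le> n" and q1: "q n \<le> 1" by auto
    define m where "m = n ^ (rmax - 1)"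
    define g where "g = growth t0 P n"
    \<comment> \<open>One \<open>n ^ t\<close> comes from \<open>full_group_bound\<close>, the other
      from replacing 1 / (n - t)! by n^t / n!.\<close>
    have "real n ^ t * real n ^ t * 2 ^ card (tup n) * (c ^ m) ^ t / fact n \<le> g * q n ^ t" if t:
        "t \<ge> T" for t
    proof -
      have "real (2 ^ card (tup n)) \<le> real (mixcount t0 P n * 2 ^ (K * m))"
        using K[OF elim(2)] unfolding m_def of_nat_le_iff .
      also have "\<dots> \<le> real (mixcount t0 P n) * (1 / d ^ (t * m))"
      proof -
        have "d ^ (12 * (K * m)) = (1/2) ^ (K * m)" by (simp only: power_mult[of d 12 "K * m"] d12)
        hence "(2::real) ^ (K * m) = 1 / d ^ (12 * (K * m))" by (simp add: power_one_over)
        also have "\<dots> \<le> 1 / d ^ (t * m)"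
        proof (rule divide_left_mono)
          show "d ^ (t * m) \<le> d ^ (12 * (K * m))"
            by (rule power_decreasing) (use t d in \<open>auto simp: T_def\<close>)
        qed (use d in auto)
        finally have "real (mixcount t0 P n) * 2 ^ (K * m) \<le> real (mixcount t0 P n) * (1 / d ^ (t * m))"
          by (rule mult_left_mono) simp
        thus ?thesis by simp
      qed
      finally have "2 ^ card (tup n) * d ^ (t * m) \<le> real (mixcount t0 P n)"
        using d by (simp add: field_simps)
      hence "2 ^ card (tup n) * d ^ (t * m) * (real n ^ t * real n ^ t * d ^ (t * m)) / fact n
         \<le> real (mixcount t0 P n) * (real n ^ t * real n ^ t * d ^ (t * m)) / fact n"
        by (intro divide_right_mono mult_right_mono) (use d in auto)
      also have "\<dots> \<le> g * (real n ^ t * real n ^ t * d ^ (t * m))"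
      proof -
        have "real (mixcount t0 P n) / fact n \<le> g" unfolding g_def growth_def
          by (intro divide_left_mono fact_mono) auto
        hence "real (mixcount t0 P n) / fact n * (real n ^ t * real n ^ t * d ^ (t * m)) \<le> g *
            (real n ^ t * real n ^ t * d ^ (t * m))"
          by (rule mult_right_mono) (use d in auto)
        thus ?thesis by (simp add: field_simps)
      qed
      also have "\<dots> \<le> g * q n ^ t"
      proof (rule mult_left_mono)
        have "n ^ 1 \<le> m" unfolding m_def by (rule power_increasing) (use n1 rmax_ge_2 in auto)
        hence "d ^ (t * m) \<le> d ^ (t * n)" using d by (intro power_decreasing) auto
        hence "real n ^ t * real n ^ t * d ^ (t * m) \<le> real n ^ t * real n ^ t * d ^ (t * n)"
          by (rule mult_left_mono) simp
        also have "\<dots> = q n ^ t" by (simp add: q_def power_mult_distrib power2_eq_square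
            mult.commute[of t n] power_mult)
        finally show "real n ^ t * real n ^ t * d ^ (t * m) \<le> q n ^ t" .
      qed (simp add: g_def less_imp_le[OF growth_pos])
      finally show ?thesis
        by (simp add: cd power_mult_distrib mult.commute[of t m] power_mult mult_ac)
    qed note main = this
    have "(\<Sum>t=T..n. real (card (supp_class n t)) / fact (n - t)) \<le> (\<Sum>t=T..n. g * q n ^ t)"
    proof (rule sum_mono)
      fix t assume t: "t \<in> {T..n}"
      have tn: "t \<le> n" using t by simp
      have f: "fact n \<le> (real n ^ t * fact (n - t) :: real)" by (rule fact_le_power_mult[OF tn])
      have "real (card (supp_class n t)) / fact (n - t)
         \<le> real n ^ t * 2 ^ card (tup n) * (c ^ m) ^ t / fact (n - t)"
        using full_group_bound[OF tn] unfolding c_def m_def by (intro divide_right_mono) auto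
      also have "\<dots> \<le> real n ^ t * 2 ^ card (tup n) * (c ^ m) ^ t * (real n ^ t / fact n)"
      proof -
        have "1 / fact (n - t) \<le> real n ^ t / fact n" using f by (simp add: field_simps)
        hence "real n ^ t * 2 ^ card (tup n) * (c ^ m) ^ t * (1 / fact (n - t))
          \<le> real n ^ t * 2 ^ card (tup n) * (c ^ m) ^ t * (real n ^ t / fact n)"
          by (rule mult_left_mono) (simp add: c_def)
        thus ?thesis by simp
      qed
      also have "\<dots> \<le> g * q n ^ t" using main[of t] t by (simp add: mult_ac)
      finally show "real (card (supp_class n t)) / fact (n - t) \<le> g * q n ^ t" .
    qed
    also have "\<dots> = g * (\<Sum>t=T..n. q n ^ t)" by (simp add: sum_distrib_left)
    also have "\<dots> \<le> g * (real n * q n)"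
      by (intro mult_left_mono geometric_tail_le)
         (use q1 d less_imp_le[OF growth_pos[of t0 P n]] in \<open>auto simp: q_def T_def g_def\<close>)
    finally show ?case using growth_pos[of t0 P n] unfolding g_def by (simp add: field_simps)
  qed
  note upper = this
  have "eventually (\<lambda>n. 0 \<le> (\<Sum>t=T..n. real (card (supp_class n t)) / fact (n - t)) / growth t0 P
      n) sequentially"
    by (intro always_eventually allI divide_nonneg_nonneg sum_nonneg less_imp_le[OF growth_pos]) auto
  from tendsto_sandwich[OF this upper tendsto_const nq0]
  have "(\<lambda>n. (\<Sum>t=T..n. real (card (supp_class n t)) / fact (n - t)) / growth t0 P n) \<longlonglongrightarrow> 0" .
  thus ?thesis by (intro exI[of _ T]) (simp add: T_def)
qed

end

section \<open>Extension axioms and the conditional zero-one law\<close>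

lemma invsI_group:
  assumes "pgroup S P" "A \<subseteq> X" "\<And>p x. p \<in> P \<Longrightarrow> x \<in> A \<Longrightarrow> lact p x \<in> A"
  shows "A \<in> invs P X"
proof (rule invsI[OF assms(2)])
  fix p assume p: "p \<in> P"
  show "lact p ` A = A"
  proof
    show "lact p ` A \<subseteq> A" using assms(3)[OF p] by blast
    show "A \<subseteq> lact p ` A"
    proof
      fix x assume "x \<in> A"
      hence "lact (invf p) x \<in> A" using assms(3) pgroup_inv[OF assms(1) p] by blast
      moreover have "x = lact p (lact (invf p) x)"
        by (simp add: lact_permutes_inv[OF pgroup_permutes[OF assms(1) p]])
      ultimately show "x \<in> lact p ` A" by (rule rev_image_eqI)
    qed
  qed
qed

primrec qdepth :: "'i form \<Rightarrow> nat" where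
  "qdepth (Rel i xs) = 0"
| "qdepth (Eq x y) = 0"
| "qdepth (Neg p) = qdepth p"
| "qdepth (Conj p q) = max (qdepth p) (qdepth q)"
| "qdepth (Forall x p) = Suc (qdepth p)"

text \<open>In the type of a new point over \<open>{1..t} \<union> Y\<close> the new point is denoted by \<open>0\<close>, which is
  not an element of any structure; \<open>subst0 z\<close> puts \<open>z\<close> in its place.\<close>
definition subst0 :: "nat \<Rightarrow> nat \<Rightarrow> nat" where
  "subst0 z b = (if b = 0 then z else b)"

section \<open>Back-and-forth between structures with the extension property\<close>

context vocabulary
begin

definition ptup :: "nat \<Rightarrow> nat set \<Rightarrow> ('i \<times> nat list) set" where
  "ptup t Y = {(i, xs). length xs = ar i \<and> 0 \<in> set xs \<and> set xs \<subseteq> {0..t} \<union> Y}"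

text \<open>Only types \<open>D\<close> invariant under \<open>P\<close> are asked for:
  \<open>P\<close> fixes the new point and the points of \<open>Y\<close>, so in an invariant
  structure no other type over \<open>{1..t} \<union> Y\<close> can be realised.\<close>

definition ext_prop :: "nat \<Rightarrow> (nat \<Rightarrow> nat) set \<Rightarrow> nat \<Rightarrow> nat \<Rightarrow> ('i \<times> nat list) set \<Rightarrow> bool" where
  "ext_prop t P k n A \<longleftrightarrow> (\<forall>Y D. Y \<subseteq> {t+1..n} \<and> card Y \<le> k \<and> D \<in> invs P (ptup t Y) \<longrightarrow>
     (\<exists>z\<in>{t+1..n} - Y. \<forall>x\<in>ptup t Y. x \<in> D \<longleftrightarrow> lact (subst0 z) x \<in> A))"

text \<open>A position of the Ehrenfeucht-Fraisse game, a finite partial isomorphism;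
  \<open>{1..t}\<close> is always in its domain and is fixed pointwise.\<close>

definition emb where
  "emb t n n' A A' Y Y' h \<longleftrightarrow> Y \<subseteq> {t+1..n} \<and> Y' \<subseteq> {t+1..n'} \<and>
     bij_betw h ({1..t} \<union> Y) ({1..t} \<union> Y') \<and> (\<forall>a\<in>{1..t}. h a = a) \<and>
     (\<forall>i xs. length xs = ar i \<and> set xs \<subseteq> {1..t} \<union> Y \<longrightarrow> ((i, xs) \<in> A \<longleftrightarrow> (i, map h xs) \<in> A'))"

lemma embD:
  assumes "emb t n n' A A' Y Y' h"
  shows "Y \<subseteq> {t+1..n}" "Y' \<subseteq> {t+1..n'}" "bij_betw h ({1..t} \<union> Y) ({1..t} \<union> Y')"
    "a \<in> {1..t} \<Longrightarrow> h a = a"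
    "length xs = ar i \<Longrightarrow> set xs \<subseteq> {1..t} \<union> Y \<Longrightarrow> (i, xs) \<in> A \<longleftrightarrow> (i, map h xs) \<in> A'"
  using assms by (auto simp: emb_def)

lemma emb_sym:
  assumes "emb t n n' A A' Y Y' h"
  shows "emb t n' n A' A Y' Y (inv_into ({1..t} \<union> Y) h)"
proof -
  note E = embD[OF assms]
  let ?V = "{1..t} \<union> Y" and ?V' = "{1..t} \<union> Y'"
  let ?g = "inv_into ?V h"
  have hg: "h (?g b) = b" if "b \<in> ?V'" for b by (rule bij_betw_inv_into_right[OF E(3) that])
  have bij: "bij_betw ?g ?V' ?V" by (rule bij_betw_inv_into[OF E(3)])
  have "?g a = a" if "a \<in> {1..t}" for a
  proof -
    have "a \<in> ?V" using that by blast
    from bij_betw_inv_into_left[OF E(3) this] show ?thesis using E(4)[OF that] by simp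
  qed
  moreover have "(i, xs) \<in> A' \<longleftrightarrow> (i, map ?g xs) \<in> A" if "length xs = ar i" "set xs \<subseteq> ?V'" for i xs
  proof -
    have "set (map ?g xs) \<subseteq> ?V"
      using that(2) bij_betw_imp_surj_on[OF bij] by (simp only: set_map) blast
    hence "(i, map ?g xs) \<in> A \<longleftrightarrow> (i, map h (map ?g xs)) \<in> A'" using E(5) that(1) by simp
    moreover have "map h (map ?g xs) = xs"
      unfolding map_map by (rule map_idI) (use that(2) hg in auto)
    ultimately show ?thesis by simp
  qed
  ultimately show ?thesis using E(1,2) bij unfolding emb_def by blast
qed

text \<open>The forth step: the type of \<open>a\<close> over the domain of \<open>h\<close> is
  transported to a type \<open>D\<close> over the range, and the extension property supplies a point
  \<open>z\<close> realising it. The invariance of \<open>A\<close> makes \<open>D\<close>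
  invariant.\<close>

lemma emb_extend:
  assumes P: "pgroup {1..t} P" and E: "emb t n n' A A' Y Y' h" and tn: "t \<le> n"
    and A: "A \<in> invs P (tup n)" and ext: "ext_prop t P k n' A'" and k: "card Y \<le> k"
    and a: "a \<in> {1..n}" "a \<notin> {1..t} \<union> Y"
  shows "\<exists>z. emb t n n' A A' (insert a Y) (insert z Y') (h(a := z))"
proof -
  note E = embD[OF E]
  let ?V = "{1..t} \<union> Y" and ?V' = "{1..t} \<union> Y'"
  \<comment> \<open>The inverse of \<open>h\<close>, extended by sending the placeholder 0 to
    \<open>a\<close>.\<close>
  define g where "g = (\<lambda>b. if b = 0 then a else inv_into ?V h b)"
  have at: "a \<in> {t+1..n}" using a by auto
  have out: "p b = b" if "p \<in> P" "b \<notin> {1..t}" for p b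
    using permutes_not_in[OF pgroup_permutes[OF P that(1)] that(2)] .
  have pin: "p b \<in> {1..t}" if "p \<in> P" "b \<in> {1..t}" for p b
    using permutes_in_image[OF pgroup_permutes[OF P that(1)]] that(2) by blast
  have V'0: "0 \<notin> ?V'" using E(2) by auto
  have g0: "g 0 = a" by (simp add: g_def)
  have gh: "g (h b) = b" if "b \<in> ?V" for b
  proof -
    have "h b \<in> ?V'" using E(3) that bij_betwE by blast
    hence "h b \<noteq> 0" using V'0 by metis
    thus ?thesis using bij_betw_inv_into_left[OF E(3) that] by (simp add: g_def)
  qed
  have gt: "g b = b" if "b \<in> {1..t}" for b
    using gh[of b] E(4)[OF that] that by simp
  have gY: "g b \<notin> {1..t}" if "b \<in> Y'" for b
  proof
    assume gb: "g b \<in> {1..t}"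
    have bV: "b \<in> ?V'" using that by blast
    have "b \<noteq> 0" using V'0 bV by metis
    hence "h (g b) = b" using bij_betw_inv_into_right[OF E(3) bV] by (simp add: g_def)
    hence "b \<in> {1..t}" using E(4)[OF gb] gb by simp
    thus False using that E(2) by auto
  qed
  define D where "D = {x \<in> ptup t Y'. lact g x \<in> A}"
  have D: "D \<in> invs P (ptup t Y')"
  proof (rule invsI_group[OF P])
    show "D \<subseteq> ptup t Y'" by (auto simp: D_def)
    fix p x assume p: "p \<in> P" and x: "x \<in> D"
    obtain i xs where ix: "x = (i, xs)" by (cases x)
    have xs: "length xs = ar i" "0 \<in> set xs" "set xs \<subseteq> {0..t} \<union> Y'" "(i, map g xs) \<in> A"
      using x by (auto simp: D_def ptup_def ix)
    \<comment> \<open>\<open>g\<close> is the identity on \<open>{1..t}\<close> and maps 0 and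
      \<open>Y'\<close> outside it, while \<open>p\<close> preserves \<open>{1..t}\<close> and fixes
      every point outside.\<close>
    have comm: "g (p b) = p (g b)" if b: "b \<in> set xs" for b
    proof -
      have "b \<in> {0..t} \<union> Y'" using b xs(3) by blast
      then consider "b = 0" | "b \<in> {1..t}" | "b \<in> Y'" by force
      thus ?thesis
      proof cases
        case 1
        have "p 0 = 0" "p a = a" using out[OF p] at by auto
        thus ?thesis using 1 g0 by simp
      next
        case 2
        show ?thesis using gt[OF 2] gt[OF pin[OF p 2]] by simp
      next
        case 3
        have "b \<notin> {1..t}" using 3 E(2) by auto
        thus ?thesis using out[OF p] gY[OF 3] by simp
      qed
    qed
    have "lact p (i, map g xs) \<in> A"
      using lact_in_iff[OF permutes_inj[OF pgroup_permutes[OF P p]] invsD(2)[OF A p]] xs(4) by blast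
    moreover have "map p (map g xs) = map g (map p xs)" using comm by simp
    ultimately have "lact g (lact p x) \<in> A" by (simp only: ix lact_simp)
    moreover have "lact p x \<in> ptup t Y'"
    proof -
      have "p 0 = 0" using out[OF p] by simp
      hence "0 \<in> p ` set xs" using xs(2) by force
      moreover have "p b \<in> {0..t} \<union> Y'" if "b \<in> set xs" for b
      proof (cases "b \<in> {1..t}")
        case True
        thus ?thesis using pin[OF p True] by auto
      next
        case False
        thus ?thesis using out[OF p False] that xs(3) by (metis subsetD)
      qed
      hence "p ` set xs \<subseteq> {0..t} \<union> Y'" by blast
      ultimately show ?thesis using xs(1) by (simp add: ptup_def ix)
    qed
    ultimately show "lact p x \<in> D" by (simp add: D_def)
  qed
  have cY': "card Y' \<le> k"
  proof -
    have "bij_betw h Y Y'"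
    proof -
      have "bij_betw h {1..t} {1..t}"
        using E(4) bij_betw_cong[of "{1..t}" h "\<lambda>x. x" "{1..t}"] by (simp add: bij_betw_def)
      moreover have "{1..t} \<inter> Y = {}" "{1..t} \<inter> Y' = {}" using E(1,2) by auto
      ultimately have "bij_betw h (?V - {1..t}) (?V' - {1..t})"
        using bij_betw_DiffI[OF E(3)] by blast
      moreover have "?V - {1..t} = Y" "?V' - {1..t} = Y'" using \<open>{1..t} \<inter> Y = {}\<close> \<open>{1..t} \<inter> Y' =
          {}\<close> by auto
      ultimately show ?thesis by simp
    qed
    thus ?thesis using k bij_betw_same_card by metis
  qed
  obtain z where z: "z \<in> {t+1..n'} - Y'" "\<And>x. x \<in> ptup t Y' \<Longrightarrow> x \<in> D \<longleftrightarrow> lact (subst0 z) x \<in> A'"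
    using ext E(2) cY' D unfolding ext_prop_def by blast
  have zV: "z \<notin> ?V'" using z(1) by auto
  let ?h = "h(a := z)"
  have bij: "bij_betw ?h ({1..t} \<union> insert a Y) ({1..t} \<union> insert z Y')"
  proof -
    have "?h b = h b" if "b \<in> ?V" for b using that a(2) by auto
    hence "bij_betw ?h ?V ?V'" using E(3) bij_betw_cong[of ?V ?h h ?V'] by blast
    moreover have "bij_betw ?h {a} {z}" by simp
    moreover have "?V' \<inter> {z} = {}" using zV by blast
    ultimately have "bij_betw ?h (?V \<union> {a}) (?V' \<union> {z})" by (rule bij_betw_combine)
    thus ?thesis by simp
  qed
  have iso: "(i, xs) \<in> A \<longleftrightarrow> (i, map ?h xs) \<in> A'"
    if xs: "length xs = ar i" "set xs \<subseteq> {1..t} \<union> insert a Y" for i xs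
  proof (cases "a \<in> set xs")
    case False
    hence "set xs \<subseteq> ?V" using xs(2) by blast
    hence *: "(i, xs) \<in> A \<longleftrightarrow> (i, map h xs) \<in> A'" by (rule E(5)[OF xs(1)])
    have "map ?h xs = map h xs" using False by auto
    thus ?thesis using * by (simp only:)
  next
    case True
    \<comment> \<open>The map \<open>h\<close> with the placeholder 0 as the image of
      \<open>a\<close>; \<open>g\<close> undoes it, and \<open>subst0 z\<close> turns it into the
      extended map.\<close>
    define f where "f = (\<lambda>b. if b = a then 0 else h b)"
    have hV': "h b \<in> ?V'" if "b \<in> set xs" "b \<noteq> a" for b
    proof -
      have "b \<in> ?V" using that xs(2) by blast
      thus ?thesis using E(3) bij_betwE by blast
    qed
    have "(i, map f xs) \<in> ptup t Y'"
    proof -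
      have "f a \<in> f ` set xs" using True by blast
      hence "0 \<in> f ` set xs" by (simp add: f_def)
      moreover have "f b \<in> {0..t} \<union> Y'" if "b \<in> set xs" for b
        using hV'[OF that] by (auto simp: f_def)
      hence "f ` set xs \<subseteq> {0..t} \<union> Y'" by blast
      ultimately show ?thesis using xs(1) by (simp add: ptup_def)
    qed
    from z(2)[OF this] have "(i, map f xs) \<in> D \<longleftrightarrow> (i, map (subst0 z) (map f xs)) \<in> A'" by (simp
        only: lact_simp)
    moreover have "map (subst0 z) (map f xs) = map ?h xs"
    proof -
      have "subst0 z (f b) = ?h b" if "b \<in> set xs" for b
      proof (cases "b = a")
        case False
        hence "h b \<noteq> 0" using hV'[OF that] V'0 by metis
        thus ?thesis using False by (simp add: f_def subst0_def)
      qed (simp add: f_def subst0_def)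
      thus ?thesis by simp
    qed
    moreover have "map g (map f xs) = xs"
    proof -
      have "g (f b) = b" if "b \<in> set xs" for b
      proof (cases "b = a")
        case False
        hence "b \<in> ?V" using that xs(2) by blast
        thus ?thesis using gh False by (simp add: f_def)
      qed (simp add: f_def g0)
      thus ?thesis by (simp add: map_idI)
    qed
    ultimately show ?thesis using \<open>(i, map f xs) \<in> ptup t Y'\<close>
      by (simp only: D_def mem_Collect_eq lact_simp simp_thms)
  qed
  have "?h b = b" if "b \<in> {1..t}" for b using that E(4) a(2) by auto
  moreover have "insert a Y \<subseteq> {t+1..n}" "insert z Y' \<subseteq> {t+1..n'}" using E(1,2) at z(1) by auto
  ultimately have "emb t n n' A A' (insert a Y) (insert z Y') ?h"
    using bij iso unfolding emb_def by blast
  thus ?thesis by blast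
qed

lemma emb_step:
  assumes P: "pgroup {1..t} P" and E: "emb t n n' A A' Y Y' h" and tn: "t \<le> n" "t \<le> n'"
    and A: "A \<in> invs P (tup n)" and ext: "ext_prop t P k n' A'" and k: "card Y \<le> k" and a: "a \<in> {1..n}"
  obtains Z Z' g where "emb t n n' A A' Z Z' g" "Y \<subseteq> Z" "card Z \<le> Suc (card Y)" "a \<in> {1..t} \<union> Z"
    "\<And>b. b \<in> {1..t} \<union> Y \<Longrightarrow> g b = h b" "g a \<in> {1..n'}"
proof (cases "a \<in> {1..t} \<union> Y")
  case True
  have "h a \<in> {1..t} \<union> Y'" using bij_betwE[OF embD(3)[OF E]] True by blast
  hence "h a \<in> {1..n'}" using embD(2)[OF E] tn(2) by auto
  thus ?thesis using that[OF E] True by simp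
next
  case False
  then obtain z where z: "emb t n n' A A' (insert a Y) (insert z Y') (h(a := z))"
    using emb_extend[OF P E tn(1) A ext k a] by blast
  have "z \<in> {t+1..n'}" using embD(2)[OF z] by blast
  hence "z \<in> {1..n'}" by simp
  moreover have "(h(a := z)) b = h b" if "b \<in> {1..t} \<union> Y" for b using False that by auto
  ultimately show ?thesis using that[OF z] by (simp add: card_insert_le_m1 card_insert_if le_SucI
      subset_insertI
        finite_subset[OF embD(1)[OF E]])
qed

text \<open>Each quantifier adds at most one point to the domain, so \<open>k\<close> only has to
  cover \<open>card Y + qdepth \<phi>\<close>. Assignments are compared on free variables alone; for
  a sentence they are arbitrary.\<close>

lemma emb_sat:
  assumes P: "pgroup {1..t} P"
  shows "wf_form ar \<phi> \<Longrightarrow> emb t n n' A A' Y Y' h \<Longrightarrow> t \<le> n \<Longrightarrow> t \<le> n' \<Longrightarrow>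
    A \<in> invs P (tup n) \<Longrightarrow> A' \<in> invs P (tup n') \<Longrightarrow> ext_prop t P k n A \<Longrightarrow> ext_prop t P k n' A' \<Longrightarrow>
    card Y + qdepth \<phi> \<le> k \<Longrightarrow> card Y' + qdepth \<phi> \<le> k \<Longrightarrow>
    (\<And>v. v \<in> free_vars \<phi> \<Longrightarrow> e v \<in> {1..t} \<union> Y \<and> e' v = h (e v)) \<Longrightarrow>
    sat (mk_struct n A) e \<phi> \<longleftrightarrow> sat (mk_struct n' A') e' \<phi>"
proof (induction \<phi> arbitrary: n n' A A' Y Y' h e e')
  case (Rel i vs)
  have "map e' vs = map h (map e vs)" using Rel.prems(11) by simp
  moreover have "e v \<in> {1..t} \<union> Y" if "v \<in> set vs" for v using Rel.prems(11)[of v] that by simp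
  hence "set (map e vs) \<subseteq> {1..t} \<union> Y" by (simp only: set_map) blast
  moreover have "length (map e vs) = ar i" using Rel.prems(1) by simp
  ultimately show ?case using embD(5)[OF Rel.prems(2), of "map e vs" i]
    by (simp only: sat.simps mk_struct_simps)
next
  case (Eq x y)
  have "inj_on h ({1..t} \<union> Y)" using embD(3)[OF Eq.prems(2)] bij_betw_def by blast
  moreover have "e x \<in> {1..t} \<union> Y" "e y \<in> {1..t} \<union> Y" "e' x = h (e x)" "e' y = h (e y)"
    using Eq.prems(11) by auto
  ultimately show ?case using inj_on_eq_iff by fastforce
next
  case (Neg p)
  have "sat (mk_struct n A) e p \<longleftrightarrow> sat (mk_struct n' A') e' p"
    by (rule Neg.IH[OF _ Neg.prems(2-8)]) (use Neg.prems in auto)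
  thus ?case by simp
next
  case (Conj p q)
  have "sat (mk_struct n A) e p \<longleftrightarrow> sat (mk_struct n' A') e' p"
    by (rule Conj.IH(1)[OF _ Conj.prems(2-8)]) (use Conj.prems in auto)
  moreover have "sat (mk_struct n A) e q \<longleftrightarrow> sat (mk_struct n' A') e' q"
    by (rule Conj.IH(2)[OF _ Conj.prems(2-8)]) (use Conj.prems in auto)
  ultimately show ?case by simp
next
  case (Forall x p)
  note E = Forall.prems(2)
  have cards: "card Y1 = card Y1'" if "emb t m m' B B' Y1 Y1' g" for m m' B B' Y1 Y1' g
  proof -
    have disj: "{1..t} \<inter> Y1 = {}" "{1..t} \<inter> Y1' = {}" and fin: "finite Y1" "finite Y1'"
      using embD(1,2)[OF that] by (auto intro: finite_subset)
    have "card ({1..t} \<union> Y1) = card ({1..t} \<union> Y1')"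
      using embD(3)[OF that] by (rule bij_betw_same_card)
    thus ?thesis using disj fin by (simp add: card_Un_disjoint)
  qed
  have wf: "wf_form ar p" using Forall.prems(1) by simp
  have kk: "card Y \<le> k" "card Y' \<le> k" "Suc (card Y) + qdepth p \<le> k" "Suc (card Y') + qdepth p \<le> k"
    using Forall.prems(9,10) by auto
  show ?case
  proof
    assume sat: "sat (mk_struct n A) e (Forall x p)"
    show "sat (mk_struct n' A') e' (Forall x p)"
      unfolding sat.simps
    proof
      fix a assume "a \<in> univ (mk_struct n' A')"
      hence a: "a \<in> {1..n'}" by simp
      \<comment> \<open>A point chosen in the second structure is answered by the forth step for the
        inverse map.\<close>
      define g0 where "g0 = inv_into ({1..t} \<union> Y) h"
      obtain Z' Z g where g: "emb t n' n A' A Z' Z g" "Y' \<subseteq> Z'" "card Z' \<le> Suc (card Y')"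
        "a \<in> {1..t} \<union> Z'" "\<And>b. b \<in> {1..t} \<union> Y' \<Longrightarrow> g b = g0 b" "g a \<in> {1..n}"
        using emb_step[OF P emb_sym[OF E] Forall.prems(4,3,6,7) kk(2) a] unfolding g0_def by metis
      have "sat (mk_struct n' A') (e'(x := a)) p \<longleftrightarrow> sat (mk_struct n A) (e(x := g a)) p"
      proof (rule Forall.IH[OF wf g(1) Forall.prems(4,3,6,5,8,7)])
        show "card Z' + qdepth p \<le> k" "card Z + qdepth p \<le> k"
          using g(3) kk cards[OF g(1)] by auto
        fix v assume v: "v \<in> free_vars p"
        show "(e'(x := a)) v \<in> {1..t} \<union> Z' \<and> (e(x := g a)) v = g ((e'(x := a)) v)"
        proof (cases "v = x")
          case False
          hence ev: "e v \<in> {1..t} \<union> Y" "e' v = h (e v)" using v Forall.prems(11)[of v] by auto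
          have "e' v \<in> {1..t} \<union> Y'" using ev bij_betwE[OF embD(3)[OF E]] by simp
          moreover have "g0 (e' v) = e v"
            using bij_betw_inv_into_left[OF embD(3)[OF E] ev(1)] ev(2) by (simp add: g0_def)
          ultimately show ?thesis using g(2,5) False by auto
        qed (use g(4) in simp)
      qed
      moreover have "sat (mk_struct n A) (e(x := g a)) p" using sat g(6) by simp
      ultimately show "sat (mk_struct n' A') (e'(x := a)) p" by simp
    qed
  next
    assume sat: "sat (mk_struct n' A') e' (Forall x p)"
    show "sat (mk_struct n A) e (Forall x p)"
      unfolding sat.simps
    proof
      fix a assume "a \<in> univ (mk_struct n A)"
      hence a: "a \<in> {1..n}" by simp
      obtain Z Z' g where g: "emb t n n' A A' Z Z' g" "Y \<subseteq> Z" "card Z \<le> Suc (card Y)"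
        "a \<in> {1..t} \<union> Z" "\<And>b. b \<in> {1..t} \<union> Y \<Longrightarrow> g b = h b" "g a \<in> {1..n'}"
        using emb_step[OF P E Forall.prems(3,4,5,8) kk(1) a] by metis
      have "sat (mk_struct n A) (e(x := a)) p \<longleftrightarrow> sat (mk_struct n' A') (e'(x := g a)) p"
      proof (rule Forall.IH[OF wf g(1) Forall.prems(3-8)])
        show "card Z + qdepth p \<le> k" "card Z' + qdepth p \<le> k"
          using g(3) kk cards[OF g(1)] by auto
        fix v assume v: "v \<in> free_vars p"
        show "(e(x := a)) v \<in> {1..t} \<union> Z \<and> (e'(x := g a)) v = g ((e(x := a)) v)"
        proof (cases "v = x")
          case False
          hence "e v \<in> {1..t} \<union> Y" "e' v = h (e v)" using v Forall.prems(11)[of v] by auto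
          thus ?thesis using g(2,5) False by auto
        qed (use g(4) in simp)
      qed
      moreover have "sat (mk_struct n' A') (e'(x := g a)) p" using sat g(6) by simp
      ultimately show "sat (mk_struct n A) (e(x := a)) p" by simp
    qed
  qed
qed

lemma ext_models_iff:
  assumes P: "pgroup {1..t} P" and \<phi>: "is_sentence ar \<phi>" and n: "max 1 t \<le> n" "max 1 t \<le> n'"
    and A0: "A0 \<in> invs P (tup t)"
    and R: "R \<in> invs P (mix t n)" "R' \<in> invs P (mix t n')"
    and ext: "ext_prop t P (qdepth \<phi>) n (A0 \<union> R)" "ext_prop t P (qdepth \<phi>) n' (A0 \<union> R')"
  shows "models (mk_struct n (A0 \<union> R)) \<phi> \<longleftrightarrow> models (mk_struct n' (A0 \<union> R')) \<phi>"
proof -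
  have tn: "t \<le> n" "t \<le> n'" using n by auto
  have "(i, xs) \<in> A0 \<union> R \<longleftrightarrow> (i, xs) \<in> A0 \<union> R'" if "length xs = ar i" "set xs \<subseteq> {1..t}" for i xs
  proof -
    have "(i, xs) \<in> tup t" using that by (simp add: tup_iff)
    hence "(i, xs) \<notin> R" "(i, xs) \<notin> R'" using invsD(1)[OF R(1)] invsD(1)[OF R(2)] by (auto simp: mix_def)
    thus ?thesis by simp
  qed
  hence E: "emb t n n' (A0 \<union> R) (A0 \<union> R') {} {} id" by (simp add: emb_def)
  have eq: "sat (mk_struct n (A0 \<union> R)) e \<phi> \<longleftrightarrow> sat (mk_struct n' (A0 \<union> R')) e' \<phi>" for e e'
    by (rule emb_sat[OF P _ E tn invs_join[OF tn(1) A0 R(1)] invs_join[OF tn(2) A0 R(2)] ext])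
       (use \<phi> in \<open>auto simp: is_sentence_def\<close>)
  \<comment> \<open>\<open>models\<close> would hold vacuously over an empty universe;
    \<open>n \<ge> 1\<close> gives an assignment at which to evaluate.\<close>
  have "range (\<lambda>_::nat. 1) \<subseteq> univ (mk_struct n (A0 \<union> R))" "range (\<lambda>_::nat. 1) \<subseteq> univ (mk_struct n'
      (A0 \<union> R'))"
    using n by auto
  thus ?thesis unfolding models_def using eq by blast
qed

section \<open>Extension axioms hold almost surely\<close>

lemma card_ptup_le:
  assumes "finite Y" "card Y \<le> k"
  shows "finite (ptup t Y)" "card (ptup t Y) \<le> (\<Sum>i\<in>UNIV. (t + k + 1) ^ ar i)"
proof -
  let ?X = "SIGMA i:UNIV. {xs. set xs \<subseteq> {0..t} \<union> Y \<and> length xs = ar i}"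
  have fin: "finite ({0..t} \<union> Y)" using assms by simp
  have finX: "finite ?X" by (intro finite_SigmaI finite_lists_length_eq[OF fin]) simp
  have sub: "ptup t Y \<subseteq> ?X" by (auto simp: ptup_def)
  show "finite (ptup t Y)" by (rule finite_subset[OF sub finX])
  have "card ({0..t} \<union> Y) \<le> card {0..t} + card Y" by (rule card_Un_le)
  hence c: "card ({0..t} \<union> Y) \<le> t + k + 1" using assms(2) by simp
  have "card (ptup t Y) \<le> card ?X" by (rule card_mono[OF finX sub])
  also have "\<dots> = (\<Sum>i\<in>UNIV. card ({0..t} \<union> Y) ^ ar i)"
    by (subst card_SigmaI) (auto simp: finite_lists_length_eq[OF fin] card_lists_length_eq[OF fin])
  also have "\<dots> \<le> (\<Sum>i\<in>UNIV. (t + k + 1) ^ ar i)"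
    by (intro sum_mono power_mono c) simp
  finally show "card (ptup t Y) \<le> (\<Sum>i\<in>UNIV. (t + k + 1) ^ ar i)" .
qed

text \<open>Each candidate \<open>z\<close> owns a set of tuples over
  \<open>{1..t} \<union> Y \<union> {z}\<close> containing \<open>z\<close>. These sets are
  disjoint, \<open>P\<close>-invariant and of size bounded independently of \<open>n\<close>, so
  \<open>avoid_patterns\<close> applies with the at least \<open>n - (t + k)\<close> points outside
  \<open>Y\<close> as candidates.\<close>

lemma type_avoided_bound:
  assumes P: "pgroup {1..t} P" and n: "t \<le> n" and A0: "A0 \<subseteq> tup t"
    and Y: "Y \<subseteq> {t+1..n}" "card Y \<le> k" and D: "D \<in> invs P (ptup t Y)"
    and C: "C = 2 ^ (\<Sum>i\<in>UNIV. (t + k + 1) ^ ar i)"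
  shows "real (card {R \<in> invs P (mix t n). \<forall>z\<in>{t+1..n} - Y. \<not> (\<forall>x\<in>ptup t Y. x \<in> D \<longleftrightarrow> lact (subst0
      z) x \<in> A0 \<union> R)})
    \<le> (1 - 1 / real C) ^ (n - (t + k)) * real (mixcount t P n)"
proof -
  let ?Z = "{t+1..n} - Y"
  let ?W = "\<lambda>z. lact (subst0 z) ` ptup t Y" and ?D = "\<lambda>z. lact (subst0 z) ` D"
  have finY: "finite Y" using Y(1) finite_subset by blast
  note cp = card_ptup_le[OF finY Y(2), of t]
  have Cpos: "C \<ge> 1" using C by simp
  have zero: "p 0 = 0" if "p \<in> P" for p
    using permutes_not_in[OF pgroup_permutes[OF P that], of 0] by simp
  \<comment> \<open>\<open>P\<close> fixes both 0 and \<open>z\<close>, so replacing the placeholder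
    commutes with the action and carries invariant sets to invariant sets.\<close>
  have lact_comm: "lact p ` lact (subst0 z) ` X = lact (subst0 z) ` lact p ` X" if "p \<in> P" "z \<in>
      ?Z" for p z X
  proof -
    have pz: "p z = z"
      using permutes_not_in[OF pgroup_permutes[OF P that(1)], of z] that(2) by auto
    have p0: "p b = 0 \<longleftrightarrow> b = 0" for b
      using zero[OF that(1)] permutes_inj[OF pgroup_permutes[OF P that(1)]] by (metis injD)
    have "p \<circ> subst0 z = subst0 z \<circ> p" using pz p0 zero[OF that(1)] by (auto simp: fun_eq_iff subst0_def)
    thus ?thesis by (simp flip: lact_comp_image)
  qed
  have ptup_inv: "lact p ` ptup t Y = ptup t Y" if p: "p \<in> P" for p
  proof -
    have "ptup t Y \<in> invs P (ptup t Y)"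
    proof (rule invsI_group[OF P order_refl])
      fix q x assume q: "q \<in> P" and x: "x \<in> ptup t Y"
      obtain i xs where ix: "x = (i, xs)" by (cases x)
      have xs: "length xs = ar i" "0 \<in> set xs" "set xs \<subseteq> {0..t} \<union> Y" using x by (auto simp: ptup_def ix)
      have "q 0 \<in> q ` set xs" using xs(2) by blast
      moreover have "q b \<in> {0..t} \<union> Y" if "b \<in> set xs" for b
      proof (cases "b \<in> {1..t}")
        case True
        hence "q b \<in> {1..t}" using permutes_in_image[OF pgroup_permutes[OF P q]] by blast
        thus ?thesis by auto
      next
        case False
        hence "q b = b" by (rule permutes_not_in[OF pgroup_permutes[OF P q]])
        thus ?thesis using that xs(3) by auto
      qed
      hence "q ` set xs \<subseteq> {0..t} \<union> Y" by blast
      ultimately show "lact q x \<in> ptup t Y" using xs(1) unfolding zero[OF q] by (simp add: ptup_def ix)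
    qed
    thus ?thesis using invsD(2) p by blast
  qed
  \<comment> \<open>This description yields both that the tuples leave \<open>{1..t}\<close> and
    that different candidates own disjoint sets.\<close>
  have W_shape: "set xs \<subseteq> {1..t} \<union> Y \<union> {z} \<and> z \<in> set xs \<and> length xs = ar i"
    if xW: "(i, xs) \<in> ?W z" and "z \<in> ?Z" for i xs z
  proof -
    obtain ys where ys: "(i, ys) \<in> ptup t Y" "xs = map (subst0 z) ys"
    proof -
      obtain y where y: "(i, xs) = lact (subst0 z) y" "y \<in> ptup t Y" using xW by (rule imageE)
      obtain j ys where "y = (j, ys)" by (cases y)
      thus ?thesis using y that by simp
    qed
    hence y: "length ys = ar i" "0 \<in> set ys" "set ys \<subseteq> {0..t} \<union> Y" by (auto simp: ptup_def)
    have "subst0 z 0 \<in> subst0 z ` set ys" using y(2) by blast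
    moreover have "subst0 z b \<in> {1..t} \<union> Y \<union> {z}" if "b \<in> set ys" for b
    proof -
      have "b \<in> {0..t} \<union> Y" using that y(3) by blast
      thus ?thesis by (cases "b = 0") (auto simp: subst0_def)
    qed
    ultimately show ?thesis using ys y by (auto simp: subst0_def)
  qed
  have W_mix: "?W z \<subseteq> mix t n" if z: "z \<in> ?Z" for z
  proof
    fix x assume x: "x \<in> ?W z"
    obtain i xs where ix: "x = (i, xs)" by (cases x)
    note s = W_shape[OF x[unfolded ix] z]
    have "{1..t} \<union> Y \<union> {z} \<subseteq> {1..n}" using Y(1) z n by auto
    hence "x \<in> tup n" using s by (auto simp: tup_iff ix)
    moreover have "z \<notin> {1..t}" using z by auto
    ultimately show "x \<in> mix t n" using s by (auto simp: mix_def tup_iff ix)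
  qed
  have W_inv: "?W z \<in> invs P (mix t n)" if z: "z \<in> ?Z" for z
    by (rule invsI[OF W_mix[OF z]]) (simp only: lact_comm[OF _ z] ptup_inv)
  have D_inv: "?D z \<in> invs P (mix t n)" if z: "z \<in> ?Z" for z
  proof (rule invsI)
    show "?D z \<subseteq> mix t n" using W_mix[OF z] invsD(1)[OF D] by blast
    show "lact p ` ?D z = ?D z" if "p \<in> P" for p
      by (simp only: lact_comm[OF that z] invsD(2)[OF D that])
  qed
  have sub: "{R \<in> invs P (mix t n). \<forall>z\<in>?Z. \<not> (\<forall>x\<in>ptup t Y. x \<in> D \<longleftrightarrow> lact (subst0 z) x \<in> A0 \<union> R)}
      \<subseteq> {R \<in> invs P (mix t n). \<forall>z\<in>?Z. R \<inter> ?W z \<noteq> ?D z}"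
  proof safe
    fix R z assume R: "R \<in> invs P (mix t n)"
      and avoid: "\<forall>z\<in>?Z. \<not> (\<forall>x\<in>ptup t Y. x \<in> D \<longleftrightarrow> lact (subst0 z) x \<in> A0 \<union> R)"
      and zz: "z \<in> {t+1..n}" "z \<notin> Y" and eq: "R \<inter> ?W z = ?D z"
    have z: "z \<in> ?Z" using zz by blast
    have inj: "inj_on (subst0 z) ({0..t} \<union> Y)"
      using z by (auto simp: inj_on_def subst0_def)
    have "x \<in> D \<longleftrightarrow> lact (subst0 z) x \<in> A0 \<union> R" if x: "x \<in> ptup t Y" for x
    proof -
      have xW: "lact (subst0 z) x \<in> ?W z" using x by blast
      hence "lact (subst0 z) x \<in> mix t n" using W_mix[OF z] by blast
      hence nA: "lact (subst0 z) x \<notin> A0" using A0 by (auto simp: mix_def)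
      have "x \<in> D" if Dx: "lact (subst0 z) x \<in> ?D z"
      proof -
        obtain y where y: "y \<in> D" "lact (subst0 z) x = lact (subst0 z) y" using Dx by (rule imageE)
        have "y \<in> ptup t Y" using y(1) invsD(1)[OF D] by blast
        obtain i xs where ix: "x = (i, xs)" by (cases x)
        obtain j ys where jy: "y = (j, ys)" by (cases y)
        have "set xs \<union> set ys \<subseteq> {0..t} \<union> Y"
          using x \<open>y \<in> ptup t Y\<close> by (auto simp: ptup_def ix jy)
        hence 1: "inj_on (subst0 z) (set xs \<union> set ys)" by (rule inj_on_subset[OF inj])
        have 2: "map (subst0 z) xs = map (subst0 z) ys" and "i = j" using y(2) by (simp_all only:
            ix jy lact_simp prod.inject)
        have "xs = ys" by (rule map_inj_on[OF 2 1])
        thus ?thesis using y(1) \<open>i = j\<close> by (simp add: ix jy)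
      qed
      hence "x \<in> D \<longleftrightarrow> lact (subst0 z) x \<in> ?D z" by (auto intro: imageI)
      also have "\<dots> \<longleftrightarrow> lact (subst0 z) x \<in> R" using xW unfolding eq[symmetric] by simp
      finally show ?thesis using nA by simp
    qed
    thus False using avoid z by blast
  qed
  have inj: "inj p" if "p \<in> P" for p using permutes_inj[OF pgroup_permutes[OF P that]] .
  have "real (card {R \<in> invs P (mix t n). \<forall>z\<in>?Z. R \<inter> ?W z \<noteq> ?D z}) \<le> (1 - 1 / real C) ^ card ?Z *
      real (card (invs P (mix t n)))"
  proof (rule avoid_patterns)
    show "finite (invs P (mix t n))" by (rule finite_invs[OF finite_mix])
    show "R - ?W z \<union> ?D z \<in> invs P (mix t n)" if "R \<in> invs P (mix t n)" "z \<in> ?Z" for R z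
      by (rule invs_Un[OF invs_Diff[OF inj that(1) W_inv[OF that(2)]] D_inv[OF that(2)]])
    show "?D z \<subseteq> ?W z" for z using invsD(1)[OF D] by blast
    show "?W y \<inter> ?W z = {}" if yz: "y \<in> ?Z" "z \<in> ?Z" "y \<noteq> z" for y z
    proof (rule equals0I)
      fix x assume x: "x \<in> ?W y \<inter> ?W z"
      obtain i xs where ix: "x = (i, xs)" by (cases x)
      have xx: "(i, xs) \<in> ?W y" "(i, xs) \<in> ?W z" using x by (simp_all only: ix Int_iff)
      have "z \<in> {1..t} \<union> Y \<union> {y}" using W_shape[OF xx(1) yz(1)] W_shape[OF xx(2) yz(2)] by blast
      thus False using yz by auto
    qed
    show "finite (?W z) \<and> 2 ^ card (?W z) \<le> C" for z
    proof
      show "finite (?W z)" using cp(1) by simp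
      have "card (?W z) \<le> (\<Sum>i\<in>UNIV. (t + k + 1) ^ ar i)" using card_image_le[OF cp(1)] cp(2)
          le_trans by blast
      thus "2 ^ card (?W z) \<le> C" unfolding C by (rule power_increasing) simp
    qed
    show "finite ?Z" by simp
    show "0 < C" using Cpos by simp
  qed
  also have "\<dots> \<le> (1 - 1 / real C) ^ (n - (t + k)) * real (card (invs P (mix t n)))"
  proof (rule mult_right_mono[OF power_decreasing])
    have "card ?Z = n - t - card Y" using Y(1) finY by (simp add: card_Diff_subset)
    thus "n - (t + k) \<le> card ?Z" using Y(2) by simp
  qed (use Cpos in auto)
  finally have main: "real (card {R \<in> invs P (mix t n). \<forall>z\<in>?Z. R \<inter> ?W z \<noteq> ?D z})
     \<le> (1 - 1 / real C) ^ (n - (t + k)) * real (mixcount t P n)" by (simp add: mixcount_def)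
  have "card {R \<in> invs P (mix t n). \<forall>z\<in>?Z. \<not> (\<forall>x\<in>ptup t Y. x \<in> D \<longleftrightarrow> lact (subst0 z) x \<in> A0 \<union> R)}
     \<le> card {R \<in> invs P (mix t n). \<forall>z\<in>?Z. R \<inter> ?W z \<noteq> ?D z}"
    by (rule card_mono[OF _ sub]) (simp add: finite_invs[OF finite_mix])
  thus ?thesis using main by linarith
qed

abbreviation non_ext ::
  "nat \<Rightarrow> (nat \<Rightarrow> nat) set \<Rightarrow> nat \<Rightarrow> ('i \<times> nat list) set \<Rightarrow> nat \<Rightarrow> ('i \<times> nat list) set set" where
  "non_ext t P k A0 n \<equiv> {R \<in> invs P (mix t n). \<not> ext_prop t P k n (A0 \<union> R)}"

text \<open>A union bound: there are O(n^k) sets \<open>Y\<close> and at most \<open>C\<close> types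
  over each, against a failure proportion exponentially small in \<open>n\<close>.\<close>

lemma ext_ratio:
  assumes P: "pgroup {1..t} P" and A0: "A0 \<subseteq> tup t"
  shows "(\<lambda>n. real (card (non_ext t P k A0 n)) / real (mixcount t P n)) \<longlonglongrightarrow> 0"
proof -
  define c where "c = (\<Sum>i\<in>UNIV. (t + k + 1) ^ ar i)"
  define C where "C = (2 :: nat) ^ c"
  define d where "d = 1 - 1 / real C"
  \<comment> \<open>This makes \<open>C \<ge> 2\<close> and hence \<open>d > 0\<close>, which
    \<open>power_times_geometric\<close> requires.\<close>
  have "c \<ge> 1"
  proof -
    have "(t + k + 1) ^ ar i \<le> c" for i unfolding c_def by (rule member_le_sum) auto
    moreover have "1 \<le> (t + k + 1) ^ ar i" for i by simp
    ultimately show ?thesis using le_trans by blast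
  qed
  hence "2 ^ 1 \<le> C" unfolding C_def by (intro power_increasing) auto
  hence d: "0 < d" "d < 1" by (simp_all add: d_def)
  let ?E = "\<lambda>n. real (Suc k) * real C * (real n ^ k * d ^ (n - (t + k)))"
  have E0: "?E \<longlonglongrightarrow> 0" by (rule tendsto_mult_right_zero[OF power_times_geometric[OF d]])
  have "eventually (\<lambda>n. real (card (non_ext t P k A0 n)) / real (mixcount t P n) \<le> ?E n) sequentially"
    using eventually_ge_at_top[of "max 1 t"]
  proof eventually_elim
    case (elim n)
    hence n: "1 \<le> n" "t \<le> n" by auto
    define Ys where "Ys = {Y. Y \<subseteq> {t+1..n} \<and> card Y \<le> k}"
    define B where "B = (\<lambda>Y D. {R \<in> invs P (mix t n). \<forall>z\<in>{t+1..n} - Y. \<not> (\<forall>x\<in>ptup t Y. x \<in> D \<longleftrightarrow>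
        lact (subst0 z) x \<in> A0 \<union> R)})"
    have finYs: "finite Ys" unfolding Ys_def by simp
    have YsD: "finite Y" "card Y \<le> k" "Y \<subseteq> {t+1..n}" if "Y \<in> Ys" for Y
      using that finite_subset[of Y "{t+1..n}"] by (simp_all add: Ys_def)
    have finD: "finite (invs P (ptup t Y))" if "Y \<in> Ys" for Y
      by (rule finite_invs[OF card_ptup_le(1)[OF YsD(1,2)[OF that]]])
    have cardD: "card (invs P (ptup t Y)) \<le> C" if "Y \<in> Ys" for Y
    proof -
      note cp = card_ptup_le[OF YsD(1,2)[OF that], of t]
      have "card (invs P (ptup t Y)) \<le> card (Pow (ptup t Y))"
        by (rule card_mono) (use cp(1) in \<open>auto simp: invs_def\<close>)
      also have "\<dots> = 2 ^ card (ptup t Y)" by (rule card_Pow[OF cp(1)])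
      also have "\<dots> \<le> C" unfolding C_def by (rule power_increasing) (use cp(2) in \<open>simp_all add: c_def\<close>)
      finally show ?thesis .
    qed
    have finB: "finite (B Y D)" for Y D unfolding B_def by (simp add: finite_invs[OF finite_mix])
    have cardYs: "card Ys \<le> Suc k * n ^ k"
    proof -
      have "Ys = (\<Union>j\<in>{..k}. {Y. Y \<subseteq> {t+1..n} \<and> card Y = j})" by (auto simp: Ys_def)
      hence "card Ys \<le> (\<Sum>j\<le>k. card {Y. Y \<subseteq> {t+1..n} \<and> card Y = j})" by (simp add: card_UN_le)
      also have "\<dots> \<le> (\<Sum>j\<le>k. n ^ k)"
      proof (rule sum_mono)
        fix j assume j: "j \<in> {..k}"
        have "card {Y. Y \<subseteq> {t+1..n} \<and> card Y = j} = (n - t) choose j"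
          using n_subsets[of "{t+1..n}" j] by simp
        also have "\<dots> \<le> n choose j" by (rule binomial_right_mono) simp
        also have "\<dots> \<le> n ^ j"
        proof (cases "j \<le> n")
          case True
          thus ?thesis by (rule binomial_le_pow)
        next
          case False
          thus ?thesis by (simp add: binomial_eq_0)
        qed
        also have "\<dots> \<le> n ^ k" using j n(1) by (intro power_increasing) auto
        finally show "card {Y. Y \<subseteq> {t+1..n} \<and> card Y = j} \<le> n ^ k" .
      qed
      finally show ?thesis by simp
    qed
    have "(non_ext t P k A0 n) \<subseteq> (\<Union>Y\<in>Ys. \<Union>D\<in>invs P (ptup t Y). B Y D)"
    proof
      fix R assume "R \<in> non_ext t P k A0 n"
      then obtain Y D where R: "R \<in> invs P (mix t n)" and Y: "Y \<subseteq> {t+1..n}" "card Y \<le> k" and D: "D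
          \<in> invs P (ptup t Y)"
        and no: "\<not> (\<exists>z\<in>{t+1..n} - Y. \<forall>x\<in>ptup t Y. x \<in> D \<longleftrightarrow> lact (subst0 z) x \<in> A0 \<union> R)"
        unfolding ext_prop_def by blast
      have "Y \<in> Ys" using Y by (simp add: Ys_def)
      moreover have "R \<in> B Y D" unfolding B_def using R no by blast
      ultimately show "R \<in> (\<Union>Y\<in>Ys. \<Union>D\<in>invs P (ptup t Y). B Y D)" using D by blast
    qed
    hence "card (non_ext t P k A0 n) \<le> card (\<Union>Y\<in>Ys. \<Union>D\<in>invs P (ptup t Y). B Y D)"
      by (rule card_mono[rotated]) (use finYs finD finB in auto)
    also have "\<dots> \<le> (\<Sum>Y\<in>Ys. card (\<Union>D\<in>invs P (ptup t Y). B Y D))" by (rule card_UN_le[OF finYs])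
    also have "\<dots> \<le> (\<Sum>Y\<in>Ys. \<Sum>D\<in>invs P (ptup t Y). card (B Y D))"
      by (rule sum_mono) (rule card_UN_le[OF finD])
    finally have "real (card (non_ext t P k A0 n)) \<le> real (\<Sum>Y\<in>Ys. \<Sum>D\<in>invs P (ptup t Y). card (B Y D))"
      by (rule of_nat_mono)
    also have "\<dots> = (\<Sum>Y\<in>Ys. \<Sum>D\<in>invs P (ptup t Y). real (card (B Y D)))" by simp
    also have "\<dots> \<le> (\<Sum>Y\<in>Ys. \<Sum>D\<in>invs P (ptup t Y). d ^ (n - (t + k)) * real (mixcount t P n))"
    proof (intro sum_mono)
      fix Y D assume "Y \<in> Ys" "D \<in> invs P (ptup t Y)"
      thus "real (card (B Y D)) \<le> d ^ (n - (t + k)) * real (mixcount t P n)"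
        unfolding B_def d_def
        by (intro type_avoided_bound[OF P n(2) A0 YsD(3,2)]) (simp_all add: C_def c_def)
    qed
    also have "\<dots> = (\<Sum>Y\<in>Ys. real (card (invs P (ptup t Y))) * (d ^ (n - (t + k)) * real (mixcount t
        P n)))" by simp
    also have "\<dots> \<le> (\<Sum>Y\<in>Ys. real C * (d ^ (n - (t + k)) * real (mixcount t P n)))"
      by (intro sum_mono mult_right_mono) (use cardD d in auto)
    also have "\<dots> = real (card Ys) * (real C * (d ^ (n - (t + k)) * real (mixcount t P n)))" by simp
    also have "\<dots> \<le> real (Suc k * n ^ k) * (real C * (d ^ (n - (t + k)) * real (mixcount t P n)))"
      by (intro mult_right_mono of_nat_mono cardYs) (use d in auto)
    also have "\<dots> = ?E n * real (mixcount t P n)" by (simp only: of_nat_mult of_nat_power mult_ac)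
    finally show ?case using mixcount_pos[of t P n] by (simp add: divide_le_eq)
  qed
  note upper = this
  have "eventually (\<lambda>n. 0 \<le> real (card (non_ext t P k A0 n)) / real (mixcount t P n)) sequentially"
    by simp
  from tendsto_sandwich[OF this upper tendsto_const E0] show ?thesis .
qed

text \<open>By \<open>ext_models_iff\<close> all extensions of \<open>A0\<close> with the extension
  property, of all sizes at least \<open>max 1 t\<close>, agree on the sentence. So a single one of
  them that satisfies it forces the limit 1, and otherwise the limit is 0. The value is kept as a
  natural number so that sums over \<open>base\<close> remain integers.\<close>

lemma zero_one:
  assumes P: "pgroup {1..t} P" and A0: "A0 \<in> invs P (tup t)" and \<phi>: "is_sentence ar \<phi>"
  shows "\<exists>b::nat. b \<le> 1 \<and> (\<lambda>n. real (card {R \<in> invs P (mix t n). models (mk_struct n (A0 \<union> R)) \<phi>})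
      / real (mixcount t P n)) \<longlonglongrightarrow> real b"
proof -
  define k where "k = qdepth \<phi>"
  define N where "N = (\<lambda>n. real (mixcount t P n))"
  define bad where "bad = (\<lambda>n. (non_ext t P k A0 n))"
  define S where "S = (\<lambda>n. {R \<in> invs P (mix t n). models (mk_struct n (A0 \<union> R)) \<phi>})"
  define S' where "S' = (\<lambda>n. {R \<in> invs P (mix t n). \<not> models (mk_struct n (A0 \<union> R)) \<phi>})"
  have Npos: "N n > 0" for n using mixcount_pos by (simp add: N_def)
  have bad0: "(\<lambda>n. real (card (bad n)) / N n) \<longlonglongrightarrow> 0"
    unfolding bad_def N_def by (rule ext_ratio[OF P invsD(1)[OF A0]])
  have finbad: "finite (bad n)" for n unfolding bad_def by (simp add: finite_invs[OF finite_mix])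
  have neg: "(\<lambda>n. real (card (X n)) / N n) \<longlonglongrightarrow> 0" if "\<And>n. n \<ge> max 1 t \<Longrightarrow> X n \<subseteq> bad n" for X
  proof (rule tendsto_sandwich[OF _ _ tendsto_const bad0])
    show "eventually (\<lambda>n. 0 \<le> real (card (X n)) / N n) sequentially"
      using Npos less_imp_le by (intro always_eventually allI divide_nonneg_nonneg) auto
    show "eventually (\<lambda>n. real (card (X n)) / N n \<le> real (card (bad n)) / N n) sequentially"
      using eventually_ge_at_top[of "max 1 t"]
      by eventually_elim (intro divide_right_mono of_nat_mono card_mono finbad that, use Npos
          less_imp_le in auto)
  qed
  show ?thesis
  proof (cases "\<exists>n\<ge>max 1 t. \<exists>R\<in>S n. R \<notin> bad n")
    case True
    then obtain m Q where m: "max 1 t \<le> m" "Q \<in> S m" "Q \<notin> bad m" by blast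
    have Q: "Q \<in> invs P (mix t m)" "models (mk_struct m (A0 \<union> Q)) \<phi>" "ext_prop t P k m (A0 \<union> Q)"
      using m by (auto simp: S_def bad_def)
    have "S' n \<subseteq> bad n" if n: "n \<ge> max 1 t" for n
    proof
      fix R assume R: "R \<in> S' n"
      hence R1: "R \<in> invs P (mix t n)" "\<not> models (mk_struct n (A0 \<union> R)) \<phi>" by (auto simp: S'_def)
      show "R \<in> bad n"
      proof (rule ccontr)
        assume "R \<notin> bad n"
        hence "ext_prop t P k n (A0 \<union> R)" using R1 by (simp add: bad_def)
        hence "models (mk_struct n (A0 \<union> R)) \<phi>"
          using ext_models_iff[OF P \<phi> n m(1) A0 R1(1) Q(1)] Q(2,3) by (simp add: k_def)
        thus False using R1(2) by blast
      qed
    qed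
    hence "(\<lambda>n. real (card (S' n)) / N n) \<longlonglongrightarrow> 0" by (rule neg)
    hence "(\<lambda>n. 1 - real (card (S' n)) / N n) \<longlonglongrightarrow> 1 - 0" by (intro tendsto_diff tendsto_const)
    moreover have "1 - real (card (S' n)) / N n = real (card (S n)) / N n" for n
    proof -
      have "card (invs P (mix t n)) = card (S n) + card (S' n)"
        unfolding S_def S'_def by (rule card_split[OF finite_invs[OF finite_mix]])
      hence "N n = real (card (S n)) + real (card (S' n))" by (simp add: N_def mixcount_def)
      thus ?thesis using Npos[of n] by (simp add: field_simps)
    qed
    ultimately show ?thesis unfolding S_def N_def by (intro exI[of _ 1]) simp
  next
    case False
    hence "S n \<subseteq> bad n" if "n \<ge> max 1 t" for n using that by blast
    hence "(\<lambda>n. real (card (S n)) / N n) \<longlonglongrightarrow> 0" by (rule neg)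
    thus ?thesis unfolding S_def N_def by (intro exI[of _ 0]) simp
  qed
qed

section \<open>Limits for a fixed automorphism group\<close>

abbreviation exact_ext ::
  "nat \<Rightarrow> (nat \<Rightarrow> nat) set \<Rightarrow> ('i \<times> nat list) set \<Rightarrow> nat \<Rightarrow> 'i form \<Rightarrow> ('i \<times> nat list) set set" where
  "exact_ext t P A0 n \<phi> \<equiv>
    {R \<in> invs P (mix t n). autg n (A0 \<union> R) = P \<and> models (mk_struct n (A0 \<union> R)) \<phi>}"

text \<open>By \<open>bad_ratio\<close>, demanding automorphism group exactly \<open>P\<close>
  changes the count in \<open>zero_one\<close> only by a negligible amount.\<close>

lemma base_limit:
  assumes P: "pgroup {1..t} P" and A0: "A0 \<in> base t P" and \<phi>: "is_sentence ar \<phi>"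
  shows "\<exists>b::nat. b \<le> 1 \<and> (\<lambda>n. real (card (exact_ext t P A0 n \<phi>)) / real (mixcount t P n)) \<longlonglongrightarrow> real b"
proof -
  have A0': "A0 \<in> invs P (tup t)" using A0 by (simp add: base_def)
  define S where "S = (\<lambda>n. {R \<in> invs P (mix t n). models (mk_struct n (A0 \<union> R)) \<phi>})"
  define G where "G = (\<lambda>n. (exact_ext t P A0 n \<phi>))"
  define B where "B = (\<lambda>n. (extra_aut t P A0 n))"
  define N where "N = (\<lambda>n. real (mixcount t P n))"
  have Npos: "N n > 0" for n using mixcount_pos by (simp add: N_def)
  obtain b :: nat where b: "b \<le> 1" "(\<lambda>n. real (card (S n)) / N n) \<longlonglongrightarrow> real b"
    using zero_one[OF P A0' \<phi>] unfolding S_def N_def by blast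
  have B0: "(\<lambda>n. real (card (B n)) / N n) \<longlonglongrightarrow> 0" unfolding B_def N_def by (rule bad_ratio[OF P A0])
  have fin: "finite (G n)" "finite (B n)" "finite (S n)" for n
    unfolding G_def B_def S_def by (simp_all add: finite_invs[OF finite_mix])
  have le1: "card (G n) \<le> card (S n)" for n by (rule card_mono[OF fin(3)]) (auto simp: G_def S_def)
  have le2: "card (S n) \<le> card (G n) + card (B n)" for n
  proof -
    have "card (S n) \<le> card (G n \<union> B n)" by (rule card_mono) (use fin in \<open>auto simp: G_def S_def B_def\<close>)
    also have "\<dots> \<le> card (G n) + card (B n)" by (rule card_Un_le)
    finally show ?thesis .
  qed
  have "(\<lambda>n. real (card (G n)) / N n) \<longlonglongrightarrow> real b"
  proof (rule tendsto_sandwich[OF _ _ _ b(2)])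
    show "(\<lambda>n. real (card (S n)) / N n - real (card (B n)) / N n) \<longlonglongrightarrow> real b"
      using tendsto_diff[OF b(2) B0] by simp
    have "real (card (S n)) / N n - real (card (B n)) / N n \<le> real (card (G n)) / N n" for n
    proof -
      have "real (card (S n)) - real (card (B n)) \<le> real (card (G n))" using le2[of n] by linarith
      hence "(real (card (S n)) - real (card (B n))) / N n \<le> real (card (G n)) / N n"
        by (rule divide_right_mono) (rule less_imp_le[OF Npos])
      thus ?thesis by (simp add: diff_divide_distrib)
    qed
    thus "eventually (\<lambda>n. real (card (S n)) / N n - real (card (B n)) / N n \<le> real (card (G n)) /
        N n) sequentially"
      by simp
    show "eventually (\<lambda>n. real (card (G n)) / N n \<le> real (card (S n)) / N n) sequentially"
      using le1 Npos less_imp_le by (intro always_eventually allI divide_right_mono of_nat_mono) auto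
  qed
  thus ?thesis using b(1) unfolding G_def N_def by blast
qed

abbreviation exact :: "nat \<Rightarrow> (nat \<Rightarrow> nat) set \<Rightarrow> 'i form \<Rightarrow> ('i \<times> nat list) set set" where
  "exact n P \<phi> \<equiv> {A \<in> Pow (tup n). autg n A = P \<and> models (mk_struct n A) \<phi>}"

text \<open>The limit is the number of members of \<open>base t P\<close> over which the sentence is
  almost surely true. Its bound is independent of the sentence, which gives the finite set of limits
  later.\<close>

lemma group_limit:
  assumes P: "pgroup {1..t} P" and \<phi>: "is_sentence ar \<phi>"
  shows "\<exists>b::nat. b \<le> card (base t P) \<and>
    (\<lambda>n. real (card (exact n P \<phi>)) / real (mixcount t P n)) \<longlonglongrightarrow> real b"
proof -
  have "\<forall>A0\<in>base t P. \<exists>b::nat. b \<le> 1 \<and> (\<lambda>n. real (card (exact_ext t P A0 n \<phi>)) / real (mixcount t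
      P n)) \<longlonglongrightarrow> real b"
    using base_limit[OF P _ \<phi>] by blast
  from bchoice[OF this] obtain b :: "('i \<times> nat list) set \<Rightarrow> nat"
    where "\<forall>A0\<in>base t P. b A0 \<le> 1 \<and> (\<lambda>n. real (card (exact_ext t P A0 n \<phi>)) / real (mixcount t P
        n)) \<longlonglongrightarrow> real (b A0)" ..
  hence b: "\<And>A0. A0 \<in> base t P \<Longrightarrow> b A0 \<le> 1"
    "\<And>A0. A0 \<in> base t P \<Longrightarrow> (\<lambda>n. real (card (exact_ext t P A0 n \<phi>)) / real (mixcount t P n)) \<longlonglongrightarrow> real (b A0)"
    by simp_all
  have "(\<lambda>n. \<Sum>A0\<in>base t P. real (card (exact_ext t P A0 n \<phi>)) / real (mixcount t P n))
     \<longlonglongrightarrow> (\<Sum>A0\<in>base t P. real (b A0))"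
    by (rule tendsto_sum) (rule b(2))
  moreover have "eventually (\<lambda>n. (\<Sum>A0\<in>base t P. real (card (exact_ext t P A0 n \<phi>)) / real
      (mixcount t P n))
     = real (card (exact n P \<phi>)) / real (mixcount t P n)) sequentially"
    using eventually_ge_at_top[of t]
  proof eventually_elim
    case (elim n)
    show ?case using count_by_base[OF P elim, of "\<lambda>A. models (mk_struct n A) \<phi>"]
      by (simp add: sum_divide_distrib)
  qed
  ultimately have "(\<lambda>n. real (card (exact n P \<phi>)) / real (mixcount t P n))
     \<longlonglongrightarrow> (\<Sum>A0\<in>base t P. real (b A0))" by (rule Lim_transform_eventually)
  moreover have "(\<Sum>A0\<in>base t P. b A0) \<le> card (base t P)"
    using sum_mono[of "base t P" b "\<lambda>_. 1"] b(1) by simp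
  ultimately show ?thesis by (intro exI[of _ "\<Sum>A0\<in>base t P. b A0"]) simp
qed

end

section \<open>Comparing orders of magnitude\<close>

context vocabulary
begin

text \<open>A tuple is fixed when all its entries are, and \<open>p\<close> fixes every point above
  \<open>t\<close>; so the count is a polynomial in \<open>n\<close>.\<close>

lemma card_fixed_tuples:
  assumes p: "p permutes {1..t}" and n: "t \<le> n"
  shows "real (card {x \<in> tup n. lact p x = x}) = (\<Sum>i\<in>UNIV. (real n - real (card {a\<in>{1..t}. p a \<noteq>
      a})) ^ ar i)"
proof -
  let ?F = "{a\<in>{1..n}. p a = a}" and ?S = "{a\<in>{1..t}. p a \<noteq> a}"
  have "{x \<in> tup n. lact p x = x} = (SIGMA i:UNIV. {xs. set xs \<subseteq> ?F \<and> length xs = ar i})"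
  proof -
    have "map p xs = xs \<longleftrightarrow> (\<forall>a\<in>set xs. p a = a)" for xs using map_eq_conv[of p xs "\<lambda>x. x"] by simp
    thus ?thesis by (auto simp: tuples_def subset_iff)
  qed
  moreover have "finite ?F" by simp
  ultimately have "card {x \<in> tup n. lact p x = x} = (\<Sum>i\<in>UNIV. card ?F ^ ar i)"
    by (simp add: card_SigmaI finite_lists_length_eq card_lists_length_eq)
  moreover have "real (card ?F) = real n - real (card ?S)"
  proof -
    have "{a\<in>{1..n}. p a \<noteq> a} = ?S"
      using n permutes_not_in[OF p] by fastforce
    moreover have "card {1..n} = card ?F + card {a\<in>{1..n}. p a \<noteq> a}" by (rule card_split) simp
    ultimately show ?thesis by simp
  qed
  ultimately show ?thesis by simp
qed

text \<open>The exponent is recorded twice: as a polynomial value, for comparing growth, and as a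
  natural number, because rationality of limits rests on its integrality.\<close>

lemma mixcount_poly:
  assumes P: "pgroup {1..t} P"
  shows "\<exists>Q::real poly. \<forall>n\<ge>t. \<exists>m::nat. mixcount t P n = 2 ^ m \<and> real m = poly Q (real n)"
proof -
  define s where "s = (\<lambda>p. real (card {a\<in>{1..t}. p a \<noteq> a}))"
  \<comment> \<open>\<open>[:- s p, 1:]\<close> is the linear polynomial X - s(p). The subtracted
    constants account for the fixed tuples inside \<open>tup t\<close>.\<close>
  define Q where "Q = smult (1 / real (card P)) (\<Sum>p\<in>P. \<Sum>i\<in>UNIV. [:- s p, 1:] ^ ar i - [:(real t -
      s p) ^ ar i:])"
  have finP: "finite P" using pgroup_finite[OF P] by simp
  hence cP: "card P > 0" using pgroup_id[OF P] card_gt_0_iff by blast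
  show ?thesis
  proof (intro exI[of _ Q] allI impI)
    fix n assume n: "t \<le> n"
    interpret finite_action "{1..t}" P lact "mix t n"
      by unfold_locales
         (use P finP finite_mix lact_mix[OF pgroup_permutes[OF P] n] in \<open>auto simp: lact_comp\<close>)
    have "real (card (orb ` mix t n)) * real (card P) = (\<Sum>p\<in>P. real (card {x \<in> mix t n. lact p x = x}))"
      unfolding of_nat_mult[symmetric] of_nat_sum[symmetric] by (simp only: burnside_fix)
    also have "\<dots> = (\<Sum>p\<in>P. \<Sum>i\<in>UNIV. (real n - s p) ^ ar i - (real t - s p) ^ ar i)"
    proof (rule sum.cong[OF refl])
      fix p assume "p \<in> P"
      hence p: "p permutes {1..t}" by (rule pgroup_permutes[OF P])
      have "{x \<in> mix t n. lact p x = x} = {x \<in> tup n. lact p x = x} - {x \<in> tup t. lact p x = x}"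
        by (auto simp: mix_def)
      moreover have "{x \<in> tup t. lact p x = x} \<subseteq> {x \<in> tup n. lact p x = x}" using tup_mono[OF n] by blast
      ultimately have "real (card {x \<in> mix t n. lact p x = x}) =
        real (card {x \<in> tup n. lact p x = x}) - real (card {x \<in> tup t. lact p x = x})"
        by (simp add: card_Diff_subset finite_tup card_mono of_nat_diff)
      thus "real (card {x \<in> mix t n. lact p x = x}) = (\<Sum>i\<in>UNIV. (real n - s p) ^ ar i - (real t -
          s p) ^ ar i)"
        by (simp only: card_fixed_tuples[OF p n] card_fixed_tuples[OF p order_refl] s_def sum_subtractf)
    qed
    finally have "real (card (orb ` mix t n)) = poly Q (real n)"
      using cP by (simp add: Q_def poly_sum field_simps)
    moreover have "mixcount t P n = 2 ^ card (orb ` mix t n)"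
      unfolding mixcount_def invs_def by (rule card_invariant_subsets)
    ultimately show "\<exists>m. mixcount t P n = 2 ^ m \<and> real m = poly Q (real n)" by blast
  qed
qed

text \<open>Writing \<open>Q - Q'\<close> as \<open>pCons a E\<close>, the exponents eventually
  differ by at least \<open>a + c * n\<close> with \<open>c > 0\<close>. The resulting exponential
  outweighs the quotient of factorials, which is at least n^(-t').\<close>

lemma growth_ratio_at_top:
  assumes Q: "\<And>n. n \<ge> t \<Longrightarrow> \<exists>m::nat. mixcount t P n = 2 ^ m \<and> real m = poly Q (real n)"
    and Q': "\<And>n. n \<ge> t' \<Longrightarrow> \<exists>m::nat. mixcount t' P' n = 2 ^ m \<and> real m = poly Q' (real n)"
    and D: "degree (Q - Q') > 0" "lead_coeff (Q - Q') > 0"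
  shows "filterlim (\<lambda>n. growth t P n / growth t' P' n) at_top sequentially"
proof -
  obtain a E where E: "Q - Q' = pCons a E" by (cases "Q - Q'")
  have "E \<noteq> 0" using D(1) E by auto
  hence lcE: "lead_coeff E > 0" using D(2) E by simp
  define c where "c = lead_coeff E"
  have c: "c > 0" using lcE by (simp add: c_def)
  obtain x0 where x0: "\<And>x. x \<ge> x0 \<Longrightarrow> poly E x \<ge> c"
    using poly_pinfty_gt_lc[OF lcE] unfolding c_def by blast
  have "filterlim (\<lambda>n. 2 powr a * (2 powr (c * real n) / real n ^ t')) at_top sequentially"
  proof (rule filterlim_tendsto_pos_mult_at_top[OF tendsto_const])
    show "filterlim (\<lambda>n. 2 powr (c * real n) / real n ^ t') at_top sequentially"
      using c by real_asymp
  qed simp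
  moreover have "eventually (\<lambda>n. 2 powr a * (2 powr (c * real n) / real n ^ t') \<le> growth t P n /
      growth t' P' n) sequentially"
    using eventually_ge_at_top[of "max (max t t') 1"] eventually_ge_at_top[of "nat \<lceil>x0\<rceil>"]
  proof eventually_elim
    case (elim n)
    hence n: "t \<le> n" "t' \<le> n" "1 \<le> n" "x0 \<le> real n" by auto
    obtain m m' :: nat where m: "mixcount t P n = 2 ^ m" "real m = poly Q (real n)"
      "mixcount t' P' n = 2 ^ m'" "real m' = poly Q' (real n)"
      using Q[OF n(1)] Q'[OF n(2)] by blast
    have "real m - real m' = poly (Q - Q') (real n)" by (simp add: m)
    also have "\<dots> = a + real n * poly E (real n)" by (simp add: E)
    also have "\<dots> \<ge> a + real n * c" using x0[OF n(4)] by (simp add: mult_left_mono)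
    finally have "a + c * real n \<le> real m - real m'" by (simp add: mult.commute)
    hence "2 powr (a + c * real n) \<le> 2 powr (real m - real m')" by simp
    hence 1: "2 powr a * 2 powr (c * real n) \<le> 2 ^ m / 2 ^ m'"
      by (simp add: powr_add powr_diff powr_realpow)
    have "fact (n - t) \<le> (fact n :: real)" by (rule fact_mono) simp
    also have "\<dots> \<le> real n ^ t' * fact (n - t')" by (rule fact_le_power_mult[OF n(2)])
    finally have 2: "1 / real n ^ t' \<le> fact (n - t') / fact (n - t)"
      using n(3) by (simp add: field_simps)
    have "2 powr a * 2 powr (c * real n) * (1 / real n ^ t') \<le> (2 ^ m / 2 ^ m') * (fact (n - t') /
        fact (n - t))"
      by (rule mult_mono[OF 1 2]) auto
    thus ?case by (simp add: growth_def m mult_ac)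
  qed
  ultimately show ?thesis by (rule filterlim_at_top_mono)
qed

text \<open>If the exponents differ by a constant, the quotient is a fixed power of 2 times (n -
  t')! / (n - t)!, and comparing \<open>t\<close> with \<open>t'\<close> decides between 0, a finite
  value and infinity. Otherwise the difference of the exponents has a leading coefficient whose sign
  decides.\<close>

lemma growth_ratio:
  assumes P: "pgroup {1..t} P" and P': "pgroup {1..t'} P'"
  shows "has_limit_in_Rats_or_infinity (\<lambda>n. growth t P n / growth t' P' n)"
proof -
  obtain Q where Q: "\<And>n. n \<ge> t \<Longrightarrow> \<exists>m::nat. mixcount t P n = 2 ^ m \<and> real m = poly Q (real n)"
    using mixcount_poly[OF P] by blast
  obtain Q' where Q': "\<And>n. n \<ge> t' \<Longrightarrow> \<exists>m::nat. mixcount t' P' n = 2 ^ m \<and> real m = poly Q' (real n)"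
    using mixcount_poly[OF P'] by blast
  have inv0: "(\<lambda>n. f n / g n) \<longlonglongrightarrow> 0" if "filterlim (\<lambda>n. g n / f n) at_top sequentially" for f g ::
      "nat \<Rightarrow> real"
    using filterlim_compose[OF tendsto_inverse_0_at_top that] tendsto_inverse_0_at_top[OF that] by simp
  consider "degree (Q - Q') = 0" | "degree (Q - Q') > 0" "lead_coeff (Q - Q') > 0"
    | "degree (Q - Q') > 0" "lead_coeff (Q - Q') < 0"
  proof -
    have "lead_coeff (Q - Q') \<noteq> 0" if "degree (Q - Q') > 0"
    proof -
      have "Q - Q' \<noteq> 0" using that by (metis degree_0 less_irrefl)
      thus ?thesis by (simp only: leading_coeff_neq_0 not_False_eq_True)
    qed
    thus ?thesis using that by (meson linorder_neqE_linordered_idom not_gr_zero)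
  qed
  thus ?thesis
  proof cases
    case 1
    then obtain d where d: "Q - Q' = [:d:]" by (rule degree_eq_zeroE)
    have ratio: "\<exists>m m'::nat. growth t P n / growth t' P' n = 2 ^ m / 2 ^ m' * (fact (n - t') /
        fact (n - t)) \<and> real m - real m' = d"
      if n: "n \<ge> max t t'" for n
    proof -
      obtain m m' :: nat where m: "mixcount t P n = 2 ^ m" "real m = poly Q (real n)"
        "mixcount t' P' n = 2 ^ m'" "real m' = poly Q' (real n)"
        using Q[of n] Q'[of n] n by auto
      have "real m - real m' = poly (Q - Q') (real n)" by (simp add: m)
      thus ?thesis using m d by (intro exI[of _ m] exI[of _ m']) (simp add: growth_def)
    qed
    define r where "r = (2::real) powr d"
    have rp: "2 ^ m / 2 ^ m' = r" if "real m - real m' = d" for m m' :: nat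
      unfolding r_def that[symmetric] by (simp add: powr_diff powr_realpow)
    have ev: "eventually (\<lambda>n. r * (fact (n - t') / fact (n - t)) = growth t P n / growth t' P' n)
        sequentially"
      using eventually_ge_at_top[of "max t t'"]
    proof eventually_elim
      case (elim n)
      obtain m m' :: nat where "growth t P n / growth t' P' n = 2 ^ m / 2 ^ m' * (fact (n - t') /
          fact (n - t))" "real m - real m' = d"
        using ratio[OF elim] by blast
      thus ?case using rp by metis
    qed
    \<comment> \<open>\<open>d\<close> is a difference of two natural numbers, so \<open>r\<close>
      is a quotient of powers of 2.\<close>
    have rQ: "r \<in> \<rat>"
    proof -
      obtain m m' :: nat where "real m - real m' = d" using ratio[of "max t t'"] by blast
      hence "r = 2 ^ m / 2 ^ m'" using rp by simp
      thus ?thesis by simp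
    qed
    have r0: "r > 0" by (simp add: r_def)
    have zero: "(\<lambda>n. fact (n - b) / fact (n - a) :: real) \<longlonglongrightarrow> 0" if "a < b" for a b :: nat
    proof (rule tendsto_sandwich[OF _ _ tendsto_const])
      show "eventually (\<lambda>n. 0 \<le> (fact (n - b) / fact (n - a) :: real)) sequentially" by simp
      show "eventually (\<lambda>n. (fact (n - b) / fact (n - a) :: real) \<le> 1 / (real n - real a)) sequentially"
        using eventually_ge_at_top[of b]
      proof eventually_elim
        case (elim n)
        have "fact (n - b) \<le> (fact (n - Suc a) :: real)" by (rule fact_mono) (use that in simp)
        moreover have "(fact (n - a) :: real) = real (n - a) * fact (n - Suc a)"
          using that elim by (subst fact_reduce) auto
        moreover have "real (n - a) = real n - real a" "real n - real a > 0" using that elim by auto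
        moreover have "fact (n - b) / fact (n - a) \<le> fact (n - Suc a) / (fact (n - a) :: real)"
          by (rule divide_right_mono) (use calculation(1) in simp_all)
        ultimately show ?case by simp
      qed
      show "(\<lambda>n. 1 / (real n - real a)) \<longlonglongrightarrow> 0" by real_asymp
    qed
    consider "t < t'" | "t = t'" | "t' < t" by linarith
    thus ?thesis
    proof cases
      case 1
      have "(\<lambda>n. r * (fact (n - t') / fact (n - t))) \<longlonglongrightarrow> 0"
        by (rule tendsto_mult_right_zero[OF zero[OF 1]])
      hence "(\<lambda>n. growth t P n / growth t' P' n) \<longlonglongrightarrow> 0" using ev by (rule Lim_transform_eventually)
      thus ?thesis unfolding has_limit_in_Rats_or_infinity_def using Rats_0 by blast
    next
      case 2
      hence "(\<lambda>n. r * (fact (n - t') / fact (n - t))) \<longlonglongrightarrow> r" by simp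
      hence "(\<lambda>n. growth t P n / growth t' P' n) \<longlonglongrightarrow> r" using ev by (rule Lim_transform_eventually)
      thus ?thesis unfolding has_limit_in_Rats_or_infinity_def using rQ by blast
    next
      case 3
      have "filterlim (\<lambda>n. fact (n - t') / fact (n - t) :: real) at_top sequentially"
      proof -
        have "filterlim (\<lambda>n. inverse (fact (n - t) / fact (n - t') :: real)) at_top sequentially"
          by (rule filterlim_inverse_at_top[OF zero[OF 3]]) simp
        thus ?thesis by simp
      qed
      hence "filterlim (\<lambda>n. r * (fact (n - t') / fact (n - t))) at_top sequentially"
        by (rule filterlim_tendsto_pos_mult_at_top[OF tendsto_const r0])
      hence "filterlim (\<lambda>n. growth t P n / growth t' P' n) at_top sequentially"
        using filterlim_cong[OF refl refl ev] by blast
      thus ?thesis unfolding has_limit_in_Rats_or_infinity_def by blast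
    qed
  next
    case 2
    thus ?thesis unfolding has_limit_in_Rats_or_infinity_def using growth_ratio_at_top[OF Q Q'] by blast
  next
    case 3
    have "degree (Q' - Q) = degree (Q - Q')" "lead_coeff (Q' - Q) = - lead_coeff (Q - Q')"
      using degree_minus[of "Q - Q'"] lead_coeff_minus[of "Q - Q'"] by simp_all
    hence "filterlim (\<lambda>n. growth t' P' n / growth t P n) at_top sequentially"
      using 3 growth_ratio_at_top[OF Q' Q] by simp
    hence "(\<lambda>n. growth t P n / growth t' P' n) \<longlonglongrightarrow> 0" by (rule inv0)
    thus ?thesis unfolding has_limit_in_Rats_or_infinity_def using Rats_0 by blast
  qed
qed

lemma growth_self: "growth t P n / growth t P n = 1"
  using growth_pos[of t P n] by simp

text \<open>By \<open>growth_ratio\<close> growth rates are pairwise comparable, so a finite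
  nonempty family has a maximal one. When a new element takes over, all former quotients tend to
  0.\<close>

lemma exists_dominating:
  assumes "finite F" "F \<noteq> {}" "\<And>t P. (t, P) \<in> F \<Longrightarrow> pgroup {1..t} P"
  shows "\<exists>(t', P')\<in>F. \<forall>(t, P)\<in>F. \<exists>q\<in>\<rat>. (\<lambda>n. growth t P n / growth t' P' n) \<longlonglongrightarrow> q"
  using assms
proof (induction F rule: finite_ne_induct)
  case (singleton x)
  obtain t P where x: "x = (t, P)" by (cases x)
  have "(\<lambda>n. growth t P n / growth t P n) \<longlonglongrightarrow> 1" by (simp only: growth_self tendsto_const)
  thus ?case using x Rats_1 by blast
next
  case (insert x F)
  obtain t P where x: "x = (t, P)" by (cases x)
  obtain t' P' where d: "(t', P') \<in> F" "\<And>s R. (s, R) \<in> F \<Longrightarrow> \<exists>q\<in>\<rat>. (\<lambda>n. growth s R n / growth t' P' n) \<longlonglongrightarrow> q"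
    using insert.IH insert.prems by fast
  have groups: "pgroup {1..t} P" "pgroup {1..t'} P'" using insert.prems x d(1) by auto
  have self: "(\<lambda>n. growth t P n / growth t P n) \<longlonglongrightarrow> 1"
    by (simp only: growth_self tendsto_const)
  consider q where "q \<in> \<rat>" "(\<lambda>n. growth t P n / growth t' P' n) \<longlonglongrightarrow> q"
    | "filterlim (\<lambda>n. growth t P n / growth t' P' n) at_top sequentially"
    using growth_ratio[OF groups] unfolding has_limit_in_Rats_or_infinity_def by blast
  thus ?case
  proof cases
    case 1
    have "\<exists>q\<in>\<rat>. (\<lambda>n. growth s R n / growth t' P' n) \<longlonglongrightarrow> q" if "(s, R) \<in> insert x F" for s R
      using that 1 d(2) x by auto
    thus ?thesis using d(1) by blast
  next
    case 2
    have z: "(\<lambda>n. growth t' P' n / growth t P n) \<longlonglongrightarrow> 0"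
      using tendsto_inverse_0_at_top[OF 2] by simp
    have "\<exists>q\<in>\<rat>. (\<lambda>n. growth s R n / growth t P n) \<longlonglongrightarrow> q" if sR: "(s, R) \<in> insert x F" for s R
    proof (cases "(s, R) = x")
      case True
      thus ?thesis using self x Rats_1 by blast
    next
      case False
      then obtain q where "(\<lambda>n. growth s R n / growth t' P' n) \<longlonglongrightarrow> q" using sR d(2) by blast
      hence "(\<lambda>n. growth s R n / growth t' P' n * (growth t' P' n / growth t P n)) \<longlonglongrightarrow> q * 0"
        using z by (rule tendsto_mult)
      moreover have "growth s R n / growth t' P' n * (growth t' P' n / growth t P n) = growth s R
          n / growth t P n" for n
        using growth_pos[of t' P' n] by simp
      ultimately have "(\<lambda>n. growth s R n / growth t P n) \<longlonglongrightarrow> 0" by (simp only: mult_zero_right)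
      thus ?thesis using Rats_0 by blast
    qed
    thus ?thesis using x by blast
  qed
qed

end

section \<open>Classes defined by the automorphism group\<close>

definition perm_monoid :: "('a \<Rightarrow> 'a) set \<Rightarrow> ('a \<Rightarrow> 'a) monoid" where
  "perm_monoid P = \<lparr>carrier = P, mult = (\<circ>), one = id\<rparr>"

lemma perm_monoid_simps [simp]: "carrier (perm_monoid P) = P" "mult (perm_monoid P) = (\<circ>)" "one
    (perm_monoid P) = id"
  "(perm_monoid P)\<lparr>carrier := K\<rparr> = perm_monoid K"
  by (simp_all add: perm_monoid_def)

lemma Sym_perm_monoid: "Sym \<Omega> = perm_monoid {f. f permutes \<Omega>}"
  by (simp add: Sym_def perm_monoid_def)

lemma group_perm_monoid:
  assumes "pgroup S P" shows "group (perm_monoid P)"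
proof (rule groupI)
  fix p assume p: "p \<in> carrier (perm_monoid P)"
  hence "invf p \<in> P" "invf p \<circ> p = id"
    using pgroup_inv[OF assms] permutes_inv_o(2)[OF pgroup_permutes[OF assms]] by simp_all
  thus "\<exists>q\<in>carrier (perm_monoid P). q \<otimes>\<^bsub>perm_monoid P\<^esub> p = \<one>\<^bsub>perm_monoid P\<^esub>" by auto
qed (use assms in \<open>simp_all add: pgroup_comp pgroup_id o_assoc\<close>)

lemma m_inv_perm_monoid:
  assumes "pgroup S P" "p \<in> P" shows "inv\<^bsub>perm_monoid P\<^esub> p = invf p"
  by (rule group.inv_equality[OF group_perm_monoid[OF assms(1)]])
     (use assms pgroup_inv[OF assms] permutes_inv_o(2)[OF pgroup_permutes[OF assms]] in simp_all)

lemma perm_monoid_conj: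
  assumes f: "f permutes S"
  shows "(\<lambda>p. f \<circ> p \<circ> invf f) \<in> iso (perm_monoid P) (perm_monoid ((\<lambda>p. f \<circ> p \<circ> invf f) ` P))"
proof -
  have "f \<circ> (p \<circ> q) \<circ> invf f = f \<circ> p \<circ> invf f \<circ> (f \<circ> q \<circ> invf f)" for p q
    using permutes_inv_o(2)[OF f] by (metis comp_assoc comp_id)
  moreover have "inj_on (\<lambda>p. f \<circ> p \<circ> invf f) P"
  proof (rule inj_on_inverseI)
    fix p show "invf f \<circ> (f \<circ> p \<circ> invf f) \<circ> f = p"
      using permutes_inv_o[OF f] by (metis comp_assoc comp_id id_comp)
  qed
  ultimately show ?thesis by (auto simp: iso_def hom_def bij_betw_def)
qed

lemma pgroup_conj:
  assumes P: "pgroup S P" and f: "f permutes S"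
  shows "pgroup S ((\<lambda>p. f \<circ> p \<circ> invf f) ` P)"
proof -
  let ?c = "\<lambda>p. f \<circ> p \<circ> invf f"
  have comp: "?c p \<circ> ?c q = ?c (p \<circ> q)" for p q
    using permutes_inv_o(2)[OF f] by (metis comp_assoc comp_id)
  have perm: "?c p permutes S" if "p \<in> P" for p
    using pgroup_permutes[OF P that] f by (intro permutes_compose permutes_inv)
  have id: "?c id = id" using permutes_inv_o(1)[OF f] by simp
  have inv: "invf (?c p) = ?c (invf p)" if "p \<in> P" for p
  proof (rule inv_unique_comp)
    show "?c p \<circ> ?c (invf p) = id" "?c (invf p) \<circ> ?c p = id"
      unfolding comp permutes_inv_o[OF pgroup_permutes[OF P that]] by (rule id)+
  qed
  show ?thesis unfolding pgroup_def
  proof (intro conjI ballI)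
    show "id \<in> ?c ` P" using imageI[OF pgroup_id[OF P], of ?c] unfolding id .
    fix p' assume "p' \<in> ?c ` P"
    then obtain p where p: "p' = ?c p" "p \<in> P" by (rule imageE)
    show "p' permutes S" unfolding p(1) by (rule perm[OF p(2)])
    show "invf p' \<in> ?c ` P" unfolding p(1) inv[OF p(2)] by (rule imageI[OF pgroup_inv[OF P p(2)]])
    fix q' assume "q' \<in> ?c ` P"
    then obtain q where q: "q' = ?c q" "q \<in> P" by (rule imageE)
    show "p' \<circ> q' \<in> ?c ` P" unfolding p(1) q(1) comp by (rule imageI[OF pgroup_comp[OF P p(2) q(2)]])
  qed
qed

lemma isomorphic_conj:
  assumes "f permutes S" "G \<cong> perm_monoid P" shows "G \<cong> perm_monoid ((\<lambda>p. f \<circ> p \<circ> invf f) ` P)"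
  using iso_trans[OF assms(2)] perm_monoid_conj[OF assms(1)] by (auto simp: is_iso_def)

lemma embeds_conj:
  assumes f: "f permutes S" and P: "pgroup S P" and G: "embeds_in G (perm_monoid P)"
  shows "embeds_in G (perm_monoid ((\<lambda>p. f \<circ> p \<circ> invf f) ` P))"
proof -
  let ?c = "\<lambda>p. f \<circ> p \<circ> invf f"
  obtain K where K: "subgroup K (perm_monoid P)" "G \<cong> perm_monoid K" using G by (auto simp:
      embeds_in_def)
  interpret group_hom "perm_monoid P" "perm_monoid (?c ` P)" ?c
    by (rule group_hom.intro[OF group_perm_monoid[OF P] group_perm_monoid[OF pgroup_conj[OF P f]]])
       (use perm_monoid_conj[OF f, of P] in \<open>simp add: group_hom_axioms_def iso_def\<close>)
  have "subgroup (?c ` K) (perm_monoid (?c ` P))" by (rule subgroup_img_is_subgroup[OF K(1)])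
  moreover have "G \<cong> perm_monoid (?c ` K)" by (rule isomorphic_conj[OF f K(2)])
  ultimately show ?thesis by (auto simp: embeds_in_def)
qed

text \<open>Every point fixed by \<open>f\<close> is fixed by all that \<open>f\<close> generates,
  so the passage to the generated group adds no moved points.\<close>

lemma spt_perms_single:
  assumes f: "f permutes \<Omega>"
  shows "spt_perms \<Omega> {f} = card {a. f a \<noteq> a}"
proof -
  have gen: "g a = a" if "g \<in> generate (Sym \<Omega>) {f}" "f a = a" for g a
    using that(1)
  proof (induction g rule: generate.induct)
    case (inv h)
    have "inv\<^bsub>Sym \<Omega>\<^esub> h = invf f"
      using inv f m_inv_perm_monoid[OF pgroup_sym, of f] by (simp add: Sym_perm_monoid)
    thus ?case using that(2) permutes_inv_eq[OF f] by simp
  qed (use that(2) in \<open>simp_all add: Sym_perm_monoid\<close>)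
  have "{a \<in> \<Omega>. \<exists>g \<in> generate (Sym \<Omega>) {f}. g a \<noteq> a} = {a. f a \<noteq> a}"
  proof
    show "{a \<in> \<Omega>. \<exists>g \<in> generate (Sym \<Omega>) {f}. g a \<noteq> a} \<subseteq> {a. f a \<noteq> a}" using gen by blast
    show "{a. f a \<noteq> a} \<subseteq> {a \<in> \<Omega>. \<exists>g \<in> generate (Sym \<Omega>) {f}. g a \<noteq> a}"
      using permutes_not_in[OF f] generate.incl[of f "{f}" "Sym \<Omega>"] by blast
  qed
  thus ?thesis by (simp add: spt_perms_def)
qed

definition max_supp :: "('a \<Rightarrow> 'a) set \<Rightarrow> nat" where
  "max_supp P = Max ((\<lambda>p. card {a. p a \<noteq> a}) ` P)"

lemma max_supp_conj:
  assumes f: "f permutes S"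
  shows "max_supp ((\<lambda>p. f \<circ> p \<circ> invf f) ` P) = max_supp P"
proof -
  have "card {a. (f \<circ> p \<circ> invf f) a \<noteq> a} = card {a. p a \<noteq> a}" for p
  proof -
    have "{a. (f \<circ> p \<circ> invf f) a \<noteq> a} = f ` {a. p a \<noteq> a}"
      using supp_conj[OF f, of "{p}"] by (simp add: supp_def)
    thus ?thesis using card_image[of f] permutes_inj_on[OF f] by metis
  qed
  thus ?thesis by (simp add: max_supp_def image_image)
qed

lemma card_supp_conj:
  assumes f: "f permutes S"
  shows "card (supp ((\<lambda>p. f \<circ> p \<circ> invf f) ` P)) = card (supp P)"
  unfolding supp_conj[OF f] by (rule card_image[OF permutes_inj_on[OF f]])

text \<open>Conjugation is the effect of relabelling on automorphism groups, so this yields the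
  closure under relabelling that \<open>class_count\<close> needs. The guard
  \<open>pgroup {1..n} P\<close> is there for embeddability, where conjugation must be a group
  homomorphism.\<close>

definition conj_closed :: "(nat \<Rightarrow> nat) set set \<Rightarrow> bool" where
  "conj_closed \<P> \<longleftrightarrow> (\<forall>n P f. P \<in> \<P> \<longrightarrow> pgroup {1..n} P \<longrightarrow> f permutes {1..n} \<longrightarrow>
     (\<lambda>p. f \<circ> p \<circ> invf f) ` P \<in> \<P>)"

lemma sat_relabel:
  assumes f: "f permutes {1..n}"
  shows "sat (mk_struct n (lact f ` A)) (f \<circ> e) \<phi> \<longleftrightarrow> sat (mk_struct n A) e \<phi>"
proof (induction \<phi> arbitrary: e)
  case (Rel i vs)
  have "(i, map (f \<circ> e) vs) = lact f (i, map e vs)" by simp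
  thus ?case using inj_image_mem_iff[OF lact_inj[OF permutes_inj[OF f]]]
    by (simp only: sat.simps mk_struct_simps)
next
  case (Eq x y)
  show ?case using permutes_inj[OF f] by (simp add: inj_eq)
next
  case (Forall x \<phi>)
  have upd: "(f \<circ> e)(x := f a) = f \<circ> e(x := a)" for a by auto
  have "(\<forall>b\<in>{1..n}. sat (mk_struct n (lact f ` A)) ((f \<circ> e)(x := b)) \<phi>) \<longleftrightarrow>
      (\<forall>b\<in>f ` {1..n}. sat (mk_struct n (lact f ` A)) ((f \<circ> e)(x := b)) \<phi>)"
    using permutes_image[OF f] by simp
  also have "\<dots> \<longleftrightarrow> (\<forall>a\<in>{1..n}. sat (mk_struct n (lact f ` A)) (f \<circ> e(x := a)) \<phi>)"
    by (simp only: ball_simps upd)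
  finally show ?case using Forall.IH by (simp only: sat.simps mk_struct_simps)
qed simp_all

lemma models_relabel:
  assumes f: "f permutes {1..n}" and m: "models (mk_struct n A) \<phi>"
  shows "models (mk_struct n (lact f ` A)) \<phi>"
  unfolding models_def
proof (intro allI impI)
  fix e :: "nat \<Rightarrow> nat" assume e: "range e \<subseteq> univ (mk_struct n (lact f ` A))"
  have "range (invf f \<circ> e) \<subseteq> {1..n}"
    using e permutes_in_image[OF permutes_inv[OF f]] by auto
  hence "sat (mk_struct n A) (invf f \<circ> e) \<phi>" using m by (simp add: models_def)
  moreover have "f \<circ> (invf f \<circ> e) = e" using permutes_inv_o(1)[OF f] by (simp add: o_assoc)
  ultimately show "sat (mk_struct n (lact f ` A)) e \<phi>" using sat_relabel[OF f, of A "invf f \<circ> e"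
      \<phi>] by simp
qed

section \<open>Class counts as sums over permutation groups\<close>

context vocabulary
begin

definition aut_class :: "(nat \<Rightarrow> nat) set set \<Rightarrow> nat \<Rightarrow> ('i \<times> nat list) set set" where
  "aut_class \<P> n = {A \<in> Pow (tup n). autg n A \<in> \<P>}"

definition num_classes :: "nat \<Rightarrow> ('i \<times> nat list) set set \<Rightarrow> real" where
  "num_classes n X = real (card (iso_classes ar (mk_struct n ` X)))"

text \<open>A tautology, so that the whole class is an instance of \<open>sat_class\<close> and
  denominators are covered by the same formula as numerators.\<close>

definition true_form :: "'i form" where "true_form = Forall 0 (Eq 0 0)"

lemma models_true_form: "models M true_form" by (simp add: models_def true_form_def)

definition sat_class :: "(nat \<Rightarrow> nat) set set \<Rightarrow> 'i form \<Rightarrow> nat \<Rightarrow> ('i \<times> nat list) set set" where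
  "sat_class \<P> \<phi> n = {A \<in> aut_class \<P> n. models (mk_struct n A) \<phi>}"

lemma sat_class_true: "sat_class \<P> true_form n = aut_class \<P> n"
  by (simp add: sat_class_def models_true_form)

lemma sat_class_count:
  assumes \<P>: "conj_closed \<P>" and n: "n \<ge> 1"
  shows "num_classes n (sat_class \<P> \<phi> n) = (\<Sum>t\<le>n. \<Sum>P\<in>full_groups t \<inter> \<P>. real (card P) *
     real (card (exact n P \<phi>)) / (fact t * fact (n - t)))"
proof -
  have closed: "lact f ` A \<in> sat_class \<P> \<phi> n" if f: "f permutes {1..n}" and A: "A \<in> sat_class \<P> \<phi>
      n" for f A
  proof -
    have A': "A \<subseteq> tup n" "autg n A \<in> \<P>" "models (mk_struct n A) \<phi>" using A by (auto simp:
        sat_class_def aut_class_def)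
    have "lact f ` A \<subseteq> tup n" using A'(1) lact_tup[OF f] by blast
    moreover have "autg n (lact f ` A) \<in> \<P>"
      unfolding autg_conj[OF f] using \<P> A'(2) pgroup_autg f unfolding conj_closed_def by blast
    ultimately show ?thesis using models_relabel[OF f A'(3)] by (simp add: sat_class_def aut_class_def)
  qed
  have "num_classes n (sat_class \<P> \<phi> n) = (\<Sum>t\<le>n. (\<Sum>P\<in>full_groups t. real (card P) * real (card
      {A\<in>sat_class \<P> \<phi> n. autg n A = P})) /
       (fact t * fact (n - t)))"
    unfolding num_classes_def by (rule class_count[OF _ n closed]) (auto simp: sat_class_def
        aut_class_def)
  also have "\<dots> = (\<Sum>t\<le>n. (\<Sum>P\<in>full_groups t \<inter> \<P>. real (card P) *
     real (card (exact n P \<phi>))) / (fact t * fact (n - t)))"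
  proof (rule sum.cong[OF refl])
    fix t assume "t \<in> {..n}"
    have "(\<Sum>P\<in>full_groups t. real (card P) * real (card {A\<in>sat_class \<P> \<phi> n. autg n A = P})) =
      (\<Sum>P\<in>full_groups t \<inter> \<P>. real (card P) * real (card {A\<in>sat_class \<P> \<phi> n. autg n A = P}))"
    proof (rule sum.mono_neutral_right[OF finite_full_groups])
      show "\<forall>P\<in>full_groups t - full_groups t \<inter> \<P>. real (card P) * real (card {A \<in> sat_class \<P> \<phi> n.
          autg n A = P}) = 0"
      proof
        fix P assume "P \<in> full_groups t - full_groups t \<inter> \<P>"
        hence "{A \<in> sat_class \<P> \<phi> n. autg n A = P} = {}" by (auto simp: sat_class_def aut_class_def)
        thus "real (card P) * real (card {A \<in> sat_class \<P> \<phi> n. autg n A = P}) = 0" by (simp only: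
            card.empty)
      qed
    qed auto
    also have "\<dots> = (\<Sum>P\<in>full_groups t \<inter> \<P>. real (card P) *
      real (card (exact n P \<phi>)))"
    proof (rule sum.cong[OF refl])
      fix P assume "P \<in> full_groups t \<inter> \<P>"
      hence "{A\<in>sat_class \<P> \<phi> n. autg n A = P} = exact n P \<phi>"
        by (auto simp: sat_class_def aut_class_def)
      thus "real (card P) * real (card {A\<in>sat_class \<P> \<phi> n. autg n A = P}) = real (card P) *
        real (card (exact n P \<phi>))" by (simp only:)
    qed
    finally show "(\<Sum>P\<in>full_groups t. real (card P) * real (card {A\<in>sat_class \<P> \<phi> n. autg n A =
        P})) / (fact t * fact (n - t)) =
      (\<Sum>P\<in>full_groups t \<inter> \<P>. real (card P) *
      real (card (exact n P \<phi>))) / (fact t * fact (n - t))"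
      by (rule arg_cong)
  qed
  finally show ?thesis by (simp only: sum_divide_distrib)
qed

text \<open>Used in contrapositive form, to drop groups with empty \<open>base\<close> from the
  sums.\<close>

lemma base_nonempty:
  assumes "pgroup {1..t} P" "t \<le> n" "A \<in> Pow (tup n)" "autg n A = P"
  shows "base t P \<noteq> {}"
  using autg_base(2)[OF assms(1,2)] assms(3,4) by auto

text \<open>\<open>group_limit\<close> gives only an unspecified integer, possibly 0. The exact
  value here makes the limit for the whole class positive, so that it can be divided by.\<close>

lemma group_limit_all:
  assumes P: "pgroup {1..t} P"
  shows "(\<lambda>n. real (card (exact n P true_form)) / real (mixcount t P n))
    \<longlonglongrightarrow> real (card (base t P))"
proof -
  have "(\<lambda>n. \<Sum>A0\<in>base t P. 1 - real (card (extra_aut t P A0 n)) / real (mixcount t P n))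
     \<longlonglongrightarrow> (\<Sum>A0\<in>base t P. 1 - 0)"
    by (intro tendsto_sum tendsto_diff tendsto_const bad_ratio[OF P])
  moreover have "eventually (\<lambda>n. (\<Sum>A0\<in>base t P. 1 - real (card (extra_aut t P A0 n)) / real
      (mixcount t P n))
     = real (card (exact n P true_form)) / real (mixcount t P n)) sequentially"
    using eventually_ge_at_top[of t]
  proof eventually_elim
    case (elim n)
    have "1 - real (card (extra_aut t P A0 n)) / real (mixcount t P n) =
      real (card {R \<in> invs P (mix t n). autg n (A0 \<union> R) = P}) / real (mixcount t P n)" for A0
    proof -
      have "mixcount t P n = card {R \<in> invs P (mix t n). autg n (A0 \<union> R) = P} + card (extra_aut t
          P A0 n)"
        unfolding mixcount_def by (rule card_split[OF finite_invs[OF finite_mix]])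
      hence "real (mixcount t P n) = real (card {R \<in> invs P (mix t n). autg n (A0 \<union> R) = P}) +
          real (card (extra_aut t P A0 n))"
        by (simp only: of_nat_add)
      thus ?thesis using mixcount_pos[of t P n] by (simp add: field_simps)
    qed
    thus ?case using count_by_base[OF P elim, of "\<lambda>A. models (mk_struct n A) true_form"]
      by (simp add: sum_divide_distrib models_true_form)
  qed
  ultimately have "(\<lambda>n. real (card (exact n P true_form)) / real (mixcount t P n))
    \<longlonglongrightarrow> (\<Sum>A0\<in>base t P. 1 - 0)" by (rule Lim_transform_eventually)
  thus ?thesis by simp
qed

text \<open>\<open>card P \<le> t!\<close> cancels the factor 1 / t!, and for fixed \<open>t\<close>
  structures with different groups are different members of \<open>supp_class n t\<close>.\<close>

lemma tail_limit:
  assumes g: "\<And>n. g n > (0::real)"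
    and tail: "(\<lambda>n. (\<Sum>t=T..n. real (card (supp_class n t)) / fact (n - t)) / g n) \<longlonglongrightarrow> 0"
  shows "(\<lambda>n. (\<Sum>t=T..n. \<Sum>P\<in>full_groups t \<inter> \<P>. real (card P) *
     real (card (exact n P \<phi>)) / (fact t * fact (n - t))) / g n) \<longlonglongrightarrow> 0"
proof (rule tendsto_sandwich[OF _ _ tendsto_const tail])
  let ?c = "\<lambda>n P. card (exact n P \<phi>)"
  show "eventually (\<lambda>n. 0 \<le> (\<Sum>t=T..n. \<Sum>P\<in>full_groups t \<inter> \<P>. real (card P) * real (?c n P) / (fact
      t * fact (n - t))) / g n) sequentially"
    by (intro always_eventually allI divide_nonneg_nonneg sum_nonneg less_imp_le[OF g]) auto
  have "(\<Sum>P\<in>full_groups t \<inter> \<P>. real (card P) * real (?c n P) / (fact t * fact (n - t)))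
      \<le> real (card (supp_class n t)) / fact (n - t)" for t n
  proof -
    have "(\<Sum>P\<in>full_groups t \<inter> \<P>. real (card P) * real (?c n P) / (fact t * fact (n - t)))
       \<le> (\<Sum>P\<in>full_groups t \<inter> \<P>. real (?c n P) / fact (n - t))"
    proof (rule sum_mono)
      fix P assume "P \<in> full_groups t \<inter> \<P>"
      hence "P \<subseteq> {p. p permutes {1..t}}" by (auto simp: full_groups_def dest: pgroup_permutes)
      hence "card P \<le> card {p. p permutes {1..t}}" by (rule card_mono[rotated]) (simp add:
          finite_permutations)
      also have "\<dots> = fact t" by (simp add: card_permutations)
      finally have "real (card P) \<le> fact t"
        unfolding of_nat_fact[symmetric, where 'a = real] of_nat_le_iff .
      hence "real (card P) / fact t \<le> 1" by simp
      hence "real (card P) / fact t * (real (?c n P) / fact (n - t)) \<le> 1 * (real (?c n P) / fact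
          (n - t))"
        by (rule mult_right_mono) simp
      thus "real (card P) * real (?c n P) / (fact t * fact (n - t)) \<le> real (?c n P) / fact (n -
          t)" by simp
    qed
    also have "\<dots> = real (\<Sum>P\<in>full_groups t \<inter> \<P>. ?c n P) / fact (n - t)"
      by (simp add: sum_divide_distrib)
    also have "\<dots> \<le> real (card (supp_class n t)) / fact (n - t)"
    proof (intro divide_right_mono of_nat_mono)
      have "(\<Sum>P\<in>full_groups t \<inter> \<P>. ?c n P) = card (\<Union>P\<in>full_groups t \<inter> \<P>. (exact n P \<phi>))"
        by (rule card_UN_disjoint[symmetric]) (auto simp: finite_full_groups finite_tup)
      also have "\<dots> \<le> card (supp_class n t)"
        by (rule card_mono) (auto simp: finite_tup full_groups_def)
      finally show "(\<Sum>P\<in>full_groups t \<inter> \<P>. ?c n P) \<le> card (supp_class n t)" .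
    qed simp
    finally show ?thesis .
  qed
  thus "eventually (\<lambda>n. (\<Sum>t=T..n. \<Sum>P\<in>full_groups t \<inter> \<P>. real (card P) * real (?c n P) / (fact t *
      fact (n - t))) / g n
      \<le> (\<Sum>t=T..n. real (card (supp_class n t)) / fact (n - t)) / g n) sequentially"
    by (intro always_eventually allI divide_right_mono sum_mono less_imp_le[OF g])
qed

text \<open>Every class defined by the automorphism group is dominated by the contribution of finitely
  many permutation groups, and hence has the order of magnitude of a single one of them.\<close>
lemma class_asymptotics:
  assumes \<P>: "conj_closed \<P>"
  shows "(\<forall>n\<ge>1. \<forall>\<phi>. num_classes n (sat_class \<P> \<phi> n) = 0) \<or>
    (\<exists>t P c L. pgroup {1..t} P \<and> c \<in> \<rat> \<and> c > 0 \<and> (\<lambda>n. num_classes n (aut_class \<P> n) / growth t P n) \<longlonglongrightarrow> c \<and>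
      finite L \<and> L \<subseteq> \<rat> \<and>
      (\<forall>\<phi>. is_sentence ar \<phi> \<longrightarrow> (\<exists>a\<in>L. (\<lambda>n. num_classes n (sat_class \<P> \<phi> n) / growth t P n) \<longlonglongrightarrow> a)))"
proof (cases "\<exists>t. \<exists>P\<in>full_groups t \<inter> \<P>. base t P \<noteq> {}")
  case False
  have "num_classes n (sat_class \<P> \<phi> n) = 0" if n: "n \<ge> 1" for n \<phi>
  proof -
    show ?thesis unfolding sat_class_count[OF \<P> n]
    proof (intro sum.neutral ballI)
      fix t P assume tP: "t \<in> {..n}" "P \<in> full_groups t \<inter> \<P>"
      have empty: "(exact n P \<phi>) = {}"
        using base_nonempty[of t P n] False tP by (auto simp: full_groups_def)
      show "real (card P) * real (card (exact n P \<phi>)) / (fact t * fact (n - t)) = 0"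
        by (simp only: empty card.empty of_nat_0 mult_zero_right div_0)
    qed
  qed
  thus ?thesis by blast
next
  case True
  then obtain t0 P0 where P0: "P0 \<in> full_groups t0 \<inter> \<P>" "base t0 P0 \<noteq> {}" by blast
  have pg: "pgroup {1..t} P" if "P \<in> full_groups t \<inter> \<P>" for t P using that by (simp add: full_groups_def)
  \<comment> \<open>Any group that occurs serves as a yardstick against which the large supports are
    negligible.\<close>
  obtain T where T: "T > t0" "(\<lambda>n. (\<Sum>t=T..n. real (card (supp_class n t)) / fact (n - t)) / growth
      t0 P0 n) \<longlonglongrightarrow> 0"
    using tail_negligible[OF pgroup_permutes[OF pg[OF P0(1)]]] by blast
  define F where "F = {(t, P). t < T \<and> P \<in> full_groups t \<inter> \<P> \<and> base t P \<noteq> {}}"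
  have finF: "finite F"
    by (rule finite_subset[of _ "SIGMA t:{..<T}. full_groups t"]) (auto simp: F_def finite_full_groups)
  have F0: "(t0, P0) \<in> F" using P0 T(1) by (simp add: F_def)
  have pgF: "pgroup {1..t} P" if "(t, P) \<in> F" for t P using that pg by (simp add: F_def)
  \<comment> \<open>All contributions are now measured by the growth of the largest one, so their
    limits are finite and rational.\<close>
  obtain t' P' where d: "(t', P') \<in> F" "\<forall>(t, P)\<in>F. \<exists>q\<in>\<rat>. (\<lambda>n. growth t P n / growth t' P' n) \<longlonglongrightarrow> q"
    using exists_dominating[OF finF _ pgF] F0 by blast
  have "\<forall>x\<in>F. \<exists>q. q \<in> \<rat> \<and> (\<lambda>n. growth (fst x) (snd x) n / growth t' P' n) \<longlonglongrightarrow> q"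
    using d(2) unfolding case_prod_unfold by blast
  from bchoice[OF this] obtain q where
    q: "\<forall>x\<in>F. q x \<in> \<rat> \<and> (\<lambda>n. growth (fst x) (snd x) n / growth t' P' n) \<longlonglongrightarrow> q x" ..
  define g where "g = growth t' P'"
  have gpos: "g n > 0" for n using growth_pos by (simp add: g_def)
  have q_nonneg: "q x \<ge> 0" if "x \<in> F" for x
  proof (rule tendsto_lowerbound)
    show "(\<lambda>n. growth (fst x) (snd x) n / growth t' P' n) \<longlonglongrightarrow> q x" using q that by blast
    show "eventually (\<lambda>n. 0 \<le> growth (fst x) (snd x) n / growth t' P' n) sequentially"
      by (intro always_eventually allI divide_nonneg_nonneg less_imp_le[OF growth_pos])
  qed simp
  have q_self: "q (t', P') = 1"
  proof (rule LIMSEQ_unique)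
    show "(\<lambda>n. growth t' P' n / growth t' P' n) \<longlonglongrightarrow> q (t', P')" using q d(1) by force
    show "(\<lambda>n. growth t' P' n / growth t' P' n) \<longlonglongrightarrow> 1" by (simp only: growth_self tendsto_const)
  qed
  \<comment> \<open>The factor \<open>|P| / t!\<close> is the constant part of the weight in
    \<open>class_count\<close>; \<open>q x\<close> compares the growth of \<open>x\<close> with the
    dominating one.\<close>
  define w where "w = (\<lambda>x. real (card (snd x)) / fact (fst x) * q x)"
  have wQ: "w x \<in> \<rat>" if "x \<in> F" for x
  proof -
    have "(fact k :: real) \<in> \<rat>" for k using Rats_of_nat[of "fact k"] by simp
    thus ?thesis using q that by (auto simp: w_def)
  qed
  let ?cnt = "\<lambda>\<phi> n P. real (card (exact n P \<phi>))"
  \<comment> \<open>The tail was bounded relative to \<open>P0\<close>, whose growth relative to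
    \<open>g\<close> has a finite limit.\<close>
  have tail0: "(\<lambda>n. (\<Sum>t=T..n. real (card (supp_class n t)) / fact (n - t)) / g n) \<longlonglongrightarrow> 0"
  proof -
    have "(\<lambda>n. growth t0 P0 n / g n) \<longlonglongrightarrow> q (t0, P0)" using q F0 unfolding g_def by force
    from tendsto_mult[OF T(2) this]
    have "(\<lambda>n. (\<Sum>t=T..n. real (card (supp_class n t)) / fact (n - t)) / growth t0 P0 n * (growth
        t0 P0 n / g n)) \<longlonglongrightarrow> 0"
      by (simp only: mult_zero_left)
    moreover have "s / growth t0 P0 n * (growth t0 P0 n / g n) = s / g n" for s n using
        growth_pos[of t0 P0 n] by simp
    ultimately show ?thesis by (simp only:)
  qed
  have lim: "(\<lambda>n. num_classes n (sat_class \<P> \<phi> n) / g n) \<longlonglongrightarrow> (\<Sum>x\<in>F. w x * real (b x))"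
    if b: "\<And>x. x \<in> F \<Longrightarrow> (\<lambda>n. ?cnt \<phi> n (snd x) / real (mixcount (fst x) (snd x) n)) \<longlonglongrightarrow> real (b x)" for \<phi> b
  proof -
    define tl where "tl = (\<lambda>n. (\<Sum>t=T..n. \<Sum>P\<in>full_groups t \<inter> \<P>. real (card P) * ?cnt \<phi> n P / (fact
        t * fact (n - t))) / g n)"
    have tl0: "tl \<longlonglongrightarrow> 0" unfolding tl_def by (rule tail_limit[OF gpos tail0])
    have main: "(\<lambda>n. \<Sum>x\<in>F. real (card (snd x)) / fact (fst x) * (?cnt \<phi> n (snd x) / real (mixcount
        (fst x) (snd x) n)) * (growth (fst x) (snd x) n / g n))
       \<longlonglongrightarrow> (\<Sum>x\<in>F. real (card (snd x)) / fact (fst x) * real (b x) * q x)"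
      unfolding g_def by (intro tendsto_sum tendsto_mult tendsto_const b) (use q in auto)
    have "eventually (\<lambda>n. (\<Sum>x\<in>F. real (card (snd x)) / fact (fst x) * (?cnt \<phi> n (snd x) / real
        (mixcount (fst x) (snd x) n)) * (growth (fst x) (snd x) n / g n)) + tl n
       = num_classes n (sat_class \<P> \<phi> n) / g n) sequentially"
      using eventually_ge_at_top[of "max 1 T"]
    proof eventually_elim
      case (elim n)
      hence n: "1 \<le> n" "T \<le> n" by auto
      let ?h = "\<lambda>t P. real (card P) * ?cnt \<phi> n P / (fact t * fact (n - t))"
      have split: "{..n} = {..<T} \<union> {T..n}" using n by auto
      have "num_classes n (sat_class \<P> \<phi> n) = (\<Sum>t<T. \<Sum>P\<in>full_groups t \<inter> \<P>. ?h t P) + (\<Sum>t=T..n.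
          \<Sum>P\<in>full_groups t \<inter> \<P>. ?h t P)"
        unfolding sat_class_count[OF \<P> n(1)] split by (rule sum.union_disjoint) auto
      also have "(\<Sum>t<T. \<Sum>P\<in>full_groups t \<inter> \<P>. ?h t P) = (\<Sum>x\<in>(SIGMA t:{..<T}. full_groups t \<inter> \<P>).
          ?h (fst x) (snd x))"
        by (subst sum.Sigma) (auto simp: finite_full_groups case_prod_unfold)
      also have "\<dots> = (\<Sum>x\<in>F. ?h (fst x) (snd x))"
      proof (rule sum.mono_neutral_right)
        show "\<forall>x\<in>(SIGMA t:{..<T}. full_groups t \<inter> \<P>) - F. ?h (fst x) (snd x) = 0"
        proof
          fix x assume x: "x \<in> (SIGMA t:{..<T}. full_groups t \<inter> \<P>) - F"
          obtain t P where tP: "x = (t, P)" by (cases x)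
          have "(exact n P \<phi>) = {}"
            using base_nonempty[of t P n] x tP n by (auto simp: F_def full_groups_def)
          thus "?h (fst x) (snd x) = 0" using tP by (simp only: fst_conv snd_conv card.empty
              of_nat_0 mult_zero_right div_0)
        qed
      qed (auto simp: F_def finite_full_groups)
      also have "\<dots> = (\<Sum>x\<in>F. real (card (snd x)) / fact (fst x) * (?cnt \<phi> n (snd x) / real
          (mixcount (fst x) (snd x) n)) * growth (fst x) (snd x) n)"
      proof (rule sum.cong[OF refl])
        fix x
        show "?h (fst x) (snd x) = real (card (snd x)) / fact (fst x) * (?cnt \<phi> n (snd x) / real
            (mixcount (fst x) (snd x) n)) * growth (fst x) (snd x) n"
          using mixcount_pos[of "fst x" "snd x" n] by (simp add: growth_def)
      qed
      finally have "num_classes n (sat_class \<P> \<phi> n) / g n = (\<Sum>x\<in>F. real (card (snd x)) / fact (fst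
          x) * (?cnt \<phi> n (snd x) / real (mixcount (fst x) (snd x) n)) * growth (fst x) (snd x) n)
              / g n + tl n"
        by (simp only: add_divide_distrib tl_def)
      thus ?case by (simp add: sum_divide_distrib)
    qed
    from Lim_transform_eventually[OF tendsto_add[OF main tl0] this]
    show ?thesis by (simp add: w_def mult_ac)
  qed
  \<comment> \<open>All values the limit can take. A sentence only selects, for each group, an
    integer between 0 and \<open>card (base t P)\<close>, so \<open>L\<close> is finite and
    independent of the sentence.\<close>
  define L where "L = (\<lambda>b. \<Sum>x\<in>F. w x * real (b x)) ` (PiE F (\<lambda>x. {..card (base (fst x) (snd x))}))"
  define c where "c = (\<Sum>x\<in>F. w x * real (card (base (fst x) (snd x))))"
  have pg': "pgroup {1..fst x} (snd x)" if "x \<in> F" for x using pgF[of "fst x" "snd x"] that by simp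
  have "finite L" unfolding L_def by (intro finite_imageI finite_PiE finF) simp
  moreover have "L \<subseteq> \<rat>" unfolding L_def using wQ by (auto intro!: Rats_sum Rats_mult)
  moreover have "c \<in> \<rat>" unfolding c_def using wQ by (auto intro!: Rats_sum Rats_mult)
  \<comment> \<open>The dominating group contributes with \<open>q = 1\<close> and nonempty
    \<open>base\<close>, and no term is negative.\<close>
  moreover have "c > 0" unfolding c_def
  proof (rule sum_pos2[OF finF d(1)])
    have "P' \<in> full_groups t' \<inter> \<P>" "base t' P' \<noteq> {}" using d(1) by (auto simp: F_def)
    hence "card P' > 0" "card (base t' P') > 0"
      using pgroup_finite[OF pg] pgroup_id[OF pg] finite_base[of t' P'] by (auto simp: card_gt_0_iff)
    thus "0 < w (t', P') * real (card (base (fst (t', P')) (snd (t', P'))))" by (simp add: w_def q_self)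
    show "0 \<le> w x * real (card (base (fst x) (snd x)))" if "x \<in> F" for x
      using q_nonneg[OF that] by (simp add: w_def)
  qed
  moreover have "(\<lambda>n. num_classes n (aut_class \<P> n) / g n) \<longlonglongrightarrow> c"
    unfolding c_def sat_class_true[symmetric] by (rule lim[OF group_limit_all[OF pg']])
  moreover have "\<exists>a\<in>L. (\<lambda>n. num_classes n (sat_class \<P> \<phi> n) / g n) \<longlonglongrightarrow> a" if \<phi>: "is_sentence ar \<phi>" for \<phi>
  proof -
    have "\<forall>x\<in>F. \<exists>b::nat. b \<le> card (base (fst x) (snd x)) \<and> (\<lambda>n. ?cnt \<phi> n (snd x) / real (mixcount
        (fst x) (snd x) n)) \<longlonglongrightarrow> real b"
      using group_limit[OF pg' \<phi>] by blast
    from bchoice[OF this] obtain b :: "nat \<times> (nat \<Rightarrow> nat) set \<Rightarrow> nat" where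
      b: "\<forall>x\<in>F. b x \<le> card (base (fst x) (snd x)) \<and> (\<lambda>n. ?cnt \<phi> n (snd x) / real (mixcount (fst x)
          (snd x) n)) \<longlonglongrightarrow> real (b x)" ..
    have "restrict b F \<in> PiE F (\<lambda>x. {..card (base (fst x) (snd x))})" using b by auto
    hence "(\<Sum>x\<in>F. w x * real (restrict b F x)) \<in> L" unfolding L_def by blast
    moreover have "(\<lambda>n. num_classes n (sat_class \<P> \<phi> n) / g n) \<longlonglongrightarrow> (\<Sum>x\<in>F. w x * real (restrict b F x))"
      by (rule lim) (use b in simp)
    ultimately show ?thesis by blast
  qed
  ultimately show ?thesis unfolding g_def using pgF[OF d(1)] by blast
qed

section \<open>Limits of quotients of class counts\<close>

lemma has_limit_cong:
  assumes "eventually (\<lambda>n. f n = g n) sequentially" "has_limit_in_Rats_or_infinity f"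
  shows "has_limit_in_Rats_or_infinity g"
  using assms tendsto_cong[OF assms(1)] filterlim_cong[OF refl refl assms(1)]
  unfolding has_limit_in_Rats_or_infinity_def by blast

lemma ratio_has_limit:
  assumes "conj_closed \<P>" "conj_closed \<P>'"
  shows "has_limit_in_Rats_or_infinity (\<lambda>n. num_classes n (aut_class \<P> n) / num_classes n
      (aut_class \<P>' n))"
proof -
  \<comment> \<open>If one of the counts vanishes for each \<open>n \<ge> 1\<close>, the quotient is
    0, also for a vanishing denominator, since division by 0 gives 0.\<close>
  have zero: ?thesis if "\<And>n. n \<ge> 1 \<Longrightarrow> num_classes n (aut_class \<P> n) = 0 \<or> num_classes n (aut_class
      \<P>' n) = 0"
  proof (rule has_limit_cong[of "\<lambda>_. 0"])
    show "eventually (\<lambda>n. 0 = num_classes n (aut_class \<P> n) / num_classes n (aut_class \<P>' n))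
        sequentially"
      using eventually_ge_at_top[of 1] by eventually_elim (use that in auto)
    show "has_limit_in_Rats_or_infinity (\<lambda>_. 0)"
      unfolding has_limit_in_Rats_or_infinity_def using tendsto_const Rats_0 by blast
  qed
  show ?thesis
  proof (cases "(\<forall>n\<ge>1. \<forall>\<phi>. num_classes n (sat_class \<P> \<phi> n) = 0) \<or> (\<forall>n\<ge>1. \<forall>\<phi>. num_classes n
      (sat_class \<P>' \<phi> n) = 0)")
    case True
    hence "num_classes n (aut_class \<P> n) = 0 \<or> num_classes n (aut_class \<P>' n) = 0" if "n \<ge> 1" for n
      using that sat_class_true[of \<P> n] sat_class_true[of \<P>' n] by metis
    thus ?thesis by (rule zero)
  next
    case False
    obtain t P c where 1: "pgroup {1..t} P" "c \<in> \<rat>" "c > 0" "(\<lambda>n. num_classes n (aut_class \<P> n) /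
        growth t P n) \<longlonglongrightarrow> c"
      using class_asymptotics[OF assms(1)] False by blast
    obtain t' P' c' where 2: "pgroup {1..t'} P'" "c' \<in> \<rat>" "c' > 0" "(\<lambda>n. num_classes n (aut_class
        \<P>' n) / growth t' P' n) \<longlonglongrightarrow> c'"
      using class_asymptotics[OF assms(2)] False by blast
    have cc: "(\<lambda>n. num_classes n (aut_class \<P> n) / growth t P n / (num_classes n (aut_class \<P>' n)
        / growth t' P' n)) \<longlonglongrightarrow> c / c'"
      by (rule tendsto_divide[OF 1(4) 2(4)]) (use 2(3) in simp)
    have eq: "num_classes n (aut_class \<P> n) / growth t P n / (num_classes n (aut_class \<P>' n) /
        growth t' P' n) * (growth t P n / growth t' P' n)
        = num_classes n (aut_class \<P> n) / num_classes n (aut_class \<P>' n)" for n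
      using growth_pos[of t P n] growth_pos[of t' P' n] by simp
    consider r where "r \<in> \<rat>" "(\<lambda>n. growth t P n / growth t' P' n) \<longlonglongrightarrow> r"
      | "filterlim (\<lambda>n. growth t P n / growth t' P' n) at_top sequentially"
      using growth_ratio[OF 1(1) 2(1)] unfolding has_limit_in_Rats_or_infinity_def by blast
    thus ?thesis
    proof cases
      case 1
      have "(\<lambda>n. num_classes n (aut_class \<P> n) / num_classes n (aut_class \<P>' n)) \<longlonglongrightarrow> c / c' * r"
        using tendsto_mult[OF cc 1(2)] by (simp only: eq)
      moreover have "c / c' * r \<in> \<rat>" using \<open>c \<in> \<rat>\<close> \<open>c' \<in> \<rat>\<close> 1(1) by simp
      ultimately show ?thesis unfolding has_limit_in_Rats_or_infinity_def by blast
    next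
      case 2
      have "c / c' > 0" using \<open>c > 0\<close> \<open>c' > 0\<close> by simp
      from filterlim_tendsto_pos_mult_at_top[OF cc this 2]
      show ?thesis unfolding has_limit_in_Rats_or_infinity_def by (intro disjI2) (simp only: eq)
    qed
  qed
qed

text \<open>Numerator and denominator are compared with the same growth function, and the
  denominator has the positive limit \<open>c\<close>; the possible limits are the members of
  \<open>L\<close> divided by \<open>c\<close>.\<close>

lemma sentence_limits:
  assumes "conj_closed \<P>"
  shows "\<exists>L\<subseteq>\<rat>. finite L \<and> (\<forall>\<phi>. is_sentence ar \<phi> \<longrightarrow>
    (\<exists>q\<in>L. (\<lambda>n. num_classes n (sat_class \<P> \<phi> n) / num_classes n (aut_class \<P> n)) \<longlonglongrightarrow> q))"
proof (cases "\<forall>n\<ge>1. \<forall>\<phi>. num_classes n (sat_class \<P> \<phi> n) = 0")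
  \<comment> \<open>An empty class: every quotient is 0/0 = 0, so \<open>{0}\<close> serves as the
    set of limits.\<close>
  case True
  have "(\<lambda>n. num_classes n (sat_class \<P> \<phi> n) / num_classes n (aut_class \<P> n)) \<longlonglongrightarrow> 0" for \<phi>
  proof (rule Lim_transform_eventually[OF tendsto_const])
    show "eventually (\<lambda>n. 0 = num_classes n (sat_class \<P> \<phi> n) / num_classes n (aut_class \<P> n))
        sequentially"
      using eventually_ge_at_top[of 1] by eventually_elim (use True in simp)
  qed
  thus ?thesis by (intro exI[of _ "{0}"]) simp
next
  case False
  obtain t P c L where L: "pgroup {1..t} P" "c \<in> \<rat>" "c > 0" "(\<lambda>n. num_classes n (aut_class \<P> n) /
      growth t P n) \<longlonglongrightarrow> c"
    "finite L" "L \<subseteq> \<rat>" "\<And>\<phi>. is_sentence ar \<phi> \<Longrightarrow> \<exists>a\<in>L. (\<lambda>n. num_classes n (sat_class \<P> \<phi> n) / growth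
        t P n) \<longlonglongrightarrow> a"
    using class_asymptotics[OF assms] False by blast
  have "\<exists>q\<in>(\<lambda>a. a / c) ` L. (\<lambda>n. num_classes n (sat_class \<P> \<phi> n) / num_classes n (aut_class \<P> n))
      \<longlonglongrightarrow> q" if \<phi>: "is_sentence ar \<phi>" for \<phi>
  proof -
    obtain a where a: "a \<in> L" "(\<lambda>n. num_classes n (sat_class \<P> \<phi> n) / growth t P n) \<longlonglongrightarrow> a" using
        L(7)[OF \<phi>] by blast
    have "(\<lambda>n. num_classes n (sat_class \<P> \<phi> n) / growth t P n / (num_classes n (aut_class \<P> n) /
        growth t P n)) \<longlonglongrightarrow> a / c"
      by (rule tendsto_divide[OF a(2) L(4)]) (use L(3) in simp)
    moreover have "num_classes n (sat_class \<P> \<phi> n) / growth t P n / (num_classes n (aut_class \<P> n)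
        / growth t P n) = num_classes n (sat_class \<P> \<phi> n) / num_classes n (aut_class \<P> n)" for n
      using growth_pos[of t P n] by simp
    ultimately have "(\<lambda>n. num_classes n (sat_class \<P> \<phi> n) / num_classes n (aut_class \<P> n)) \<longlonglongrightarrow> a /
        c" by (simp only:)
    thus ?thesis using a(1) by blast
  qed
  moreover have "(\<lambda>a. a / c) ` L \<subseteq> \<rat>" using L(2,6) by auto
  ultimately show ?thesis using L(5) by (intro exI[of _ "(\<lambda>a. a / c) ` L"]) simp
qed

section \<open>Translation to classes given by \<open>Aut\<close>, \<open>spt\<close> and
  \<open>spt_star\<close>\<close>

lemma Aut_perm_monoid: "A \<subseteq> tup n \<Longrightarrow> Aut (mk_struct n A) = perm_monoid (autg n A)"
  by (simp add: Aut_eq perm_monoid_def)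

lemma Structs_n_aut_class:
  assumes "\<And>A. A \<subseteq> tup n \<Longrightarrow> Q (mk_struct n A) \<longleftrightarrow> autg n A \<in> \<P>"
  shows "{M \<in> Structs_n ar n. Q M} = mk_struct n ` aut_class \<P> n"
  unfolding Structs_n_eq aut_class_def using assms by auto

lemma spt_star_eq: "A \<subseteq> tup n \<Longrightarrow> spt_star (mk_struct n A) = card (supp (autg n A))"
proof -
  assume A: "A \<subseteq> tup n"
  have "{a \<in> {1..n}. \<exists>f \<in> autg n A. f a \<noteq> a} = supp (autg n A)"
    using supp_autg[of n A] unfolding supp_def by blast
  thus ?thesis using A by (simp add: spt_star_def carrier_Aut)
qed

lemma spt_eq:
  assumes A: "A \<subseteq> tup n" shows "spt (mk_struct n A) = max_supp (autg n A)"
proof -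
  have "{spt_perms (univ (mk_struct n A)) {f} |f. f \<in> carrier (Aut (mk_struct n A))} = (\<lambda>p. card
      {a. p a \<noteq> a}) ` autg n A"
    unfolding carrier_Aut[OF A] mk_struct_simps
    using spt_perms_single[OF autgD(1)] by (auto simp: image_iff) metis+
  thus ?thesis by (simp only: spt_def max_supp_def)
qed

lemma conj_closed_iso: "conj_closed {P. G \<cong> perm_monoid P}"
  unfolding conj_closed_def using isomorphic_conj by blast

lemma conj_closed_embeds: "conj_closed {P. embeds_in G (perm_monoid P)}"
  unfolding conj_closed_def using embeds_conj by blast

lemma conj_closed_supp: "conj_closed {P. Q (card (supp P))}"
  unfolding conj_closed_def by (auto simp only: mem_Collect_eq card_supp_conj)

lemma conj_closed_max_supp: "conj_closed {P. Q (max_supp P)}"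
  unfolding conj_closed_def by (auto simp only: mem_Collect_eq max_supp_conj)

lemma class_ratio_has_limit:
  assumes "\<And>n A. A \<subseteq> tup n \<Longrightarrow> Q (mk_struct n A) \<longleftrightarrow> autg n A \<in> \<P>"
    and "\<And>n A. A \<subseteq> tup n \<Longrightarrow> Q' (mk_struct n A) \<longleftrightarrow> autg n A \<in> \<P>'"
    and "conj_closed \<P>" "conj_closed \<P>'"
  shows "has_limit_in_Rats_or_infinity (\<lambda>n. class_ratio ar {M \<in> Structs_n ar n. Q M} {M \<in>
      Structs_n ar n. Q' M})"
  using ratio_has_limit[OF assms(3,4)]
  by (simp only: Structs_n_aut_class[OF assms(1)] Structs_n_aut_class[OF assms(2)] class_ratio_def
      num_classes_def)

lemma class_ratio_sentence_limits:
  assumes Q: "\<And>n A. A \<subseteq> tup n \<Longrightarrow> Q (mk_struct n A) \<longleftrightarrow> autg n A \<in> \<P>"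
    and "conj_closed \<P>" and S': "S' = {M \<in> Structs ar. Q M}"
  shows "\<exists>L\<subseteq>\<rat>. finite L \<and> (\<forall>\<phi>. is_sentence ar \<phi> \<longrightarrow>
    (\<exists>q\<in>L. (\<lambda>n. class_ratio ar {M \<in> S' \<inter> Structs_n ar n. models M \<phi>} (S' \<inter> Structs_n ar n)) \<longlonglongrightarrow> q))"
proof -
  have S'n: "S' \<inter> Structs_n ar n = mk_struct n ` aut_class \<P> n" if "n \<ge> 1" for n
  proof -
    have "S' \<inter> Structs_n ar n = {M \<in> Structs_n ar n. Q M}"
      using that unfolding S' Structs_def by auto
    thus ?thesis using Structs_n_aut_class[OF Q] by simp
  qed
  have ev: "eventually (\<lambda>n. num_classes n (sat_class \<P> \<phi> n) / num_classes n (aut_class \<P> n) =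
      class_ratio ar {M \<in> S' \<inter> Structs_n ar n. models M \<phi>} (S' \<inter> Structs_n ar n)) sequentially" for \<phi>
    using eventually_ge_at_top[of 1]
  proof eventually_elim
    case (elim n)
    have "{M \<in> mk_struct n ` aut_class \<P> n. models M \<phi>} = mk_struct n ` sat_class \<P> \<phi> n"
      by (auto simp: sat_class_def)
    thus ?case using S'n[OF elim] by (simp only: class_ratio_def num_classes_def)
  qed
  obtain L where L: "L \<subseteq> \<rat>" "finite L" "\<And>\<phi>. is_sentence ar \<phi> \<Longrightarrow>
      \<exists>q\<in>L. (\<lambda>n. num_classes n (sat_class \<P> \<phi> n) / num_classes n (aut_class \<P> n)) \<longlonglongrightarrow> q"
    using sentence_limits[OF assms(2)] by blast
  show ?thesis
  proof (intro exI[of _ L] conjI L(1,2) allI impI)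
    fix \<phi> assume "is_sentence ar \<phi>"
    then obtain q where q: "q \<in> L" "(\<lambda>n. num_classes n (sat_class \<P> \<phi> n) / num_classes n
        (aut_class \<P> n)) \<longlonglongrightarrow> q" using L(3) by blast
    from Lim_transform_eventually[OF q(2) ev] q(1)
    show "\<exists>q\<in>L. (\<lambda>n. class_ratio ar {M \<in> S' \<inter> Structs_n ar n. models M \<phi>} (S' \<inter> Structs_n ar n)) \<longlonglongrightarrow> q" ..
  qed
qed

end

theorem theorem1p3:
  fixes ar :: "'i::finite \<Rightarrow> nat"
  assumes max_arity: "Max (range ar) \<ge> 2"
  shows
    "(\<forall>(G :: 'g monoid) (H :: 'h monoid).
        group G \<and> finite (carrier G) \<and> group H \<and> finite (carrier H) \<longrightarrow>
          has_limit_in_Rats_or_infinity (\<lambda>n. class_ratio ar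
             {M \<in> Structs_n ar n. embeds_in H (Aut M)} {M \<in> Structs_n ar n. embeds_in G (Aut M)}) \<and>
          has_limit_in_Rats_or_infinity (\<lambda>n. class_ratio ar
             {M \<in> Structs_n ar n. H \<cong> Aut M} {M \<in> Structs_n ar n. G \<cong> Aut M}) \<and>
          has_limit_in_Rats_or_infinity (\<lambda>n. class_ratio ar
             {M \<in> Structs_n ar n. G \<cong> Aut M} {M \<in> Structs_n ar n. embeds_in G (Aut M)}))
     \<and>
     (\<forall>S'.
        (\<exists>G :: 'g monoid. group G \<and> finite (carrier G) \<and>
           (S' = {M \<in> Structs ar. G \<cong> Aut M} \<or> S' = {M \<in> Structs ar. embeds_in G (Aut M)})) \<or>
        (\<exists>m \<ge> 2. S' = {M \<in> Structs ar. spt_star M = m} \<or>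
                  S' = {M \<in> Structs ar. spt M \<ge> m} \<or>
                  S' = {M \<in> Structs ar. spt_star M \<ge> m}) \<longrightarrow>
        (\<exists>A \<subseteq> \<rat>. finite A \<and>
           (\<forall>\<phi>. is_sentence ar \<phi> \<longrightarrow>
              (\<exists>q \<in> A. (\<lambda>n. class_ratio ar
                  {M \<in> S' \<inter> Structs_n ar n. models M \<phi>} (S' \<inter> Structs_n ar n)) \<longlonglongrightarrow> q))))"
proof -
  interpret vocabulary ar by unfold_locales (rule max_arity)
  \<comment> \<open>Stated for an arbitrary carrier type, because \<open>G\<close> and
    \<open>H\<close> have different ones.\<close>
  have iso: "G \<cong> Aut (mk_struct n A) \<longleftrightarrow> autg n A \<in> {P. G \<cong> perm_monoid P}"
    if "A \<subseteq> tup n" for G :: "'x monoid" and n A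
    by (simp add: Aut_perm_monoid[OF that])
  have emb: "embeds_in G (Aut (mk_struct n A)) \<longleftrightarrow> autg n A \<in> {P. embeds_in G (perm_monoid P)}"
    if "A \<subseteq> tup n" for G :: "'x monoid" and n A
    by (simp add: Aut_perm_monoid[OF that])
  show ?thesis
  proof (intro conjI allI impI)
    fix G :: "'g monoid" and H :: "'h monoid"
    show "has_limit_in_Rats_or_infinity (\<lambda>n. class_ratio ar
       {M \<in> Structs_n ar n. embeds_in H (Aut M)} {M \<in> Structs_n ar n. embeds_in G (Aut M)})"
      by (rule class_ratio_has_limit[OF emb emb conj_closed_embeds conj_closed_embeds])
    show "has_limit_in_Rats_or_infinity (\<lambda>n. class_ratio ar
       {M \<in> Structs_n ar n. H \<cong> Aut M} {M \<in> Structs_n ar n. G \<cong> Aut M})"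
      by (rule class_ratio_has_limit[OF iso iso conj_closed_iso conj_closed_iso])
    show "has_limit_in_Rats_or_infinity (\<lambda>n. class_ratio ar
       {M \<in> Structs_n ar n. G \<cong> Aut M} {M \<in> Structs_n ar n. embeds_in G (Aut M)})"
      by (rule class_ratio_has_limit[OF iso emb conj_closed_iso conj_closed_embeds])
  next
    fix S' :: "('i, nat) rel_structure set"
    assume "(\<exists>G :: 'g monoid. group G \<and> finite (carrier G) \<and>
           (S' = {M \<in> Structs ar. G \<cong> Aut M} \<or> S' = {M \<in> Structs ar. embeds_in G (Aut M)})) \<or>
        (\<exists>m \<ge> 2. S' = {M \<in> Structs ar. spt_star M = m} \<or>
                  S' = {M \<in> Structs ar. spt M \<ge> m} \<or>
                  S' = {M \<in> Structs ar. spt_star M \<ge> m})"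
    then consider G :: "'g monoid" where "S' = {M \<in> Structs ar. G \<cong> Aut M}"
      | G :: "'g monoid" where "S' = {M \<in> Structs ar. embeds_in G (Aut M)}"
      | m where "S' = {M \<in> Structs ar. spt_star M = m}"
      | m where "S' = {M \<in> Structs ar. spt M \<ge> m}"
      | m where "S' = {M \<in> Structs ar. spt_star M \<ge> m}" by blast
    thus "\<exists>A\<subseteq>\<rat>. finite A \<and> (\<forall>\<phi>. is_sentence ar \<phi> \<longrightarrow>
              (\<exists>q \<in> A. (\<lambda>n. class_ratio ar
                  {M \<in> S' \<inter> Structs_n ar n. models M \<phi>} (S' \<inter> Structs_n ar n)) \<longlonglongrightarrow> q))"
    proof cases
      case 1
      show ?thesis by (rule class_ratio_sentence_limits[OF iso conj_closed_iso 1])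
    next
      case 2
      show ?thesis by (rule class_ratio_sentence_limits[OF emb conj_closed_embeds 2])
    next
      case (3 m)
      show ?thesis
        by (rule class_ratio_sentence_limits[OF _ conj_closed_supp[of "\<lambda>k. k = m"] 3]) (simp add:
            spt_star_eq)
    next
      case (4 m)
      show ?thesis
        by (rule class_ratio_sentence_limits[OF _ conj_closed_max_supp[of "\<lambda>k. k \<ge> m"] 4]) (simp
            add: spt_eq)
    next
      case (5 m)
      show ?thesis
        by (rule class_ratio_sentence_limits[OF _ conj_closed_supp[of "\<lambda>k. k \<ge> m"] 5]) (simp add:
            spt_star_eq)
    qed
  qed
qed

end
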